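(* The following statements hold. (i) Let $G$ be a normal subgroup of a group $\Pi$ and let $Q=\Pi/G$. (a) If $Q$ is a cut-group and $G\cap\Phi^+(\Pi)=\{1\}$ (in particular, if $Q$ is a cut-group and $\Phi^+(G)=\{1\}$), then $\Pi$ is a cut-group. (b) If $\Phi^+(Q)=\{1\}$ and $\Phi^+(G)$ is an RS-subgroup of $\Pi$ (in particular, if $\Phi^+(Q)=\{1\}$ and $G$ is a cut-group), then $\Pi$ is a cut-group. (ii) If $\Pi=G\ast_A G'$ is an amalgam (amalgamated free product) of arbitrary groups $G$ and $G'$ whose amalgamated subgroup $A$ is an RS-subgroup of $G$ or of $G'$, then $\Pi$ is a cut-group, provided $A\neq G$ and $A\neq G'$. In particular, the free product of arbitrary non-trivial groups (with at least two factors) is a cut-group. (iii) If $\Pi$ is an HNN extension of a group $G$ over isomorphic subgroups $A$ and $B$ of $G$ such that one of $A$ or $B$ is an RS-subgroup of $G$, then $\Pi$ is a cut-group.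
   Context: For a group $G$ (possibly infinite), $\mathcal{U}(\mathbb{Z}[G])$ is the group of units of the integral group ring $\mathbb{Z}[G]$ and $\mathcal{Z}(\cdot)$ denotes the center of a group. $G$ is called a cut-group if $\mathcal{Z}(\mathcal{U}(\mathbb{Z}[G]))=\pm\mathcal{Z}(G)$. $\Phi(G)$ denotes the FC-subgroup of $G$, i.e. the subgroup of elements having only finitely many conjugates in $G$, and $\Phi^+(G)$ denotes the torsion subgroup of $\Phi(G)$. Write $y\sim_G z$ if $y$ and $z$ are conjugate in $G$, let $o(x)$ denote the order of $x$, and let $U(n)=\{j : 1\le j\le n,\ \gcd(j,n)=1\}$. An element $x\in G$ of finite order is an RS-element in $G$ if for every $j\in U(o(x))$ one has $x^j\sim_G x$ or $x^j\sim_G x^{-1}$. A subgroup $A$ of $G$ is an RS-subgroup of $G$ if every torsion element of $A$ is an RS-element in $G$. *)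

theory Defs
  imports "HOL-Algebra.Algebra" "HOL-Number_Theory.Totient"
begin

section \<open>Integral group rings and cut-groups\<close>

text \<open>Elements of the integral group ring are the finitely supported integer-valued
  functions on the group, with convolution as multiplication.\<close>

definition group_ring :: "('a, 'm) monoid_scheme \<Rightarrow> ('a \<Rightarrow> int) ring" where
  "group_ring G =
    \<lparr> carrier = {f. finite {x. f x \<noteq> 0} \<and> {x. f x \<noteq> 0} \<subseteq> carrier G},
      monoid.mult = (\<lambda>f g x. \<Sum>y | f y \<noteq> 0. \<Sum>z | g z \<noteq> 0 \<and> y \<otimes>\<^bsub>G\<^esub> z = x. f y * g z),
      monoid.one = (\<lambda>x. if x = \<one>\<^bsub>G\<^esub> then 1 else 0),
      ring.zero = (\<lambda>x. 0),
      ring.add = (\<lambda>f g x. f x + g x) \<rparr>"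

text \<open>The group element \<open>g\<close> is identified with \<open>gr_monom 1 g\<close>, and \<open>- g\<close> with
  \<open>gr_monom (- 1) g\<close>.\<close>

definition gr_monom :: "int \<Rightarrow> 'a \<Rightarrow> 'a \<Rightarrow> int" where
  "gr_monom c g = (\<lambda>x. if x = g then c else 0)"

definition group_center :: "('a, 'm) monoid_scheme \<Rightarrow> 'a set" where
  "group_center G = {z \<in> carrier G. \<forall>x\<in>carrier G. z \<otimes>\<^bsub>G\<^esub> x = x \<otimes>\<^bsub>G\<^esub> z}"

definition cut_group :: "('a, 'm) monoid_scheme \<Rightarrow> bool" where
  "cut_group G \<longleftrightarrow>
     group_center (units_of (group_ring G)) = {gr_monom e z |e z. e \<in> {1, -1} \<and> z \<in> group_center G}"

section \<open>The FC-subgroup and RS-subgroups\<close>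

definition conj_in :: "('a, 'm) monoid_scheme \<Rightarrow> 'a \<Rightarrow> 'a \<Rightarrow> bool" where
  "conj_in G y z \<longleftrightarrow> (\<exists>g\<in>carrier G. z = g \<otimes>\<^bsub>G\<^esub> y \<otimes>\<^bsub>G\<^esub> inv\<^bsub>G\<^esub> g)"

definition torsion_elt :: "('a, 'm) monoid_scheme \<Rightarrow> 'a \<Rightarrow> bool" where
  "torsion_elt G x \<longleftrightarrow> (\<exists>n::nat. n > 0 \<and> x [^]\<^bsub>G\<^esub> n = \<one>\<^bsub>G\<^esub>)"

definition FC_subgroup :: "('a, 'm) monoid_scheme \<Rightarrow> 'a set" where
  "FC_subgroup G = {x \<in> carrier G. finite {y. conj_in G x y}}"

definition FC_torsion :: "('a, 'm) monoid_scheme \<Rightarrow> 'a set" where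
  "FC_torsion G = {x \<in> FC_subgroup G. torsion_elt G x}"

definition RS_element :: "('a, 'm) monoid_scheme \<Rightarrow> 'a \<Rightarrow> bool" where
  "RS_element G x \<longleftrightarrow> x \<in> carrier G \<and> torsion_elt G x \<and>
     (\<forall>j \<in> totatives (group.ord G x).
        conj_in G (x [^]\<^bsub>G\<^esub> j) x \<or> conj_in G (x [^]\<^bsub>G\<^esub> j) (inv\<^bsub>G\<^esub> x))"

definition RS_subgroup :: "'a set \<Rightarrow> ('a, 'm) monoid_scheme \<Rightarrow> bool" where
  "RS_subgroup A G \<longleftrightarrow> subgroup A G \<and> (\<forall>x\<in>A. torsion_elt G x \<longrightarrow> RS_element G x)"

section \<open>Groups given by generators and relations\<close>

text \<open>A word is a list of letters \<open>(s, True)\<close> and \<open>(s, False)\<close>, the latter standing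
  for the inverse of the generator \<open>s\<close>. A pair \<open>(u, v)\<close> of words is read as the
  relation \<open>u = v\<close>.\<close>

type_synonym 's word = "('s \<times> bool) list"

definition words :: "'s set \<Rightarrow> 's word set" where
  "words S = lists (S \<times> UNIV)"

inductive word_eq :: "'s set \<Rightarrow> ('s word \<times> 's word) set \<Rightarrow> 's word \<Rightarrow> 's word \<Rightarrow> bool"
  for S R where
  rel: "(u, v) \<in> R \<Longrightarrow> u \<in> words S \<Longrightarrow> v \<in> words S \<Longrightarrow> word_eq S R u v"
| cancel: "s \<in> S \<Longrightarrow> word_eq S R [(s, b), (s, \<not> b)] []"
| refl: "u \<in> words S \<Longrightarrow> word_eq S R u u"
| sym: "word_eq S R u v \<Longrightarrow> word_eq S R v u"
| trans: "word_eq S R u v \<Longrightarrow> word_eq S R v w \<Longrightarrow> word_eq S R u w"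
| cong: "word_eq S R u v \<Longrightarrow> word_eq S R u' v' \<Longrightarrow> word_eq S R (u @ u') (v @ v')"

definition word_class :: "'s set \<Rightarrow> ('s word \<times> 's word) set \<Rightarrow> 's word \<Rightarrow> 's word set" where
  "word_class S R u = {v. word_eq S R u v}"

definition presented_group ::
    "'s set \<Rightarrow> ('s word \<times> 's word) set \<Rightarrow> 's word set monoid" where
  "presented_group S R =
    \<lparr> carrier = word_class S R ` words S,
      monoid.mult = (\<lambda>U V. \<Union>u\<in>U. \<Union>v\<in>V. word_class S R (u @ v)),
      monoid.one = word_class S R [] \<rparr>"

text \<open>Imposing the multiplication table of \<open>G\<close> on the generators \<open>\<iota> x\<close> also forces
  \<open>\<iota> \<one> = 1\<close>, since every generator is invertible.\<close>

definition mult_table :: "('a \<Rightarrow> 's) \<Rightarrow> ('a, 'm) monoid_scheme \<Rightarrow> ('s word \<times> 's word) set" where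
  "mult_table \<iota> G =
    {([(\<iota> x, True), (\<iota> y, True)], [(\<iota> (x \<otimes>\<^bsub>G\<^esub> y), True)]) |x y. x \<in> carrier G \<and> y \<in> carrier G}"

definition free_product :: "'i set \<Rightarrow> ('i \<Rightarrow> ('a, 'm) monoid_scheme) \<Rightarrow> ('i \<times> 'a) word set monoid" where
  "free_product I G =
    presented_group (SIGMA i:I. carrier (G i)) (\<Union>i\<in>I. mult_table (Pair i) (G i))"

text \<open>The amalgamated subgroup sits as \<open>A\<close> in \<open>G\<close> and as \<open>f ` A\<close> in \<open>G'\<close>.\<close>

definition amalgam ::
    "('a, 'm) monoid_scheme \<Rightarrow> ('b, 'n) monoid_scheme \<Rightarrow> 'a set \<Rightarrow> ('a \<Rightarrow> 'b)
      \<Rightarrow> ('a + 'b) word set monoid" where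
  "amalgam G G' A f =
    presented_group (carrier G <+> carrier G')
      (mult_table Inl G \<union> mult_table Inr G' \<union> {([(Inl a, True)], [(Inr (f a), True)]) |a. a \<in> A})"

text \<open>The stable letter \<open>t\<close> is \<open>None\<close>; the last set consists of the relations
  \<open>t\<inverse> a t = f a\<close> for \<open>a \<in> A\<close>.\<close>

definition HNN_extension ::
    "('a, 'm) monoid_scheme \<Rightarrow> 'a set \<Rightarrow> ('a \<Rightarrow> 'a) \<Rightarrow> 'a option word set monoid" where
  "HNN_extension G A f =
    presented_group (insert None (Some ` carrier G))
      (mult_table Some G \<union>
       {([(None, False), (Some a, True), (None, True)], [(Some (f a), True)]) |a. a \<in> A})"

end

theory Submission
  imports Defs "Jordan_Normal_Form.Schur_Decomposition"
begin

text \<open>Let \<open>u\<close> be a central unit of the integral group ring, \<open>u\<^sup>*\<close> its image under inversion of group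
  elements, and \<open>w = u u\<^sup>*\<close>. The coefficient of \<open>w\<close> at \<open>1\<close> is the sum of the squares of the coefficients of
  \<open>u\<close>, so \<open>u\<close> is trivial as soon as \<open>w = 1\<close>.

  The support of \<open>w\<close> lies in \<open>\<Phi>\<^sup>+\<close>: otherwise a homomorphism from a finitely generated subgroup of \<open>\<Phi>\<close> to
  the reals, nonzero on the support, gives a grading in which \<open>w\<close> is not homogeneous of degree \<open>0\<close>. A symmetric
  unit of the centre must have degree \<open>0\<close>, as the centre is reduced and has no idempotents besides \<open>0\<close> and \<open>1\<close>.
  In the quotient case \<open>w\<close> maps injectively to \<open>\<int>[Q]\<close>, and if \<open>\<Phi>\<^sup>+(Q) = 1\<close> then \<open>w\<close> is a central
  unit of \<open>\<int>[G]\<close>.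

  If \<open>\<Phi>\<^sup>+\<close> consists of RS-elements, \<open>w\<close> is constant on the generators of each finite cyclic subgroup, hence an
  integral combination of sums over cyclic subgroups. These are multiples of idempotents, so the power
  traces of \<open>w\<close> show that its eigenvalues on the group ring of a finite subgroup are rational. Being
  units of the ring of algebraic integers they are \<open>1\<close> or \<open>-1\<close>, so the trace of \<open>w\<^sup>2\<close> is that of the identity, and \<open>w = 1\<close>.

  For amalgams and HNN extensions, normal forms place \<open>\<Phi>\<^sup>+\<close> in the amalgamated subgroup.\<close>

section \<open>The integral group ring\<close>

text \<open>Passing to \<open>w\<close> is forced: a central \<open>u\<close> may be a group element
  of infinite order, so no degree argument applies to it. Symmetry of \<open>w\<close> pairs the
  degrees \<open>d\<close> and \<open>-d\<close>, and gives \<open>w\<close> equal values at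
  \<open>x\<close> and at its inverse, the very ambiguity that an RS-element allows. The reals serve
  as a divisible target, so that homomorphisms extend within an abelian group; a finitely generated
  subgroup of \<open>\<Phi>\<close> only has a centre of finite index, and the transfer bridges that
  gap. Rationality of the eigenvalues comes from linear algebra. The trace of
  \<open>w^(k+1) = w^k w\<close> is a rational combination of sequences \<open>s^k\<close>, since
  the sums of \<open>w^k\<close> over cyclic subgroups are; geometric sequences are linearly
  independent, and comparing coefficients shows multiplicity times eigenvalue to be rational. One
  normal form theorem serves amalgams, free products and HNN extensions: a factor \<open>G_i\<close>
  of an amalgam acts on the normal forms of a larger HNN extension as
  \<open>t_i^-1 G_i t_i\<close>.\<close>

lemma group_ring_carrier:
  "f \<in> carrier (group_ring G) \<longleftrightarrow> finite {x. f x \<noteq> 0} \<and> {x. f x \<noteq> 0} \<subseteq> carrier G"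
  by (simp add: group_ring_def)

lemma group_ring_finite_support [intro]:
  "f \<in> carrier (group_ring G) \<Longrightarrow> finite {x. f x \<noteq> 0}"
  by (simp add: group_ring_def)

lemma group_ring_nonzeroD:
  "f \<in> carrier (group_ring G) \<Longrightarrow> f x \<noteq> 0 \<Longrightarrow> x \<in> carrier G"
  by (auto simp: group_ring_def)

lemma group_ring_one: "\<one>\<^bsub>group_ring G\<^esub> = (\<lambda>x. if x = \<one>\<^bsub>G\<^esub> then 1 else 0)"
  by (simp add: group_ring_def)

lemma group_ring_mult:
  "(f \<otimes>\<^bsub>group_ring G\<^esub> g) x = (\<Sum>y | f y \<noteq> 0. \<Sum>z | g z \<noteq> 0 \<and> y \<otimes>\<^bsub>G\<^esub> z = x. f y * g z)"
  by (simp add: group_ring_def)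

lemma group_ring_mult_nonzeroD:
  assumes "(f \<otimes>\<^bsub>group_ring G\<^esub> g) x \<noteq> 0"
  shows "\<exists>y z. f y \<noteq> 0 \<and> g z \<noteq> 0 \<and> x = y \<otimes>\<^bsub>G\<^esub> z"
proof -
  obtain y where y: "f y \<noteq> 0" "(\<Sum>z | g z \<noteq> 0 \<and> y \<otimes>\<^bsub>G\<^esub> z = x. f y * g z) \<noteq> 0"
    using sum.not_neutral_contains_not_neutral[OF assms[unfolded group_ring_mult]] by blast
  then obtain z where "g z \<noteq> 0 \<and> y \<otimes>\<^bsub>G\<^esub> z = x"
    using sum.not_neutral_contains_not_neutral[OF y(2)] by blast
  with y(1) show ?thesis by blast
qed

definition supp_on :: "('a \<Rightarrow> int) \<Rightarrow> 'a set \<Rightarrow> 'a \<Rightarrow> int" where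
  "supp_on f S = (\<lambda>x. if x \<in> S then f x else 0)"

text \<open>Invariance is asked only under conjugation by \<open>H\<close>: the grading argument
  lives in a finitely generated subgroup and the trace argument in finite ones, and this much is
  what commuting with functions supported on \<open>H\<close> requires.\<close>

definition class_fun :: "('a, 'm) monoid_scheme \<Rightarrow> 'a set \<Rightarrow> ('a \<Rightarrow> int) \<Rightarrow> bool" where
  "class_fun G H f \<longleftrightarrow> (\<forall>h\<in>H. \<forall>x\<in>carrier G. f (h \<otimes>\<^bsub>G\<^esub> x \<otimes>\<^bsub>G\<^esub> inv\<^bsub>G\<^esub> h) = f x)"

text \<open>The canonical involution of the group ring, an anti-automorphism. The cut-off outside
  the carrier is there because \<open>inv\<close> is unspecified at such points.\<close>

definition gr_star :: "('a, 'm) monoid_scheme \<Rightarrow> ('a \<Rightarrow> int) \<Rightarrow> 'a \<Rightarrow> int" where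
  "gr_star G f = (\<lambda>x. if x \<in> carrier G then f (inv\<^bsub>G\<^esub> x) else 0)"

context group begin

abbreviation "ZG \<equiv> group_ring G"

lemma mult_inv_cancel_left [simp]:
  "y \<in> carrier G \<Longrightarrow> z \<in> carrier G \<Longrightarrow> inv y \<otimes> (y \<otimes> z) = z"
  "y \<in> carrier G \<Longrightarrow> z \<in> carrier G \<Longrightarrow> y \<otimes> (inv y \<otimes> z) = z"
  by (simp_all add: m_assoc [symmetric])

lemma mult_inv_cancel_right [simp]:
  "y \<in> carrier G \<Longrightarrow> z \<in> carrier G \<Longrightarrow> z \<otimes> inv y \<otimes> y = z"
  "y \<in> carrier G \<Longrightarrow> z \<in> carrier G \<Longrightarrow> z \<otimes> y \<otimes> inv y = z"
  by (simp_all add: m_assoc)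

text \<open>Given \<open>y\<close> and \<open>x\<close>, the equation \<open>y z = x\<close> has one
  solution, which collapses the double sum. \<open>S\<close> may be any finite set containing the
  support, so that sums for different functions can share an index set.\<close>

lemma gr_mult_left:
  assumes "g \<in> carrier ZG" "finite S" "{y. f y \<noteq> 0} \<subseteq> S" "S \<subseteq> carrier G" "x \<in> carrier G"
  shows "(f \<otimes>\<^bsub>ZG\<^esub> g) x = (\<Sum>y\<in>S. f y * g (inv y \<otimes> x))"
proof -
  have "(\<Sum>z | g z \<noteq> 0 \<and> y \<otimes> z = x. f y * g z) = f y * g (inv y \<otimes> x)" if y: "y \<in> carrier G" for y
  proof -
    have eq: "{z. g z \<noteq> 0 \<and> y \<otimes> z = x} = (if g (inv y \<otimes> x) \<noteq> 0 then {inv y \<otimes> x} else {})"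
      using y assms(5) group_ring_nonzeroD [OF assms(1)] by auto
    show ?thesis unfolding eq by simp
  qed
  then have "(f \<otimes>\<^bsub>ZG\<^esub> g) x = (\<Sum>y | f y \<noteq> 0. f y * g (inv y \<otimes> x))"
    unfolding group_ring_mult using assms(3,4) by (intro sum.cong) auto
  also have "\<dots> = (\<Sum>y\<in>S. f y * g (inv y \<otimes> x))"
    using assms by (intro sum.mono_neutral_left) auto
  finally show ?thesis .
qed

lemma gr_mult_right:
  assumes "f \<in> carrier ZG" "g \<in> carrier ZG"
    "finite S" "{y. g y \<noteq> 0} \<subseteq> S" "S \<subseteq> carrier G" "x \<in> carrier G"
  shows "(f \<otimes>\<^bsub>ZG\<^esub> g) x = (\<Sum>z\<in>S. f (x \<otimes> inv z) * g z)"
proof -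
  \<comment> \<open>The substitution \<open>y = x z^-1\<close> carries the right-hand sum to a
    left-hand one; outside this image the second factor vanishes.\<close>
  let ?S = "(\<lambda>z. x \<otimes> inv z) ` S"
  have fin: "finite ({y. f y \<noteq> 0} \<union> ?S)" "{y. f y \<noteq> 0} \<union> ?S \<subseteq> carrier G"
    using assms by (auto dest: group_ring_nonzeroD)
  have "(f \<otimes>\<^bsub>ZG\<^esub> g) x = (\<Sum>y\<in>{y. f y \<noteq> 0} \<union> ?S. f y * g (inv y \<otimes> x))"
    using assms fin by (intro gr_mult_left) auto
  also have "\<dots> = (\<Sum>y\<in>?S. f y * g (inv y \<otimes> x))"
  proof (rule sum.mono_neutral_right[OF fin(1)], blast, rule)
    fix y assume y: "y \<in> ({y. f y \<noteq> 0} \<union> ?S) - ?S"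
    then have yc: "y \<in> carrier G" using fin by auto
    have "g (inv y \<otimes> x) = 0"
    proof (rule ccontr)
      assume "g (inv y \<otimes> x) \<noteq> 0"
      then have "inv y \<otimes> x \<in> S" using assms by auto
      moreover have "x \<otimes> inv (inv y \<otimes> x) = y"
        using yc assms(6) by (simp add: inv_mult_group)
      ultimately have "y \<in> ?S" by (metis image_eqI)
      with y show False by blast
    qed
    then show "f y * g (inv y \<otimes> x) = 0" by simp
  qed
  also have "\<dots> = (\<Sum>z\<in>S. f (x \<otimes> inv z) * g z)"
  proof -
    have "inj_on (\<lambda>z. x \<otimes> inv z) S"
    proof (rule inj_onI)
      fix y z assume yz: "y \<in> S" "z \<in> S" "x \<otimes> inv y = x \<otimes> inv z"
      then have "y \<in> carrier G" "z \<in> carrier G" using assms(5) by auto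
      with yz(3) assms(6) have "inv (inv y) = inv (inv z)" by simp
      with \<open>y \<in> carrier G\<close> \<open>z \<in> carrier G\<close> show "y = z" by simp
    qed
    moreover have "inv (x \<otimes> inv z) \<otimes> x = z" if "z \<in> S" for z
      using assms(5,6) that by (auto simp: inv_mult_group m_assoc subset_iff)
    ultimately show ?thesis by (simp add: sum.reindex)
  qed
  finally show ?thesis .
qed

lemma gr_mult_closed:
  assumes "f \<in> carrier ZG" "g \<in> carrier ZG"
  shows "f \<otimes>\<^bsub>ZG\<^esub> g \<in> carrier ZG"
proof -
  have sub: "{x. (f \<otimes>\<^bsub>ZG\<^esub> g) x \<noteq> 0} \<subseteq> (\<lambda>(y, z). y \<otimes> z) ` ({y. f y \<noteq> 0} \<times> {z. g z \<noteq> 0})"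
  proof
    fix x assume "x \<in> {x. (f \<otimes>\<^bsub>ZG\<^esub> g) x \<noteq> 0}"
    then obtain y z where "f y \<noteq> 0" "g z \<noteq> 0" "x = y \<otimes> z"
      using group_ring_mult_nonzeroD[of G f g] by blast
    then show "x \<in> (\<lambda>(y, z). y \<otimes> z) ` ({y. f y \<noteq> 0} \<times> {z. g z \<noteq> 0})"
      by (intro image_eqI[of _ _ "(y, z)"]) auto
  qed
  moreover have "(\<lambda>(y, z). y \<otimes> z) ` ({y. f y \<noteq> 0} \<times> {z. g z \<noteq> 0}) \<subseteq> carrier G"
    using assms by (auto dest: group_ring_nonzeroD)
  moreover have "finite ((\<lambda>(y, z). y \<otimes> z) ` ({y. f y \<noteq> 0} \<times> {z. g z \<noteq> 0}))"
    using assms by (intro finite_imageI finite_cartesian_product) auto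
  ultimately show ?thesis
    unfolding group_ring_carrier by (meson finite_subset subset_trans)
qed

lemma gr_eqI:
  assumes "f \<in> carrier ZG" "g \<in> carrier ZG" "\<And>x. x \<in> carrier G \<Longrightarrow> f x = g x"
  shows "f = g"
  using assms(3) group_ring_nonzeroD[OF assms(1)] group_ring_nonzeroD[OF assms(2)] by (intro ext) metis

lemma gr_one_closed: "\<one>\<^bsub>ZG\<^esub> \<in> carrier ZG"
  by (auto simp: group_ring_carrier group_ring_one)

lemma monoid_group_ring: "monoid ZG"
proof
  fix f g h assume fgh: "f \<in> carrier ZG" "g \<in> carrier ZG" "h \<in> carrier ZG"
  have fh: "finite {x. f x \<noteq> 0}" "{x. f x \<noteq> 0} \<subseteq> carrier G"
    "finite {x. h x \<noteq> 0}" "{x. h x \<noteq> 0} \<subseteq> carrier G"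
    using fgh by (simp_all add: group_ring_carrier)
  show "f \<otimes>\<^bsub>ZG\<^esub> g \<otimes>\<^bsub>ZG\<^esub> h = f \<otimes>\<^bsub>ZG\<^esub> (g \<otimes>\<^bsub>ZG\<^esub> h)"
  proof (rule gr_eqI)
    fix x assume x: "x \<in> carrier G"
    have "(f \<otimes>\<^bsub>ZG\<^esub> g \<otimes>\<^bsub>ZG\<^esub> h) x = (\<Sum>z | h z \<noteq> 0. (f \<otimes>\<^bsub>ZG\<^esub> g) (x \<otimes> inv z) * h z)"
      using fgh fh x by (intro gr_mult_right gr_mult_closed) auto
    also have "\<dots> = (\<Sum>z | h z \<noteq> 0. (\<Sum>y | f y \<noteq> 0. f y * g (inv y \<otimes> (x \<otimes> inv z))) * h z)"
      using fgh fh x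
      by (intro sum.cong HOL.refl arg_cong2[of _ _ _ _ "(*)"] gr_mult_left)
         (auto dest: group_ring_nonzeroD)
    also have "\<dots> = (\<Sum>y | f y \<noteq> 0. \<Sum>z | h z \<noteq> 0. f y * (g (inv y \<otimes> (x \<otimes> inv z)) * h z))"
      by (subst sum.swap) (simp add: sum_distrib_right mult.assoc)
    also have "\<dots> = (\<Sum>y | f y \<noteq> 0. \<Sum>z | h z \<noteq> 0. f y * (g (inv y \<otimes> x \<otimes> inv z) * h z))"
      using fh x by (intro sum.cong HOL.refl) (auto simp: m_assoc subset_iff)
    also have "\<dots> = (\<Sum>y | f y \<noteq> 0. f y * (\<Sum>z | h z \<noteq> 0. g (inv y \<otimes> x \<otimes> inv z) * h z))"
      by (simp add: sum_distrib_left)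
    also have "\<dots> = (\<Sum>y | f y \<noteq> 0. f y * (g \<otimes>\<^bsub>ZG\<^esub> h) (inv y \<otimes> x))"
      using fgh fh x
      by (intro sum.cong HOL.refl arg_cong2[of _ _ _ _ "(*)"] gr_mult_right[symmetric])
         (auto dest: group_ring_nonzeroD)
    also have "\<dots> = (f \<otimes>\<^bsub>ZG\<^esub> (g \<otimes>\<^bsub>ZG\<^esub> h)) x"
      using fgh fh x by (intro gr_mult_left[symmetric] gr_mult_closed) auto
    finally show "(f \<otimes>\<^bsub>ZG\<^esub> g \<otimes>\<^bsub>ZG\<^esub> h) x = (f \<otimes>\<^bsub>ZG\<^esub> (g \<otimes>\<^bsub>ZG\<^esub> h)) x" .
  qed (use fgh in \<open>auto intro!: gr_mult_closed\<close>)
next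
  fix f assume f: "f \<in> carrier ZG"
  show "\<one>\<^bsub>ZG\<^esub> \<otimes>\<^bsub>ZG\<^esub> f = f"
  proof (rule gr_eqI)
    fix x assume x: "x \<in> carrier G"
    show "(\<one>\<^bsub>ZG\<^esub> \<otimes>\<^bsub>ZG\<^esub> f) x = f x"
      using gr_mult_left[OF f, of "{\<one>}" "\<one>\<^bsub>ZG\<^esub>" x] x by (simp add: group_ring_one)
  qed (use f in \<open>auto intro!: gr_mult_closed gr_one_closed\<close>)
  show "f \<otimes>\<^bsub>ZG\<^esub> \<one>\<^bsub>ZG\<^esub> = f"
  proof (rule gr_eqI)
    fix x assume x: "x \<in> carrier G"
    show "(f \<otimes>\<^bsub>ZG\<^esub> \<one>\<^bsub>ZG\<^esub>) x = f x"
      using gr_mult_right[OF f gr_one_closed, of "{\<one>}" x] x by (simp add: group_ring_one)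
  qed (use f in \<open>auto intro!: gr_mult_closed gr_one_closed\<close>)
qed (auto intro: gr_mult_closed gr_one_closed)

interpretation ZG: monoid ZG by (rule monoid_group_ring)

lemma gr_star_nonzero: "f \<in> carrier ZG \<Longrightarrow> {x. gr_star G f x \<noteq> 0} = m_inv G ` {x. f x \<noteq> 0}"
proof (intro equalityI subsetI)
  fix x assume f: "f \<in> carrier ZG" and "x \<in> {x. gr_star G f x \<noteq> 0}"
  then have "x \<in> carrier G" "f (inv x) \<noteq> 0" by (auto simp: gr_star_def split: if_splits)
  then show "x \<in> m_inv G ` {x. f x \<noteq> 0}" by (intro image_eqI[of _ _ "inv x"]) auto
next
  fix x assume f: "f \<in> carrier ZG" and "x \<in> m_inv G ` {x. f x \<noteq> 0}"
  then obtain y where "x = inv y" "f y \<noteq> 0" by blast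
  then show "x \<in> {x. gr_star G f x \<noteq> 0}"
    using group_ring_nonzeroD[OF f] by (auto simp: gr_star_def)
qed

lemma gr_star_closed: "f \<in> carrier ZG \<Longrightarrow> gr_star G f \<in> carrier ZG"
  unfolding group_ring_carrier [of "gr_star G f"] gr_star_nonzero
  by (auto dest: group_ring_nonzeroD)

lemma gr_star_star: "f \<in> carrier ZG \<Longrightarrow> gr_star G (gr_star G f) = f"
  by (rule gr_eqI[OF gr_star_closed[OF gr_star_closed]]) (auto simp: gr_star_def)

lemma gr_star_one: "gr_star G \<one>\<^bsub>ZG\<^esub> = \<one>\<^bsub>ZG\<^esub>"
  by (rule gr_eqI[OF gr_star_closed[OF gr_one_closed] gr_one_closed])
     (auto simp: gr_star_def group_ring_one inv_eq_1_iff)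

lemma gr_star_mult:
  assumes f: "f \<in> carrier ZG" and g: "g \<in> carrier ZG"
  shows "gr_star G (f \<otimes>\<^bsub>ZG\<^esub> g) = gr_star G g \<otimes>\<^bsub>ZG\<^esub> gr_star G f"
proof (rule gr_eqI)
  fix x assume x: "x \<in> carrier G"
  have fin: "finite {x. f x \<noteq> 0}" "{x. f x \<noteq> 0} \<subseteq> carrier G"
    using f by (auto simp: group_ring_carrier)
  have "(gr_star G g \<otimes>\<^bsub>ZG\<^esub> gr_star G f) x
      = (\<Sum>z\<in>m_inv G ` {x. f x \<noteq> 0}. gr_star G g (x \<otimes> inv z) * gr_star G f z)"
    using f g fin x gr_star_nonzero[OF f] by (intro gr_mult_right gr_star_closed) auto
  also have "\<dots> = (\<Sum>y | f y \<noteq> 0. gr_star G g (x \<otimes> y) * f y)"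
  proof (subst sum.reindex)
    show "inj_on (m_inv G) {x. f x \<noteq> 0}"
    proof (rule inj_onI)
      fix y z assume yz: "y \<in> {x. f x \<noteq> 0}" "z \<in> {x. f x \<noteq> 0}" "inv y = inv z"
      then have "y \<in> carrier G" "z \<in> carrier G" "inv (inv y) = inv (inv z)" using fin(2) by auto
      then show "y = z" by simp
    qed
    show "sum ((\<lambda>z. gr_star G g (x \<otimes> inv z) * gr_star G f z) \<circ> m_inv G) {x. f x \<noteq> 0} =
        (\<Sum>y | f y \<noteq> 0. gr_star G g (x \<otimes> y) * f y)"
      using fin(2) by (intro sum.cong) (auto simp: gr_star_def subset_iff)
  qed
  also have "\<dots> = (\<Sum>y | f y \<noteq> 0. f y * g (inv y \<otimes> inv x))"
    using fin(2) x by (intro sum.cong) (auto simp: gr_star_def subset_iff inv_mult_group)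
  also have "\<dots> = gr_star G (f \<otimes>\<^bsub>ZG\<^esub> g) x"
    using f g fin x by (simp add: gr_star_def gr_mult_left[symmetric])
  finally show "gr_star G (f \<otimes>\<^bsub>ZG\<^esub> g) x = (gr_star G g \<otimes>\<^bsub>ZG\<^esub> gr_star G f) x" by simp
qed (use f g in \<open>auto intro!: gr_star_closed gr_mult_closed\<close>)

lemma gr_mult_star_at_one:
  assumes f: "f \<in> carrier ZG"
  shows "(f \<otimes>\<^bsub>ZG\<^esub> gr_star G f) \<one> = (\<Sum>x | f x \<noteq> 0. (f x)\<^sup>2)"
proof -
  have fin: "finite {x. f x \<noteq> 0}" "{x. f x \<noteq> 0} \<subseteq> carrier G"
    using f by (auto simp: group_ring_carrier)
  have "(f \<otimes>\<^bsub>ZG\<^esub> gr_star G f) \<one> = (\<Sum>y | f y \<noteq> 0. f y * gr_star G f (inv y \<otimes> \<one>))"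
    using f fin by (intro gr_mult_left gr_star_closed) auto
  also have "\<dots> = (\<Sum>x | f x \<noteq> 0. (f x)\<^sup>2)"
    using fin by (intro sum.cong) (auto simp: gr_star_def power2_eq_square subset_iff)
  finally show ?thesis .
qed

text \<open>For \<open>z\<close> in \<open>H\<close>, \<open>x z^-1\<close> is the conjugate of
  \<open>z^-1 x\<close> by \<open>z\<close>, so the left and right convolution sums agree term by
  term.\<close>

lemma class_fun_comm:
  assumes f: "f \<in> carrier ZG" and g: "g \<in> carrier ZG"
    and H: "class_fun G H f" and gH: "{x. g x \<noteq> 0} \<subseteq> H"
  shows "f \<otimes>\<^bsub>ZG\<^esub> g = g \<otimes>\<^bsub>ZG\<^esub> f"
proof (rule gr_eqI)
  fix x assume x: "x \<in> carrier G"
  have fin: "finite {x. g x \<noteq> 0}" "{x. g x \<noteq> 0} \<subseteq> carrier G"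
    using g by (auto simp: group_ring_carrier)
  have "(f \<otimes>\<^bsub>ZG\<^esub> g) x = (\<Sum>z | g z \<noteq> 0. f (x \<otimes> inv z) * g z)"
    using f g fin x by (intro gr_mult_right) auto
  also have "\<dots> = (\<Sum>z | g z \<noteq> 0. g z * f (inv z \<otimes> x))"
  proof (rule sum.cong[OF HOL.refl])
    fix z assume z: "z \<in> {x. g x \<noteq> 0}"
    with fin gH have zc: "z \<in> carrier G" "z \<in> H" by auto
    have "f (z \<otimes> (inv z \<otimes> x) \<otimes> inv z) = f (inv z \<otimes> x)"
      using H zc x unfolding class_fun_def by (meson inv_closed m_closed)
    then show "f (x \<otimes> inv z) * g z = g z * f (inv z \<otimes> x)" using zc x by simp
  qed
  also have "\<dots> = (g \<otimes>\<^bsub>ZG\<^esub> f) x"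
    using f g fin x by (intro gr_mult_left[symmetric]) auto
  finally show "(f \<otimes>\<^bsub>ZG\<^esub> g) x = (g \<otimes>\<^bsub>ZG\<^esub> f) x" .
qed (use f g in \<open>auto intro!: gr_mult_closed\<close>)

lemma gr_monom_closed: "g \<in> carrier G \<Longrightarrow> gr_monom c g \<in> carrier ZG"
  by (auto simp: group_ring_carrier gr_monom_def)

lemma gr_monom_nonzero: "{x. gr_monom c g x \<noteq> 0} \<subseteq> {g}"
  by (auto simp: gr_monom_def)

lemma gr_monom_mult_left:
  assumes "g \<in> carrier G" "f \<in> carrier ZG" "x \<in> carrier G"
  shows "(gr_monom c g \<otimes>\<^bsub>ZG\<^esub> f) x = c * f (inv g \<otimes> x)"
  using gr_mult_left[OF assms(2) _ gr_monom_nonzero[of c g] _ assms(3)] assms(1)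
  by (simp add: fun_cong[OF gr_monom_def, of c g g])

lemma gr_monom_mult_right:
  assumes "g \<in> carrier G" "f \<in> carrier ZG" "x \<in> carrier G"
  shows "(f \<otimes>\<^bsub>ZG\<^esub> gr_monom c g) x = f (x \<otimes> inv g) * c"
  using gr_mult_right[OF assms(2) gr_monom_closed[OF assms(1)] _ gr_monom_nonzero[of c g] _ assms(3)] assms(1)
  by (simp add: fun_cong[OF gr_monom_def, of c g g])

lemma gr_monom_unit:
  assumes "g \<in> carrier G" "e \<in> {1, -1}"
  shows "gr_monom e g \<in> Units ZG"
proof -
  have "gr_monom e g \<otimes>\<^bsub>ZG\<^esub> gr_monom e (inv g) = \<one>\<^bsub>ZG\<^esub>"
  proof (rule gr_eqI)
    fix x assume x: "x \<in> carrier G"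
    have "inv g \<otimes> x = inv g \<longleftrightarrow> x = \<one>"
      using assms(1) x by simp
    then show "(gr_monom e g \<otimes>\<^bsub>ZG\<^esub> gr_monom e (inv g)) x = \<one>\<^bsub>ZG\<^esub> x"
      using assms x
      by (subst gr_monom_mult_left) (auto intro: gr_monom_closed simp: group_ring_one, auto simp: gr_monom_def)
  qed (use assms in \<open>auto intro!: gr_mult_closed gr_monom_closed gr_one_closed\<close>)
  moreover have "gr_monom e (inv g) \<otimes>\<^bsub>ZG\<^esub> gr_monom e g = \<one>\<^bsub>ZG\<^esub>"
  proof (rule gr_eqI)
    fix x assume x: "x \<in> carrier G"
    have "g \<otimes> x = g \<longleftrightarrow> x = \<one>"
      using assms(1) x by simp
    then show "(gr_monom e (inv g) \<otimes>\<^bsub>ZG\<^esub> gr_monom e g) x = \<one>\<^bsub>ZG\<^esub> x"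
      using assms x
      by (subst gr_monom_mult_left) (auto intro: gr_monom_closed simp: group_ring_one, auto simp: gr_monom_def)
  qed (use assms in \<open>auto intro!: gr_mult_closed gr_monom_closed gr_one_closed\<close>)
  ultimately show ?thesis
    using assms(1) by (auto simp: Units_def intro!: bexI[of _ "gr_monom e (inv g)"] gr_monom_closed)
qed

text \<open>Group elements are units, and commuting with \<open>gr_monom 1 h\<close> is already
  conjugation invariance when read off at the point \<open>h x\<close>.\<close>

lemma center_units_class_fun:
  assumes "u \<in> group_center (units_of ZG)"
  shows "class_fun G (carrier G) u"
  unfolding class_fun_def
proof (intro ballI)
  fix h x assume h: "h \<in> carrier G" and x: "x \<in> carrier G"
  have u: "u \<in> Units ZG" "u \<in> carrier ZG"
    using assms by (auto simp: group_center_def units_of_def Units_def)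
  have "u \<otimes>\<^bsub>ZG\<^esub> gr_monom 1 h = gr_monom 1 h \<otimes>\<^bsub>ZG\<^esub> u"
    using assms gr_monom_unit[OF h, of 1] by (auto simp: group_center_def units_of_def)
  then have "(u \<otimes>\<^bsub>ZG\<^esub> gr_monom 1 h) (h \<otimes> x) = (gr_monom 1 h \<otimes>\<^bsub>ZG\<^esub> u) (h \<otimes> x)" by simp
  then show "u (h \<otimes> x \<otimes> inv h) = u x"
    using h x u by (simp add: gr_monom_mult_left gr_monom_mult_right)
qed

lemma class_fun_center_units:
  assumes "u \<in> Units ZG" "class_fun G (carrier G) u"
  shows "u \<in> group_center (units_of ZG)"
  unfolding group_center_def units_of_def
  using assms class_fun_comm[OF _ _ assms(2)]
  by (auto simp: Units_def group_ring_carrier)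

text \<open>Commutation with \<open>u\<close> passes to its inverse, which is therefore central
  among the units, and central units are class functions.\<close>

lemma class_fun_inverse:
  assumes "class_fun G (carrier G) u" "u \<in> carrier ZG" "u' \<in> carrier ZG"
    "u \<otimes>\<^bsub>ZG\<^esub> u' = \<one>\<^bsub>ZG\<^esub>" "u' \<otimes>\<^bsub>ZG\<^esub> u = \<one>\<^bsub>ZG\<^esub>"
  shows "class_fun G (carrier G) u'"
proof -
  have "u' \<in> group_center (units_of ZG)"
    unfolding group_center_def units_of_def
  proof (simp, intro conjI ballI)
    show "u' \<in> Units ZG" using assms by (auto simp: Units_def)
    fix x assume "x \<in> Units ZG"
    then have x: "x \<in> carrier ZG" by auto
    have xu: "u \<otimes>\<^bsub>ZG\<^esub> x = x \<otimes>\<^bsub>ZG\<^esub> u"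
      using assms x by (intro class_fun_comm) (auto simp: group_ring_carrier)
    have "u' \<otimes>\<^bsub>ZG\<^esub> x = u' \<otimes>\<^bsub>ZG\<^esub> ((x \<otimes>\<^bsub>ZG\<^esub> u) \<otimes>\<^bsub>ZG\<^esub> u')"
      using assms x by (simp add: ZG.m_assoc)
    also have "\<dots> = (u' \<otimes>\<^bsub>ZG\<^esub> u) \<otimes>\<^bsub>ZG\<^esub> (x \<otimes>\<^bsub>ZG\<^esub> u')"
      unfolding xu[symmetric] using assms(2,3) x by (simp only: ZG.m_assoc ZG.m_closed)
    also have "\<dots> = x \<otimes>\<^bsub>ZG\<^esub> u'"
      using assms x by simp
    finally show "u' \<otimes>\<^bsub>ZG\<^esub> x = x \<otimes>\<^bsub>ZG\<^esub> u'" .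
  qed
  then show ?thesis by (rule center_units_class_fun)
qed

lemma class_fun_star:
  "f \<in> carrier ZG \<Longrightarrow> H \<subseteq> carrier G \<Longrightarrow> class_fun G H f \<Longrightarrow> class_fun G H (gr_star G f)"
  unfolding class_fun_def gr_star_def
  by (auto simp: inv_mult_group m_assoc subset_iff)

text \<open>Conjugation by \<open>h\<close> permutes the finite support of \<open>f\<close>, so the
  convolution at the conjugate point is the one at \<open>x\<close> reindexed.\<close>

lemma class_fun_mult:
  assumes f: "f \<in> carrier ZG" and g: "g \<in> carrier ZG" and H: "H \<subseteq> carrier G"
    and cf: "class_fun G H f" and cg: "class_fun G H g"
  shows "class_fun G H (f \<otimes>\<^bsub>ZG\<^esub> g)"
  unfolding class_fun_def
proof (intro ballI)
  fix h x assume h: "h \<in> H" and x: "x \<in> carrier G"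
  have hc: "h \<in> carrier G" using h H by auto
  have fin: "finite {x. f x \<noteq> 0}" "{x. f x \<noteq> 0} \<subseteq> carrier G"
    using f by (auto simp: group_ring_carrier)
  let ?c = "\<lambda>y. h \<otimes> y \<otimes> inv h"
  have inj: "inj_on ?c {x. f x \<noteq> 0}"
  proof (rule inj_onI)
    fix y z assume yz: "y \<in> {x. f x \<noteq> 0}" "z \<in> {x. f x \<noteq> 0}" "?c y = ?c z"
    then have "y \<in> carrier G" "z \<in> carrier G" using fin by auto
    with yz(3) hc show "y = z" by simp
  qed
  have img: "?c ` {x. f x \<noteq> 0} = {x. f x \<noteq> 0}"
  proof -
    have sub: "?c ` {x. f x \<noteq> 0} \<subseteq> {x. f x \<noteq> 0}"
    proof
      fix y assume "y \<in> ?c ` {x. f x \<noteq> 0}"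
      then obtain z where z: "y = ?c z" "f z \<noteq> 0" by blast
      then have "z \<in> carrier G" using fin by blast
      with cf h z show "y \<in> {x. f x \<noteq> 0}" unfolding class_fun_def by fastforce
    qed
    then show ?thesis using endo_inj_surj[OF fin(1) sub inj] by simp
  qed
  have "(f \<otimes>\<^bsub>ZG\<^esub> g) (?c x) = (\<Sum>y\<in>?c ` {x. f x \<noteq> 0}. f y * g (inv y \<otimes> ?c x))"
    unfolding img using g fin x hc by (intro gr_mult_left) auto
  also have "\<dots> = (\<Sum>y\<in>{x. f x \<noteq> 0}. f (?c y) * g (inv (?c y) \<otimes> ?c x))"
    by (subst sum.reindex[OF inj]) (simp add: o_def)
  also have "\<dots> = (\<Sum>y\<in>{x. f x \<noteq> 0}. f y * g (inv y \<otimes> x))"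
  proof (rule sum.cong[OF HOL.refl])
    fix y assume "y \<in> {x. f x \<noteq> 0}"
    then have y: "y \<in> carrier G" using fin by auto
    have "inv (?c y) \<otimes> ?c x = ?c (inv y \<otimes> x)"
      using y x hc by (simp add: inv_mult_group m_assoc)
    moreover have "f (?c y) = f y"
      using cf h y unfolding class_fun_def by blast
    moreover have "g (?c (inv y \<otimes> x)) = g (inv y \<otimes> x)"
      using cg h y x unfolding class_fun_def by blast
    ultimately show "f (?c y) * g (inv (?c y) \<otimes> ?c x) = f y * g (inv y \<otimes> x)"
      by presburger
  qed
  also have "\<dots> = (f \<otimes>\<^bsub>ZG\<^esub> g) x"
    using g fin x by (intro gr_mult_left[symmetric]) auto
  finally show "(f \<otimes>\<^bsub>ZG\<^esub> g) (?c x) = (f \<otimes>\<^bsub>ZG\<^esub> g) x" .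
qed

end

section \<open>The FC-subgroup\<close>

context group begin

lemma conj_inI: "g \<in> carrier G \<Longrightarrow> conj_in G y (g \<otimes> y \<otimes> inv g)"
  by (auto simp: conj_in_def)

lemma conj_in_closed: "conj_in G y z \<Longrightarrow> y \<in> carrier G \<Longrightarrow> z \<in> carrier G"
  by (auto simp: conj_in_def)

lemma conj_in_trans:
  assumes "conj_in G x y" "conj_in G y z" "x \<in> carrier G"
  shows "conj_in G x z"
proof -
  obtain g h where gh: "g \<in> carrier G" "h \<in> carrier G" "y = g \<otimes> x \<otimes> inv g" "z = h \<otimes> y \<otimes> inv h"
    using assms by (auto simp: conj_in_def)
  then have "z = (h \<otimes> g) \<otimes> x \<otimes> inv (h \<otimes> g)"
    using assms(3) by (simp add: inv_mult_group m_assoc)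
  then show ?thesis using gh conj_inI[of "h \<otimes> g" x] by simp
qed

lemma FC_subgroup_conj_closed:
  assumes "x \<in> FC_subgroup G" "conj_in G x y"
  shows "y \<in> FC_subgroup G"
proof -
  have "{z. conj_in G y z} \<subseteq> {z. conj_in G x z}"
    using assms conj_in_trans by (auto simp: FC_subgroup_def)
  then show ?thesis
    using assms conj_in_closed by (auto simp: FC_subgroup_def intro: finite_subset)
qed

lemma subgroup_FC_subgroup: "subgroup (FC_subgroup G) G"
proof (rule subgroupI)
  have "{y. conj_in G \<one> y} \<subseteq> {\<one>}" by (auto simp: conj_in_def)
  then have "finite {y. conj_in G \<one> y}" by (rule finite_subset) simp
  then have "\<one> \<in> FC_subgroup G" by (simp add: FC_subgroup_def)
  then show "FC_subgroup G \<noteq> {}" by blast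
  show "FC_subgroup G \<subseteq> carrier G" by (auto simp: FC_subgroup_def)
next
  fix a assume a: "a \<in> FC_subgroup G"
  have "{y. conj_in G (inv a) y} \<subseteq> m_inv G ` {y. conj_in G a y}"
  proof
    fix y assume "y \<in> {y. conj_in G (inv a) y}"
    then obtain g where g: "g \<in> carrier G" "y = g \<otimes> inv a \<otimes> inv g" by (auto simp: conj_in_def)
    moreover have "inv (g \<otimes> a \<otimes> inv g) = g \<otimes> inv a \<otimes> inv g"
      using g a by (simp add: FC_subgroup_def inv_mult_group m_assoc)
    ultimately show "y \<in> m_inv G ` {y. conj_in G a y}"
      by (intro image_eqI[of _ _ "g \<otimes> a \<otimes> inv g"]) (auto intro: conj_inI)
  qed
  then show "inv a \<in> FC_subgroup G"
    using a by (auto simp: FC_subgroup_def intro: finite_subset)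
next
  fix a b assume a: "a \<in> FC_subgroup G" and b: "b \<in> FC_subgroup G"
  have "{y. conj_in G (a \<otimes> b) y} \<subseteq> (\<lambda>(y, z). y \<otimes> z) ` ({y. conj_in G a y} \<times> {y. conj_in G b y})"
  proof
    fix y assume "y \<in> {y. conj_in G (a \<otimes> b) y}"
    then obtain g where g: "g \<in> carrier G" "y = g \<otimes> (a \<otimes> b) \<otimes> inv g" by (auto simp: conj_in_def)
    moreover have "g \<otimes> (a \<otimes> b) \<otimes> inv g = (g \<otimes> a \<otimes> inv g) \<otimes> (g \<otimes> b \<otimes> inv g)"
      using g a b by (simp add: FC_subgroup_def m_assoc)
    ultimately show "y \<in> (\<lambda>(y, z). y \<otimes> z) ` ({y. conj_in G a y} \<times> {y. conj_in G b y})"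
      by (intro image_eqI[of _ _ "(g \<otimes> a \<otimes> inv g, g \<otimes> b \<otimes> inv g)"]) (auto intro: conj_inI)
  qed
  then show "a \<otimes> b \<in> FC_subgroup G"
    using a b by (auto simp: FC_subgroup_def intro: finite_subset)
qed

lemma conj_pow:
  assumes "g \<in> carrier G" "x \<in> carrier G"
  shows "(g \<otimes> x \<otimes> inv g) [^] (m::nat) = g \<otimes> x [^] m \<otimes> inv g"
proof (induction m)
  case (Suc m)
  have "x [^] Suc m = x [^] m \<otimes> x" by simp
  then show ?case using Suc assms by (simp add: m_assoc)
qed (use assms in simp)

lemma torsion_elt_conj:
  assumes "x \<in> carrier G" "torsion_elt G x" "conj_in G x y"
  shows "torsion_elt G y"
proof -
  obtain n :: nat where n: "n > 0" "x [^] n = \<one>" using assms by (auto simp: torsion_elt_def)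
  obtain g where g: "g \<in> carrier G" "y = g \<otimes> x \<otimes> inv g" using assms by (auto simp: conj_in_def)
  have "y [^] n = \<one>" using n g assms(1) by (simp add: conj_pow)
  then show ?thesis using n by (auto simp: torsion_elt_def)
qed

definition list_mult :: "'a list \<Rightarrow> 'a" where "list_mult l = foldr (\<otimes>) l \<one>"

lemma list_mult_simps [simp]: "list_mult [] = \<one>" "list_mult (a # l) = a \<otimes> list_mult l"
  by (simp_all add: list_mult_def)

lemma list_mult_closed [simp]: "set l \<subseteq> carrier G \<Longrightarrow> list_mult l \<in> carrier G"
  by (induction l) auto

lemma list_mult_append:
  "set l \<subseteq> carrier G \<Longrightarrow> set l' \<subseteq> carrier G \<Longrightarrow> list_mult (l @ l') = list_mult l \<otimes> list_mult l'"
  by (induction l) (auto simp: m_assoc)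

text \<open>Writing \<open>a x^k = x^k (x^-k a x^k)\<close> moves a power past a letter at the price
  of conjugating that letter. Since \<open>D\<close> is closed under such conjugation, the letter
  stays in \<open>D\<close> and the number of letters does not grow.\<close>

lemma list_mult_move_front:
  assumes D: "D \<subseteq> carrier G" and conj: "\<And>x y. x \<in> D \<Longrightarrow> y \<in> D \<Longrightarrow> inv x \<otimes> y \<otimes> x \<in> D"
    and x: "x \<in> D" and l: "set l \<subseteq> D" "count_list l x \<ge> k"
  shows "\<exists>l'. set l' \<subseteq> D \<and> length l' + k = length l \<and> list_mult l = x [^] k \<otimes> list_mult l'"
  using l
proof (induction l arbitrary: k)
  case Nil
  then show ?case by (auto intro!: exI[of _ "[]"])
next
  case (Cons a l)
  show ?case
  proof (cases k)
    case 0
    then show ?thesis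
      using Cons.prems D list_mult_closed[of "a # l"]
      by (intro exI[of _ "a # l"]) (simp add: subset_iff)
  next
    case (Suc j)
    show ?thesis
    proof (cases "a = x")
      case True
      then obtain l' where l': "set l' \<subseteq> D" "length l' + j = length l"
        "list_mult l = x [^] j \<otimes> list_mult l'"
        using Cons.IH[of j] Cons.prems Suc True by auto
      have "list_mult (a # l) = x [^] k \<otimes> list_mult l'"
        using True l' x D Suc nat_pow_Suc2[of x j] by (simp add: m_assoc[symmetric] subset_iff)
      then show ?thesis using l' Suc by (intro exI[of _ l']) auto
    next
      case False
      then obtain l' where l': "set l' \<subseteq> D" "length l' + k = length l"
        "list_mult l = x [^] k \<otimes> list_mult l'"
        using Cons.IH[of k] Cons.prems by auto
      have pow: "inv (x [^] m) \<otimes> a \<otimes> x [^] m \<in> D" for m :: nat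
      proof (induction m)
        case 0
        then show ?case using Cons.prems D by auto
      next
        case (Suc m)
        have "inv (x [^] Suc m) \<otimes> a \<otimes> x [^] Suc m = inv x \<otimes> (inv (x [^] m) \<otimes> a \<otimes> x [^] m) \<otimes> x"
          using x D Cons.prems by (simp add: inv_mult_group m_assoc subset_iff)
        then show ?case using conj[OF x Suc] by simp
      qed
      have "a \<otimes> (x [^] k \<otimes> list_mult l') = x [^] k \<otimes> (inv (x [^] k) \<otimes> a \<otimes> x [^] k \<otimes> list_mult l')"
        using x D Cons.prems l' list_mult_closed[of l']
        by (simp add: m_assoc subset_iff)
      then have "list_mult (a # l) = x [^] k \<otimes> list_mult ((inv (x [^] k) \<otimes> a \<otimes> x [^] k) # l')"
        using l' by simp
      moreover have "set ((inv (x [^] k) \<otimes> a \<otimes> x [^] k) # l') \<subseteq> D" using pow l' by auto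
      moreover have "length ((inv (x [^] k) \<otimes> a \<otimes> x [^] k) # l') + k = length (a # l)"
        using l' by simp
      ultimately show ?thesis by blast
    qed
  qed
qed

text \<open>Dietzmann's lemma: once a product is long enough, some factor occurs \<open>N\<close> times and
  can be collected at the front and cancelled.\<close>

lemma list_mult_shorten:
  assumes D: "D \<subseteq> carrier G" "finite D"
    and conj: "\<And>x y. x \<in> D \<Longrightarrow> y \<in> D \<Longrightarrow> inv x \<otimes> y \<otimes> x \<in> D"
    and N: "N > 0" "\<And>x. x \<in> D \<Longrightarrow> x [^] (N::nat) = \<one>" and l: "set l \<subseteq> D"
  shows "\<exists>l'. set l' \<subseteq> D \<and> length l' \<le> card D * N \<and> list_mult l' = list_mult l"
  using l
proof (induction l rule: length_induct)
  case (1 l)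
  show ?case
  proof (cases "length l \<le> card D * N")
    case False
    have "\<exists>x\<in>D. count_list l x \<ge> N"
    proof (rule ccontr)
      assume "\<not> ?thesis"
      then have "(\<Sum>x\<in>D. count_list l x) \<le> (\<Sum>x\<in>D. N)"
        by (intro sum_mono) auto
      moreover have "(\<Sum>x\<in>D. count_list l x) = length l"
        using 1(2) D by (intro sum_count_set) auto
      ultimately show False using False by simp
    qed
    then obtain x where x: "x \<in> D" "count_list l x \<ge> N" by blast
    from list_mult_move_front[OF D(1) conj x(1) 1(2) x(2)] obtain l' where
      l': "set l' \<subseteq> D" "length l' + N = length l" "list_mult l = x [^] N \<otimes> list_mult l'" by blast
    then have "list_mult l' = list_mult l"
      using N(2)[OF x(1)] D(1) by (simp add: list_mult_closed subset_trans)
    moreover have "length l' < length l" using l' N by simp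
    ultimately show ?thesis using 1(1) l' by metis
  qed (use 1 in blast)
qed

text \<open>The conjugates of \<open>F\<close> form a finite conjugation-closed set \<open>D\<close>
  of bounded exponent, and by \<open>list_mult_shorten\<close> its products are values of words of
  bounded length. This replaces \<open>\<Phi>\<^sup>+\<close> by a finite group wherever finitely
  many elements are concerned.\<close>

lemma finite_FC_torsion_subset_subgroup:
  assumes F: "finite F" "F \<subseteq> FC_torsion G"
  shows "\<exists>T. subgroup T G \<and> finite T \<and> F \<subseteq> T \<and> T \<subseteq> FC_torsion G"
proof -
  define D where "D = {y. \<exists>x\<in>F. conj_in G x y}"
  have Fc: "F \<subseteq> carrier G" using F by (auto simp: FC_torsion_def FC_subgroup_def)
  have "D = (\<Union>x\<in>F. {y. conj_in G x y})" by (auto simp: D_def)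
  then have finX: "finite D" using F by (auto simp: FC_torsion_def FC_subgroup_def)
  have Xc: "D \<subseteq> carrier G" using Fc conj_in_closed by (auto simp: D_def)
  have XFC: "D \<subseteq> FC_subgroup G"
    using F FC_subgroup_conj_closed by (auto simp: D_def FC_torsion_def)
  have Xtor: "torsion_elt G x" if "x \<in> D" for x
    using that F Fc torsion_elt_conj by (auto simp: D_def FC_torsion_def)
  have FX: "F \<subseteq> D"
  proof
    fix x assume x: "x \<in> F"
    then have "conj_in G x x" using Fc conj_inI[of \<one> x] by (simp add: subset_iff)
    with x show "x \<in> D" by (auto simp: D_def)
  qed
  have conj: "inv x \<otimes> y \<otimes> x \<in> D" if "x \<in> D" "y \<in> D" for x y
  proof -
    obtain z where z: "z \<in> F" "conj_in G z y" using \<open>y \<in> D\<close> by (auto simp: D_def)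
    have y: "conj_in G y (inv x \<otimes> y \<otimes> x)"
      using conj_inI[of "inv x" y] that Xc by auto
    show ?thesis using z(1) conj_in_trans[OF z(2) y] Fc by (auto simp: D_def)
  qed
  \<comment> \<open>A common exponent for \<open>D\<close>: the product of one chosen exponent for
    each element.\<close>
  define N where "N = (\<Prod>x\<in>D. SOME n::nat. n > 0 \<and> x [^] n = \<one>)"
  have some: "(SOME n::nat. n > 0 \<and> x [^] n = \<one>) > 0 \<and> x [^] (SOME n::nat. n > 0 \<and> x [^] n = \<one>) = \<one>"
    if "x \<in> D" for x
    using Xtor[OF that] unfolding torsion_elt_def by (rule someI_ex)
  have N: "N > 0" unfolding N_def using some by (intro prod_pos) blast
  have powN: "x [^] N = \<one>" if x: "x \<in> D" for x
  proof -
    have "(SOME n::nat. n > 0 \<and> x [^] n = \<one>) dvd N"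
      unfolding N_def using finX x by (rule dvd_prodI)
    then obtain k where "N = (SOME n::nat. n > 0 \<and> x [^] n = \<one>) * k" by (rule dvdE)
    then have "x [^] N = (x [^] (SOME n::nat. n > 0 \<and> x [^] n = \<one>)) [^] k"
      using x Xc by (auto simp: nat_pow_pow)
    then show ?thesis using some[OF x] by simp
  qed
  define T where "T = list_mult ` {l. set l \<subseteq> D}"
  have "T \<subseteq> list_mult ` {l. set l \<subseteq> D \<and> length l \<le> card D * N}"
  proof
    fix t assume "t \<in> T"
    then obtain l where "set l \<subseteq> D" "t = list_mult l" by (auto simp: T_def)
    with list_mult_shorten[OF Xc finX conj N powN, of l]
    show "t \<in> list_mult ` {l. set l \<subseteq> D \<and> length l \<le> card D * N}"
      by (metis (mono_tags, lifting) image_eqI mem_Collect_eq)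
  qed
  then have finT: "finite T"
    using finite_lists_length_le[OF finX] by (rule finite_subset[OF _ finite_imageI])
  have Tsub: "subgroup T G"
  proof (rule subgroupI)
    show "T \<subseteq> carrier G" using Xc by (auto simp: T_def intro!: list_mult_closed)
    show "T \<noteq> {}" by (auto simp: T_def intro: exI[of _ "[]"])
    have app: "list_mult l \<otimes> list_mult l' \<in> T" if "set l \<subseteq> D" "set l' \<subseteq> D" for l l'
      using that Xc list_mult_append[of l l'] by (auto simp: T_def intro!: image_eqI[of _ _ "l @ l'"])
    show "a \<otimes> b \<in> T" if "a \<in> T" "b \<in> T" for a b
      using that app by (auto simp: T_def)
    \<comment> \<open>With a bounded exponent inverses are positive powers, so products of elements
      of \<open>D\<close> alone already form a group.\<close>
    have invX: "inv x \<in> T" if x: "x \<in> D" for x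
    proof -
      have xc: "x \<in> carrier G" using x Xc by blast
      have "list_mult (replicate m x) = x [^] m" for m
        by (induction m) (use xc nat_pow_Suc2 in auto)
      then have "x [^] (N - 1) \<in> T"
        using x by (force simp: T_def image_iff intro: exI[of _ "replicate (N - 1) x"])
      moreover have "x [^] (N - 1) \<otimes> x = \<one>"
        using powN[OF x] N nat_pow_Suc[of x "N - 1"] by simp
      then have "inv x = x [^] (N - 1)" using xc by (intro inv_equality) auto
      ultimately show ?thesis by simp
    qed
    have "inv (list_mult l) \<in> T" if "set l \<subseteq> D" for l
      using that
    proof (induction l)
      case Nil
      then show ?case by (auto simp: T_def intro!: image_eqI[of _ _ "[]"])
    next
      case (Cons a l)
      then have "inv (list_mult (a # l)) = inv (list_mult l) \<otimes> inv a"
        using Xc by (simp add: inv_mult_group subset_iff)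
      moreover obtain l1 l2 where "inv (list_mult l) = list_mult l1" "set l1 \<subseteq> D"
        "inv a = list_mult l2" "set l2 \<subseteq> D"
        using Cons invX[of a] by (auto simp: T_def)
      ultimately show ?case using app by simp
    qed
    then show "inv a \<in> T" if "a \<in> T" for a using that by (auto simp: T_def)
  qed
  have "F \<subseteq> T"
  proof
    fix x assume "x \<in> F"
    then show "x \<in> T"
      using FX Fc by (auto simp: T_def subset_iff intro!: image_eqI[of _ _ "[x]"])
  qed
  moreover have "T \<subseteq> FC_torsion G"
  proof
    fix t assume t: "t \<in> T"
    then obtain l where l: "set l \<subseteq> D" "t = list_mult l" by (auto simp: T_def)
    have "list_mult l \<in> FC_subgroup G" using l(1)
    proof (induction l)
      case Nil
      then show ?case using subgroup.one_closed[OF subgroup_FC_subgroup] by simp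
    next
      case (Cons a l)
      then show ?case using subgroup.m_closed[OF subgroup_FC_subgroup, of a] XFC by auto
    qed
    moreover have "torsion_elt G t"
    proof -
      interpret T: group "G\<lparr>carrier := T\<rparr>" using Tsub by (rule subgroup.subgroup_is_group) (rule is_group)
      have "t [^]\<^bsub>G\<lparr>carrier := T\<rparr>\<^esub> Coset.order (G\<lparr>carrier := T\<rparr>) = \<one>"
        using T.pow_order_eq_1 t by simp
      then have "t [^] card T = \<one>"
        by (simp add: Coset.order_def nat_pow_consistent[symmetric])
      moreover have "card T > 0" using t finT by (auto simp: card_gt_0_iff)
      ultimately show ?thesis by (auto simp: torsion_elt_def)
    qed
    ultimately show "t \<in> FC_torsion G" using l by (simp add: FC_torsion_def)
  qed
  ultimately show ?thesis using Tsub finT by blast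
qed

end

section \<open>Homomorphisms from abelian groups to the reals\<close>

definition real_hom :: "('a, 'm) monoid_scheme \<Rightarrow> ('a \<Rightarrow> real) \<Rightarrow> bool" where
  "real_hom G d \<longleftrightarrow> (\<forall>x\<in>carrier G. \<forall>y\<in>carrier G. d (x \<otimes>\<^bsub>G\<^esub> y) = d x + d y)"

text \<open>Partial homomorphisms to the reals are represented by their graphs.\<close>

definition real_graph :: "('a, 'm) monoid_scheme \<Rightarrow> ('a \<times> real) set \<Rightarrow> bool" where
  "real_graph G M \<longleftrightarrow> M \<subseteq> carrier G \<times> UNIV \<and> (\<one>\<^bsub>G\<^esub>, 0) \<in> M \<and>
     (\<forall>a q b r. (a, q) \<in> M \<longrightarrow> (b, r) \<in> M \<longrightarrow> (a \<otimes>\<^bsub>G\<^esub> b, q + r) \<in> M) \<and>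
     (\<forall>a q. (a, q) \<in> M \<longrightarrow> (inv\<^bsub>G\<^esub> a, - q) \<in> M) \<and>
     (\<forall>q. (\<one>\<^bsub>G\<^esub>, q) \<in> M \<longrightarrow> q = 0)"

context comm_group begin

lemma real_graph_int_pow:
  assumes M: "real_graph G M" and a: "(a, q) \<in> M"
  shows "(a [^] (k::int), of_int k * q) \<in> M"
proof -
  have ac: "a \<in> carrier G" using M a by (auto simp: real_graph_def)
  have nat: "(a [^] (n::nat), of_nat n * q) \<in> M" for n
  proof (induction n)
    case 0
    then show ?case using M by (simp add: real_graph_def)
  next
    case (Suc n)
    then have "(a [^] n \<otimes> a, of_nat n * q + q) \<in> M"
      using M a unfolding real_graph_def by blast
    then show ?case by (simp add: algebra_simps)
  qed
  show ?thesis
  proof (cases k rule: int_cases2)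
    case (nonneg n)
    then show ?thesis using nat[of n] by (simp add: int_pow_int)
  next
    case (nonpos n)
    have "(inv (a [^] n), - (of_nat n * q)) \<in> M"
      using M nat[of n] unfolding real_graph_def by blast
    then show ?thesis using nonpos ac by (simp add: int_pow_neg int_pow_int)
  qed
qed

text \<open>Divisibility of the reals: if some nonzero power \<open>y^n\<close> already has a value
  \<open>q\<close>, the value at \<open>y\<close> has to be \<open>q/n\<close>, and this fits all
  other powers; otherwise any value works and \<open>0\<close> is taken. The new graph is generated
  by the old one and this pair.\<close>

lemma real_graph_extend:
  assumes M: "real_graph G M" and y: "y \<in> carrier G"
  shows "\<exists>M' r. real_graph G M' \<and> M \<subseteq> M' \<and> (y, r) \<in> M'"
proof -
  have mem: "a \<in> carrier G" if "(a, q) \<in> M" for a q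
    using that M by (auto simp: real_graph_def)
  have mult: "(a \<otimes> b, q + r) \<in> M" if "(a, q) \<in> M" "(b, r) \<in> M" for a b q r
    using that M by (auto simp: real_graph_def)
  have inv: "(inv a, - q) \<in> M" if "(a, q) \<in> M" for a q
    using that M by (auto simp: real_graph_def)
  have one: "(\<one>, 0) \<in> M" "(\<one>, q) \<in> M \<Longrightarrow> q = 0" for q
    using M by (auto simp: real_graph_def)
  have fn: "q = r" if "(a, q) \<in> M" "(a, r) \<in> M" for a q r
    using mult[OF that(1) inv[OF that(2)]] mem[OF that(1)] one(2)[of "q - r"] by simp
  have "\<exists>r. \<forall>k q. (y [^] (k::int), q) \<in> M \<longrightarrow> q = of_int k * r"
  proof (cases "\<exists>n q. n \<noteq> 0 \<and> (y [^] (n::int), q) \<in> M")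
    case True
    then obtain n q where n: "n \<noteq> 0" "(y [^] (n::int), q) \<in> M" by blast
    show ?thesis
    proof (intro exI allI impI)
      fix k q' assume k: "(y [^] (k::int), q') \<in> M"
      have "(y [^] (k * n), of_int n * q') \<in> M"
        using real_graph_int_pow[OF M k, of n] y by (simp add: int_pow_pow)
      moreover have "(y [^] (k * n), of_int k * q) \<in> M"
        using real_graph_int_pow[OF M n(2), of k] y by (simp add: int_pow_pow mult.commute)
      ultimately have "of_int n * q' = of_int k * q" by (rule fn)
      then show "q' = of_int k * (q / of_int n)" using n(1) by (simp add: field_simps)
    qed
  next
    case False
    then have "q = of_int k * 0" if "(y [^] (k::int), q) \<in> M" for k q
      using that one(2)[of q] by (cases "k = 0") auto
    then show ?thesis by blast
  qed
  then obtain r where r: "\<And>k q. (y [^] (k::int), q) \<in> M \<Longrightarrow> q = of_int k * r" by blast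
  define M' where "M' = {(s \<otimes> y [^] (k::int), q + of_int k * r) |s k q. (s, q) \<in> M}"
  have M'I: "(s \<otimes> y [^] k, q + of_int k * r) \<in> M'" if "(s, q) \<in> M" for s q and k :: int
    using that by (auto simp: M'_def)
  have "real_graph G M'"
    unfolding real_graph_def
  proof (intro conjI allI impI)
    show "M' \<subseteq> carrier G \<times> UNIV" using mem y by (auto simp: M'_def)
    show "(\<one>, 0) \<in> M'" using M'I[OF one(1), of 0] by simp
  next
    fix a q b t assume "(a, q) \<in> M'" "(b, t) \<in> M'"
    then obtain s k q0 s' k' t0 where *: "a = s \<otimes> y [^] (k::int)" "q = q0 + of_int k * r" "(s, q0) \<in> M"
      "b = s' \<otimes> y [^] (k'::int)" "t = t0 + of_int k' * r" "(s', t0) \<in> M"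
      by (auto simp: M'_def)
    then have "a \<otimes> b = (s \<otimes> s') \<otimes> y [^] (k + k')"
      using mem[of s] mem[of s'] y by (simp add: int_pow_mult m_ac)
    then show "(a \<otimes> b, q + t) \<in> M'"
      using M'I[OF mult[OF *(3,6)], of "k + k'"] * by (simp add: algebra_simps)
  next
    fix a q assume "(a, q) \<in> M'"
    then obtain s k q0 where *: "a = s \<otimes> y [^] (k::int)" "q = q0 + of_int k * r" "(s, q0) \<in> M"
      by (auto simp: M'_def)
    then have "inv a = inv s \<otimes> y [^] (- k)"
      using mem[of s] y by (simp add: inv_mult int_pow_neg)
    then show "(inv a, - q) \<in> M'"
      using M'I[OF inv[OF *(3)], of "- k"] * by simp
  next
    fix q assume "(\<one>, q) \<in> M'"
    then obtain s k q0 where *: "\<one> = s \<otimes> y [^] (k::int)" "q = q0 + of_int k * r" "(s, q0) \<in> M"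
      by (auto simp: M'_def)
    then have "s = inv (y [^] k)"
      using mem[of s] y inv_equality[of s "y [^] k"] by simp
    then have "s = y [^] (- k)" using y by (simp add: int_pow_neg)
    then have "q0 = of_int (- k) * r" using r[of "- k" q0] * by simp
    then show "q = 0" using * by simp
  qed
  moreover have "M \<subseteq> M'"
    using M'I[of _ _ 0] mem by fastforce
  moreover have "(y, r) \<in> M'"
    using M'I[OF one(1), of 1] y by simp
  ultimately show ?thesis by blast
qed

text \<open>Zorn's lemma is applied to graphs containing \<open>(z, 1)\<close>. The map sending
  \<open>z^k\<close> to \<open>k\<close> gives one because \<open>z\<close> has infinite order, and
  a maximal graph is defined everywhere by \<open>real_graph_extend\<close>.\<close>

lemma real_hom_nonzero:
  assumes z: "z \<in> carrier G" and tor: "\<not> torsion_elt G z"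
  shows "\<exists>d. real_hom G d \<and> d z \<noteq> 0"
proof -
  have zpow: "k = 0" if "z [^] (k::int) = \<one>" for k
  proof (rule ccontr)
    assume k: "k \<noteq> 0"
    obtain n :: nat where n: "k = int n \<or> k = - int n" by (metis int_cases2)
    then have "z [^] n = \<one>"
    proof
      assume "k = - int n"
      then have "inv (z [^] n) = \<one>" using that z by (simp add: int_pow_neg int_pow_int)
      then show ?thesis using z by (simp add: inv_eq_1_iff)
    qed (use that in \<open>simp add: int_pow_int\<close>)
    moreover have "n > 0" using n k by auto
    ultimately show False using tor unfolding torsion_elt_def by blast
  qed
  let ?A = "{M. real_graph G M \<and> (z, 1) \<in> M}"
  have "\<exists>M\<in>?A. \<forall>N\<in>?A. M \<subseteq> N \<longrightarrow> N = M"
  proof (rule subset_Zorn_nonempty)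
    let ?M = "range (\<lambda>k::int. (z [^] k, of_int k :: real))"
    have "real_graph G ?M"
      unfolding real_graph_def
    proof (intro conjI allI impI)
      show "?M \<subseteq> carrier G \<times> UNIV" using z by auto
      show "(\<one>, 0) \<in> ?M" by (rule image_eqI[of _ _ 0]) auto
    next
      fix a q b r assume "(a, q) \<in> ?M" "(b, r) \<in> ?M"
      then obtain k l where "a = z [^] (k::int)" "q = of_int k" "b = z [^] (l::int)" "r = of_int l" by auto
      then show "(a \<otimes> b, q + r) \<in> ?M"
        using z by (intro image_eqI[of _ _ "k + l"]) (auto simp: int_pow_mult)
    next
      fix a q assume "(a, q) \<in> ?M"
      then obtain k where "a = z [^] (k::int)" "q = of_int k" by auto
      then show "(inv a, - q) \<in> ?M"
        using z by (intro image_eqI[of _ _ "- k"]) (auto simp: int_pow_neg)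
    next
      fix q assume "(\<one>, q) \<in> ?M"
      then obtain k where k: "\<one> = z [^] (k::int)" "q = of_int k" by auto
      then show "q = 0" using zpow[of k] by simp
    qed
    moreover have "(z, 1) \<in> ?M" using z by (intro image_eqI[of _ _ 1]) auto
    ultimately show "?A \<noteq> {}" by blast
  next
    fix C assume C: "C \<noteq> {}" "subset.chain ?A C"
    then have CA: "\<And>M. M \<in> C \<Longrightarrow> real_graph G M \<and> (z, 1) \<in> M" by (auto simp: subset.chain_def)
    have "real_graph G (\<Union>C)"
      unfolding real_graph_def
    proof (intro conjI allI impI)
      show "\<Union>C \<subseteq> carrier G \<times> UNIV" using CA by (force simp: real_graph_def)
      show "(\<one>, 0) \<in> \<Union>C" using CA C(1) by (auto simp: real_graph_def)
    next
      fix a q b r assume "(a, q) \<in> \<Union>C" "(b, r) \<in> \<Union>C"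
      then obtain M N where MN: "M \<in> C" "N \<in> C" "(a, q) \<in> M" "(b, r) \<in> N" by blast
      then have "M \<subseteq> N \<or> N \<subseteq> M" using C(2) by (auto simp: subset.chain_def)
      then obtain L where "L \<in> C" "(a, q) \<in> L" "(b, r) \<in> L" using MN by blast
      then have "(a \<otimes> b, q + r) \<in> L" using CA[of L] unfolding real_graph_def by blast
      then show "(a \<otimes> b, q + r) \<in> \<Union>C" using \<open>L \<in> C\<close> by blast
    next
      fix a q assume "(a, q) \<in> \<Union>C"
      then obtain L where "L \<in> C" "(a, q) \<in> L" by blast
      then have "(inv a, - q) \<in> L" using CA[of L] unfolding real_graph_def by blast
      then show "(inv a, - q) \<in> \<Union>C" using \<open>L \<in> C\<close> by blast
    next
      fix q assume "(\<one>, q) \<in> \<Union>C"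
      then obtain L where "L \<in> C" "(\<one>, q) \<in> L" by blast
      then show "q = 0" using CA[of L] by (auto simp: real_graph_def)
    qed
    then show "\<Union>C \<in> ?A" using CA C(1) by blast
  qed
  then obtain M where M: "real_graph G M" "(z, 1) \<in> M"
    and max: "\<And>N. real_graph G N \<Longrightarrow> (z, 1) \<in> N \<Longrightarrow> M \<subseteq> N \<Longrightarrow> N = M" by blast
  have tot: "\<exists>r. (y, r) \<in> M" if y: "y \<in> carrier G" for y
    using real_graph_extend[OF M(1) y] max M(2) by blast
  have fn: "q = r" if "(a, q) \<in> M" "(a, r) \<in> M" for a q r
  proof -
    have "(inv a, - r) \<in> M" using M(1) that(2) by (auto simp: real_graph_def)
    then have "(a \<otimes> inv a, q + - r) \<in> M" using M(1) that(1) unfolding real_graph_def by blast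
    moreover have "a \<in> carrier G" using M(1) that(1) by (auto simp: real_graph_def)
    ultimately have "(\<one>, q - r) \<in> M" by simp
    then have "q - r = 0" using M(1) unfolding real_graph_def by blast
    then show ?thesis by simp
  qed
  define d where "d y = (THE r. (y, r) \<in> M)" for y
  have d: "d y = r" if "(y, r) \<in> M" for y r
    unfolding d_def using that fn by (intro the_equality) auto
  have "real_hom G d"
    unfolding real_hom_def
  proof (intro ballI)
    fix x y assume "x \<in> carrier G" "y \<in> carrier G"
    then obtain q r where qr: "(x, q) \<in> M" "(y, r) \<in> M" using tot by blast
    then have "(x \<otimes> y, q + r) \<in> M" using M(1) unfolding real_graph_def by blast
    then show "d (x \<otimes> y) = d x + d y" using qr d by simp
  qed
  moreover have "d z \<noteq> 0" using d[OF M(2)] by simp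
  ultimately show ?thesis by blast
qed

end

section \<open>The transfer to a centre of finite index\<close>

context group begin

lemma centralizes_generate:
  assumes F: "F \<subseteq> carrier G" and z: "z \<in> carrier G" "\<And>x. x \<in> F \<Longrightarrow> z \<otimes> x = x \<otimes> z"
    and h: "h \<in> generate G F"
  shows "z \<otimes> h = h \<otimes> z"
  using h
proof induction
  case one
  then show ?case using z by simp
next
  case (incl h)
  then show ?case using z by simp
next
  case (inv h)
  then have "h \<in> carrier G" using F by auto
  have "inv h \<otimes> (h \<otimes> z) \<otimes> inv h = inv h \<otimes> (z \<otimes> h) \<otimes> inv h" using z(2)[OF inv] by simp
  then show ?case using z(1) \<open>h \<in> carrier G\<close> by (simp add: m_assoc)
next
  case (eng h1 h2)
  then have "h1 \<in> carrier G" "h2 \<in> carrier G" using generate_in_carrier[OF F] by auto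
  then show ?case using eng z(1) by (metis m_assoc)
qed

text \<open>The homomorphism is the transfer from \<open>H\<close> to its centre, which has finite index, followed by a
  homomorphism from the centre to the reals. The cosets of the centre are represented by the conjugates
  of the tuple of generators.\<close>

lemma FC_real_hom_nonzero:
  assumes F: "finite F" "F \<subseteq> FC_subgroup G"
    and x0: "x0 \<in> generate G F" "\<not> torsion_elt G x0"
  shows "\<exists>d. (\<forall>x\<in>generate G F. \<forall>y\<in>generate G F. d (x \<otimes> y) = d x + d y) \<and> d x0 \<noteq> (0::real)"
proof -
  have Fc: "F \<subseteq> carrier G" using F by (auto simp: FC_subgroup_def)
  define H where "H = generate G F"
  have H: "subgroup H G" unfolding H_def by (rule generate_is_subgroup[OF Fc])
  have Hc: "h \<in> carrier G" if "h \<in> H" for h using subgroup.mem_carrier[OF H that] .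
  have Hm: "h \<otimes> h' \<in> H" if "h \<in> H" "h' \<in> H" for h h' using subgroup.m_closed[OF H that] .
  have Hi: "inv h \<in> H" if "h \<in> H" for h using subgroup.m_inv_closed[OF H that] .
  have H1: "\<one> \<in> H" using subgroup.one_closed[OF H] .
  \<comment> \<open>\<open>Z\<close> is the centre of \<open>H\<close>: commuting with the
    generators is enough.\<close>
  define Z where "Z = {z \<in> H. \<forall>x\<in>F. z \<otimes> x = x \<otimes> z}"
  have Zcomm: "z \<otimes> h = h \<otimes> z" if "z \<in> Z" "h \<in> H" for z h
  proof (rule centralizes_generate[OF Fc])
    show "z \<in> carrier G" "h \<in> generate G F" using that Hc by (auto simp: Z_def H_def)
    show "z \<otimes> x = x \<otimes> z" if "x \<in> F" for x using \<open>z \<in> Z\<close> that by (simp add: Z_def)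
  qed
  have ZH: "z \<in> H" if "z \<in> Z" for z using that by (simp add: Z_def)
  have ZI: "z \<in> Z" if "z \<in> H" "\<And>x. x \<in> F \<Longrightarrow> z \<otimes> x = x \<otimes> z" for z using that by (simp add: Z_def)
  have FH: "F \<subseteq> H" unfolding H_def by (rule subsetI) (rule generate.incl)
  have Zsub: "subgroup Z G"
  proof (rule subgroupI)
    show "Z \<subseteq> carrier G" using Hc ZH by blast
    have "\<one> \<in> Z" by (rule ZI) (use H1 Fc in \<open>simp_all add: subset_iff\<close>)
    then show "Z \<noteq> {}" by blast
  next
    fix a assume a: "a \<in> Z"
    show "inv a \<in> Z"
    proof (rule ZI)
      fix x assume x: "x \<in> F"
      have xa: "x \<in> carrier G" "a \<in> carrier G" using x a Fc ZH Hc by auto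
      have "inv a \<otimes> (x \<otimes> a) \<otimes> inv a = inv a \<otimes> (a \<otimes> x) \<otimes> inv a" using Zcomm[OF a, of x] x FH by auto
      then show "inv a \<otimes> x = x \<otimes> inv a" using xa by (simp add: m_assoc)
    qed (use a ZH Hi in auto)
  next
    fix a b assume ab: "a \<in> Z" "b \<in> Z"
    show "a \<otimes> b \<in> Z"
    proof (rule ZI)
      fix x assume x: "x \<in> F"
      have xa: "x \<in> carrier G" "a \<in> carrier G" "b \<in> carrier G" using x ab Fc ZH Hc by auto
      have "x \<otimes> a = a \<otimes> x" "x \<otimes> b = b \<otimes> x" using Zcomm[OF ab(1), of x] Zcomm[OF ab(2), of x] x FH by auto
      then show "(a \<otimes> b) \<otimes> x = x \<otimes> (a \<otimes> b)" using xa by (metis m_assoc)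
    qed (use ab ZH Hm in auto)
  qed
  let ?Z = "G\<lparr>carrier := Z\<rparr>"
  have "group ?Z" using subgroup.subgroup_is_group[OF Zsub is_group] .
  then have Zgrp: "comm_group ?Z"
    by (rule group.group_comm_groupI) (use Zcomm ZH in simp)
  define om where "om h = (\<lambda>x\<in>F. h \<otimes> x \<otimes> inv h)" for h
  define W where "W = om ` H"
  \<comment> \<open>Each generator has finitely many conjugates, so only finitely many tuples occur;
    this is the finite index of \<open>Z\<close>.\<close>
  have "W \<subseteq> (\<Pi>\<^sub>E x\<in>F. {y. conj_in G x y})"
    using Hc by (auto simp: W_def om_def intro!: conj_inI)
  moreover have "finite (\<Pi>\<^sub>E x\<in>F. {y. conj_in G x y})"
    using F by (intro finite_PiE) (auto simp: FC_subgroup_def)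
  ultimately have finW: "finite W" by (rule finite_subset)
  define act where "act g w = (\<lambda>x\<in>F. g \<otimes> w x \<otimes> inv g)" for g w
  have act_om: "act g (om h) = om (g \<otimes> h)" if "g \<in> H" "h \<in> H" for g h
    unfolding act_def om_def
    using that Hc Fc by (intro restrict_ext) (auto simp: inv_mult_group m_assoc subset_iff)
  have om_Z: "inv h' \<otimes> h \<in> Z" if hh: "h \<in> H" "h' \<in> H" "om h = om h'" for h h'
  proof (rule ZI)
    show "inv h' \<otimes> h \<in> H" using hh Hm Hi by blast
    fix x assume x: "x \<in> F"
    have c: "h \<in> carrier G" "h' \<in> carrier G" "x \<in> carrier G" using hh x Hc Fc by auto
    have "h \<otimes> x \<otimes> inv h = h' \<otimes> x \<otimes> inv h'" using fun_cong[OF hh(3), of x] x by (simp add: om_def)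
    then have "inv h' \<otimes> (h \<otimes> x \<otimes> inv h) \<otimes> h = inv h' \<otimes> (h' \<otimes> x \<otimes> inv h') \<otimes> h" by simp
    then show "inv h' \<otimes> h \<otimes> x = x \<otimes> (inv h' \<otimes> h)" using c by (simp add: m_assoc)
  qed
  define t where "t w = (SOME h. h \<in> H \<and> om h = w)" for w
  have t: "t w \<in> H \<and> om (t w) = w" if "w \<in> W" for w
    unfolding t_def by (rule someI_ex) (use that in \<open>auto simp: W_def\<close>)
  have actW: "act g w \<in> W" if "g \<in> H" "w \<in> W" for g w
    using that act_om Hm by (auto simp: W_def)
  have act_act: "act (g \<otimes> h) w = act g (act h w)" if "g \<in> H" "h \<in> H" "w \<in> W" for g h w
    using that act_om Hm Hc by (auto simp: W_def m_assoc)
  have act_one: "act \<one> w = w" if "w \<in> W" for w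
    using that act_om[OF H1] Hc by (auto simp: W_def)
  have act_bij: "bij_betw (act g) W W" if g: "g \<in> H" for g
  proof (rule bij_betwI[of _ _ _ "act (inv g)"])
    show "act g \<in> W \<rightarrow> W" "act (inv g) \<in> W \<rightarrow> W" using actW g Hi by auto
    show "act (inv g) (act g w) = w" "act g (act (inv g) w) = w" if "w \<in> W" for w
      using act_act[of "inv g" g w] act_act[of g "inv g" w] act_one g Hi Hc that by auto
  qed
  \<comment> \<open>The transfer cocycle, determined by \<open>g t(w) = t(g w) z(g, w)\<close>:
    acting with \<open>g\<close> on a coset representative gives another representative up to an
    element of \<open>Z\<close>.\<close>
  define z where "z g w = inv (t (act g w)) \<otimes> g \<otimes> t w" for g w
  have zZ: "z g w \<in> Z" if "g \<in> H" "w \<in> W" for g w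
  proof -
    have "act g w = om (g \<otimes> t w)" using that t[of w] act_om[of g "t w"] by simp
    moreover have "om (t (act g w)) = act g w" using that t[OF actW] by blast
    ultimately have "om (g \<otimes> t w) = om (t (act g w))" by simp
    then have "inv (t (act g w)) \<otimes> (g \<otimes> t w) \<in> Z" using that t actW Hm by (intro om_Z) auto
    then show ?thesis unfolding z_def using that t actW Hc by (simp add: m_assoc)
  qed
  have zmult: "z (g \<otimes> h) w = z g (act h w) \<otimes> z h w" if "g \<in> H" "h \<in> H" "w \<in> W" for g h w
  proof -
    have c: "g \<in> carrier G" "h \<in> carrier G" "t w \<in> carrier G" "t (act h w) \<in> carrier G"
      "t (act g (act h w)) \<in> carrier G"
      using that t actW Hc by auto
    then show ?thesis unfolding z_def act_act[OF that] by (simp add: m_assoc)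
  qed
  \<comment> \<open>Pigeonhole on the powers of \<open>x0\<close>: two of them have the same tuple,
    so some positive power is central. Without torsion, that power can be given a nonzero real
    value.\<close>
  have "\<not> inj (\<lambda>n::nat. om (x0 [^] n))"
  proof
    assume "inj (\<lambda>n::nat. om (x0 [^] n))"
    moreover have pH: "x0 [^] (n::nat) \<in> H" for n
      using x0(1) H1 Hm by (induction n) (auto simp: H_def)
    then have "range (\<lambda>n::nat. om (x0 [^] n)) \<subseteq> W" by (auto simp: W_def)
    ultimately show False using finW by (meson finite_subset infinite_UNIV_nat range_inj_infinite)
  qed
  then obtain i j :: nat where ij: "i < j" "om (x0 [^] i) = om (x0 [^] j)"
    unfolding inj_def by (metis linorder_neqE_nat)
  have x0H: "x0 \<in> H" using x0 by (simp add: H_def)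
  have x0c: "x0 \<in> carrier G" using Hc x0H .
  have pH: "x0 [^] (n::nat) \<in> H" for n
    using x0H H1 Hm by (induction n) auto
  define k where "k = j - i"
  have k: "k > 0" using ij by (simp add: k_def)
  have "x0 [^] j = x0 [^] i \<otimes> x0 [^] k" using ij x0c by (simp add: k_def nat_pow_mult)
  then have "inv (x0 [^] i) \<otimes> x0 [^] j = x0 [^] k" using x0c by simp
  then have x0Z: "x0 [^] k \<in> Z" using om_Z[of "x0 [^] j" "x0 [^] i"] pH ij by simp
  have "\<not> torsion_elt ?Z (x0 [^] k)"
  proof
    assume "torsion_elt ?Z (x0 [^] k)"
    then obtain n :: nat where "n > 0" "(x0 [^] k) [^] n = \<one>"
      by (auto simp: torsion_elt_def nat_pow_consistent[symmetric])
    then have "x0 [^] (k * n) = \<one>" "k * n > 0" using k x0c by (auto simp: nat_pow_pow)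
    then show False using x0(2) unfolding torsion_elt_def by blast
  qed
  then obtain m where m: "real_hom ?Z m" "m (x0 [^] k) \<noteq> 0"
    using comm_group.real_hom_nonzero[OF Zgrp, of "x0 [^] k"] x0Z by auto
  define d where "d g = (\<Sum>w\<in>W. m (z g w))" for g
  have hom: "d (g \<otimes> h) = d g + d h" if gh: "g \<in> H" "h \<in> H" for g h
  proof -
    have "d (g \<otimes> h) = (\<Sum>w\<in>W. m (z g (act h w)) + m (z h w))"
      unfolding d_def
    proof (rule sum.cong[OF HOL.refl])
      fix w assume w: "w \<in> W"
      have "m (z g (act h w) \<otimes> z h w) = m (z g (act h w)) + m (z h w)"
        using m(1) zZ[OF gh(1) actW[OF gh(2) w]] zZ[OF gh(2) w] by (simp add: real_hom_def)
      then show "m (z (g \<otimes> h) w) = m (z g (act h w)) + m (z h w)" using zmult[OF gh w] by simp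
    qed
    also have "\<dots> = (\<Sum>w\<in>W. m (z g (act h w))) + d h" by (simp add: sum.distrib d_def)
    also have "(\<Sum>w\<in>W. m (z g (act h w))) = d g"
      unfolding d_def using sum.reindex_bij_betw[OF act_bij[OF gh(2)], of "\<lambda>w. m (z g w)"] by simp
    finally show ?thesis .
  qed
  have d1: "d \<one> = 0" using hom[OF H1 H1] by simp
  have dpow: "d (x0 [^] (n::nat)) = of_nat n * d x0" for n
    by (induction n) (use d1 hom pH x0H in \<open>auto simp: algebra_simps\<close>)
  \<comment> \<open>A central element fixes every coset, and conjugating it by a representative
    changes nothing. The transfer of \<open>x0^k\<close> is therefore its \<open>card W\<close>-th
    multiple, which survives in the reals.\<close>
  have "z (x0 [^] k) w = x0 [^] k" if w: "w \<in> W" for w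
  proof -
    have tw: "t w \<in> H" "om (t w) = w" using t[OF w] by auto
    have "act (x0 [^] k) w = om (x0 [^] k \<otimes> t w)" using act_om[OF ZH[OF x0Z] tw(1)] tw(2) by simp
    also have "\<dots> = om (t w \<otimes> x0 [^] k)" using Zcomm[OF x0Z tw(1)] by simp
    also have "\<dots> = om (t w)"
      unfolding om_def
    proof (rule restrict_ext)
      fix x assume x: "x \<in> F"
      have c: "x \<in> carrier G" "t w \<in> carrier G" "x0 [^] k \<in> carrier G" using x Fc tw Hc x0c by auto
      have "t w \<otimes> x0 [^] k \<otimes> x \<otimes> inv (t w \<otimes> x0 [^] k) = t w \<otimes> (x0 [^] k \<otimes> x \<otimes> inv (x0 [^] k)) \<otimes> inv (t w)"
        using c by (simp add: inv_mult_group m_assoc)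
      also have "x0 [^] k \<otimes> x \<otimes> inv (x0 [^] k) = x" using Zcomm[OF x0Z, of x] x FH c by auto
      finally show "t w \<otimes> x0 [^] k \<otimes> x \<otimes> inv (t w \<otimes> x0 [^] k) = t w \<otimes> x \<otimes> inv (t w)" .
    qed
    finally have "act (x0 [^] k) w = w" using tw by simp
    then have "z (x0 [^] k) w = inv (t w) \<otimes> x0 [^] k \<otimes> t w" by (simp add: z_def)
    also have "\<dots> = x0 [^] k" using Zcomm[OF x0Z tw(1)] Hc[OF tw(1)] x0c by (simp add: m_assoc)
    finally show ?thesis .
  qed
  then have "d (x0 [^] k) = of_nat (card W) * m (x0 [^] k)" by (simp add: d_def)
  moreover have "card W > 0" using finW H1 by (auto simp: card_gt_0_iff W_def)
  ultimately have "d (x0 [^] k) \<noteq> 0" using m(2) by simp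
  then have "d x0 \<noteq> 0" using dpow[of k] by auto
  with hom show ?thesis unfolding H_def by blast
qed

end

section \<open>Central units\<close>

lemma supp_on_nonzero: "{x. supp_on f S x \<noteq> 0} = {x. f x \<noteq> 0} \<inter> S"
  by (auto simp: supp_on_def)

context group begin

lemma supp_on_closed: "f \<in> carrier ZG \<Longrightarrow> supp_on f S \<in> carrier ZG"
  by (auto simp: group_ring_carrier supp_on_nonzero)

lemma gr_mult_cong:
  assumes "f \<in> carrier ZG" "g \<in> carrier ZG" "f' \<in> carrier ZG" "g' \<in> carrier ZG" "x \<in> carrier G"
    and eq: "\<And>y z. y \<in> carrier G \<Longrightarrow> z \<in> carrier G \<Longrightarrow> y \<otimes> z = x \<Longrightarrow> f y * g z = f' y * g' z"
  shows "(f \<otimes>\<^bsub>ZG\<^esub> g) x = (f' \<otimes>\<^bsub>ZG\<^esub> g') x"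
proof -
  let ?S = "{y. f y \<noteq> 0} \<union> {y. f' y \<noteq> 0}"
  have S: "finite ?S" "?S \<subseteq> carrier G" using assms(1,3) by (auto simp: group_ring_carrier)
  have "(f \<otimes>\<^bsub>ZG\<^esub> g) x = (\<Sum>y\<in>?S. f y * g (inv y \<otimes> x))"
    using assms S by (intro gr_mult_left) auto
  also have "\<dots> = (\<Sum>y\<in>?S. f' y * g' (inv y \<otimes> x))"
  proof (rule sum.cong[OF HOL.refl])
    fix y assume "y \<in> ?S"
    then have "y \<in> carrier G" using S by blast
    then show "f y * g (inv y \<otimes> x) = f' y * g' (inv y \<otimes> x)"
      using assms(5) by (intro eq) auto
  qed
  also have "\<dots> = (f' \<otimes>\<^bsub>ZG\<^esub> g') x"
    using assms S by (intro gr_mult_left[symmetric]) auto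
  finally show ?thesis .
qed

text \<open>\<open>p = f f^*\<close> is symmetric with positive coefficient at \<open>1\<close>, so
  \<open>p^2 = p p^*\<close> is nonzero for the same reason; but the two factors commute, and
  \<open>p^2\<close> therefore contains \<open>f^2\<close>.\<close>

lemma gr_square_nonzero:
  assumes f: "f \<in> carrier ZG" and H: "H \<subseteq> carrier G" "\<And>h. h \<in> H \<Longrightarrow> inv h \<in> H"
    and fH: "{x. f x \<noteq> 0} \<subseteq> H" and cf: "class_fun G H f" and f0: "f x \<noteq> 0"
  shows "f \<otimes>\<^bsub>ZG\<^esub> f \<noteq> (\<lambda>_. 0)"
proof
  interpret ZG: monoid ZG by (rule monoid_group_ring)
  have pos: "g \<otimes>\<^bsub>ZG\<^esub> gr_star G g \<noteq> (\<lambda>_. 0)" if g: "g \<in> carrier ZG" "g y \<noteq> 0" for g y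
  proof
    assume "g \<otimes>\<^bsub>ZG\<^esub> gr_star G g = (\<lambda>_. 0)"
    then have "(\<Sum>x | g x \<noteq> 0. (g x)\<^sup>2) = 0" using gr_mult_star_at_one[OF g(1)] by simp
    moreover have "(\<Sum>x | g x \<noteq> 0. (g x)\<^sup>2) > 0"
      using g by (intro sum_pos) auto
    ultimately show False by simp
  qed
  assume ff: "f \<otimes>\<^bsub>ZG\<^esub> f = (\<lambda>_. 0)"
  let ?s = "gr_star G f" and ?z = "(\<lambda>_. 0) :: 'a \<Rightarrow> int"
  have s: "?s \<in> carrier ZG" using gr_star_closed f .
  have sH: "{x. ?s x \<noteq> 0} \<subseteq> H" using gr_star_nonzero[OF f] fH H by auto
  have comm: "f \<otimes>\<^bsub>ZG\<^esub> ?s = ?s \<otimes>\<^bsub>ZG\<^esub> f" using class_fun_comm[OF f s cf sH] .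
  let ?p = "f \<otimes>\<^bsub>ZG\<^esub> ?s"
  have p: "?p \<in> carrier ZG" using f s by simp
  obtain y where "?p y \<noteq> 0" using pos[OF f f0] by (auto simp: fun_eq_iff)
  then have "?p \<otimes>\<^bsub>ZG\<^esub> gr_star G ?p \<noteq> ?z" using pos p by blast
  moreover have "gr_star G ?p = ?p" using f s by (simp add: gr_star_mult gr_star_star)
  moreover have "?p \<otimes>\<^bsub>ZG\<^esub> ?p = (?s \<otimes>\<^bsub>ZG\<^esub> (f \<otimes>\<^bsub>ZG\<^esub> f)) \<otimes>\<^bsub>ZG\<^esub> ?s"
    using f s by (metis comm ZG.m_assoc ZG.m_closed)
  moreover have "(?s \<otimes>\<^bsub>ZG\<^esub> ?z) = ?z" "(?z \<otimes>\<^bsub>ZG\<^esub> ?s) = ?z"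
    by (auto simp: fun_eq_iff group_ring_mult)
  ultimately show False using ff by metis
qed

text \<open>\<open>p = e e^*\<close> is a symmetric idempotent, so its coefficient at
  \<open>1\<close> is a positive integer equal to the sum of all its squared coefficients, which
  leaves only \<open>p = 1\<close>. Then \<open>e = e p = e e e^* = p\<close>.\<close>

lemma idempotent_trivial:
  assumes e: "e \<in> carrier ZG" and H: "H \<subseteq> carrier G" "\<And>h. h \<in> H \<Longrightarrow> inv h \<in> H"
    and eH: "{x. e x \<noteq> 0} \<subseteq> H" and ce: "class_fun G H e"
    and ee: "e \<otimes>\<^bsub>ZG\<^esub> e = e" and e0: "e x \<noteq> 0"
  shows "e = \<one>\<^bsub>ZG\<^esub>"
proof -
  interpret ZG: monoid ZG by (rule monoid_group_ring)
  let ?s = "gr_star G e"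
  have s: "?s \<in> carrier ZG" using gr_star_closed e .
  have sH: "{x. ?s x \<noteq> 0} \<subseteq> H" using gr_star_nonzero[OF e] eH H by auto
  have comm: "e \<otimes>\<^bsub>ZG\<^esub> ?s = ?s \<otimes>\<^bsub>ZG\<^esub> e" using class_fun_comm[OF e s ce sH] .
  have ss: "?s \<otimes>\<^bsub>ZG\<^esub> ?s = ?s" using gr_star_mult[OF e e] ee by simp
  define p where "p = e \<otimes>\<^bsub>ZG\<^esub> ?s"
  have p: "p \<in> carrier ZG" using e s by (simp add: p_def)
  have star_p: "gr_star G p = p" using e s by (simp add: p_def gr_star_mult gr_star_star)
  have pp: "p \<otimes>\<^bsub>ZG\<^esub> p = p"
  proof -
    have "p \<otimes>\<^bsub>ZG\<^esub> p = e \<otimes>\<^bsub>ZG\<^esub> (?s \<otimes>\<^bsub>ZG\<^esub> e) \<otimes>\<^bsub>ZG\<^esub> ?s" using e s by (simp add: p_def ZG.m_assoc)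
    also have "\<dots> = (e \<otimes>\<^bsub>ZG\<^esub> e) \<otimes>\<^bsub>ZG\<^esub> (?s \<otimes>\<^bsub>ZG\<^esub> ?s)"
      unfolding comm[symmetric] using e s by (simp add: ZG.m_assoc)
    finally show ?thesis by (simp add: ee ss p_def)
  qed
  have p1: "p \<one> = (\<Sum>x | p x \<noteq> 0. (p x)\<^sup>2)" using gr_mult_star_at_one[OF p] star_p pp by simp
  have p1': "p \<one> = (\<Sum>x | e x \<noteq> 0. (e x)\<^sup>2)" using gr_mult_star_at_one[OF e] by (simp add: p_def)
  have "p \<one> > 0" unfolding p1' using e e0 by (intro sum_pos) auto
  have fin: "finite {x. p x \<noteq> 0}" using p by auto
  have split: "(\<Sum>x | p x \<noteq> 0. (p x)\<^sup>2) = (p \<one>)\<^sup>2 + (\<Sum>x\<in>{x. p x \<noteq> 0} - {\<one>}. (p x)\<^sup>2)"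
    using \<open>p \<one> > 0\<close> by (intro sum.remove[OF fin]) auto
  have ge: "(\<Sum>x\<in>{x. p x \<noteq> 0} - {\<one>}. (p x)\<^sup>2) \<ge> 0" by (intro sum_nonneg) auto
  have "(p \<one>)\<^sup>2 \<ge> p \<one>" using \<open>p \<one> > 0\<close> by (simp add: power2_eq_square)
  then have eq: "(p \<one>)\<^sup>2 = p \<one>" "(\<Sum>x\<in>{x. p x \<noteq> 0} - {\<one>}. (p x)\<^sup>2) = 0"
    using p1 split ge by linarith+
  then have "p \<one> = 1" using \<open>p \<one> > 0\<close> by (simp add: power2_eq_square)
  moreover have "p y = 0" if "y \<noteq> \<one>" for y
    using eq(2) fin that by (subst (asm) sum_nonneg_eq_0_iff) auto
  ultimately have p_one: "p = \<one>\<^bsub>ZG\<^esub>" by (auto simp: fun_eq_iff group_ring_one)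
  have "e = e \<otimes>\<^bsub>ZG\<^esub> p" using e p_one by simp
  also have "\<dots> = (e \<otimes>\<^bsub>ZG\<^esub> e) \<otimes>\<^bsub>ZG\<^esub> ?s" using e s by (simp add: p_def ZG.m_assoc)
  also have "\<dots> = \<one>\<^bsub>ZG\<^esub>" using ee p_one by (simp add: p_def)
  finally show ?thesis .
qed

end

section \<open>The group ring graded by a homomorphism to the reals\<close>

locale graded_group_ring = group +
  fixes H :: "'a set" and d :: "'a \<Rightarrow> real"
  assumes H: "subgroup H G"
    and d: "\<And>x y. x \<in> H \<Longrightarrow> y \<in> H \<Longrightarrow> d (x \<otimes> y) = d x + d y"
begin

lemma Hc: "H \<subseteq> carrier G" using H by (rule subgroup.subset)

lemma H_inv: "h \<in> H \<Longrightarrow> inv h \<in> H" using H by (rule subgroup.m_inv_closed)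

lemma d_one: "d \<one> = 0" using d[of \<one> \<one>] subgroup.one_closed[OF H] by simp

lemma d_inv: "h \<in> H \<Longrightarrow> d (inv h) = - d h"
  using d[of h "inv h"] H_inv[of h] d_one Hc by auto

text \<open>The homogeneous component of degree \<open>a\<close>. As \<open>d\<close> is
  unconstrained outside \<open>H\<close>, the name is justified for functions supported on
  \<open>H\<close>.\<close>

definition hpart :: "real \<Rightarrow> ('a \<Rightarrow> int) \<Rightarrow> 'a \<Rightarrow> int" where
  "hpart a f = supp_on f {x. d x = a}"

text \<open>The centre of the group ring of \<open>H\<close>, realised inside the group ring of
  \<open>G\<close>.\<close>

definition R :: "('a \<Rightarrow> int) set" where
  "R = {f \<in> carrier ZG. {x. f x \<noteq> 0} \<subseteq> H \<and> class_fun G H f}"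

lemma R_carrier: "f \<in> R \<Longrightarrow> f \<in> carrier ZG" by (simp add: R_def)
lemma R_supp: "f \<in> R \<Longrightarrow> f x \<noteq> 0 \<Longrightarrow> x \<in> H" by (auto simp: R_def)

lemma R_mult:
  assumes f: "f \<in> R" and g: "g \<in> R"
  shows "f \<otimes>\<^bsub>ZG\<^esub> g \<in> R"
proof -
  have "{x. (f \<otimes>\<^bsub>ZG\<^esub> g) x \<noteq> 0} \<subseteq> H"
  proof
    fix x assume "x \<in> {x. (f \<otimes>\<^bsub>ZG\<^esub> g) x \<noteq> 0}"
    then obtain y z where "f y \<noteq> 0" "g z \<noteq> 0" "x = y \<otimes> z"
      using group_ring_mult_nonzeroD[of G f g] by blast
    then show "x \<in> H" using R_supp[OF f] R_supp[OF g] subgroup.m_closed[OF H] by blast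
  qed
  then show ?thesis
    using f g class_fun_mult[OF _ _ Hc] gr_mult_closed by (auto simp: R_def)
qed

lemma R_comm: "f \<in> R \<Longrightarrow> g \<in> R \<Longrightarrow> f \<otimes>\<^bsub>ZG\<^esub> g = g \<otimes>\<^bsub>ZG\<^esub> f"
  using class_fun_comm by (auto simp: R_def)

text \<open>A homomorphism to an abelian group is constant on conjugates, so cutting out one degree
  preserves invariance.\<close>

lemma R_hpart:
  assumes f: "f \<in> R"
  shows "hpart a f \<in> R"
proof -
  have "class_fun G H (hpart a f)"
    unfolding class_fun_def
  proof (intro ballI)
    fix h x assume h: "h \<in> H" and x: "x \<in> carrier G"
    have fx: "f (h \<otimes> x \<otimes> inv h) = f x" using f h x by (auto simp: R_def class_fun_def)
    have hc: "h \<in> carrier G" using h Hc by auto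
    show "hpart a f (h \<otimes> x \<otimes> inv h) = hpart a f x"
    proof (cases "x \<in> H")
      case True
      then have "d (h \<otimes> x \<otimes> inv h) = d x"
        using h H_inv subgroup.m_closed[OF H] d d_inv by simp
      then show ?thesis using fx by (simp add: hpart_def supp_on_def)
    next
      case False
      then have "f x = 0" using R_supp[OF f] by blast
      then show ?thesis using fx by (simp add: hpart_def supp_on_def)
    qed
  qed
  then show ?thesis using f supp_on_closed
    by (auto simp: R_def hpart_def supp_on_nonzero)
qed

lemma hpart_nonzero: "hpart a f x \<noteq> 0 \<longleftrightarrow> f x \<noteq> 0 \<and> d x = a"
  by (simp add: hpart_def supp_on_def)

lemma hpart_mult_homogeneous:
  assumes f: "f \<in> R" and g: "g \<in> R" and hom: "\<And>x. f x \<noteq> 0 \<Longrightarrow> d x = a"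
  shows "hpart (a + b) (f \<otimes>\<^bsub>ZG\<^esub> g) = f \<otimes>\<^bsub>ZG\<^esub> hpart b g"
proof (rule gr_eqI)
  fix x assume x: "x \<in> carrier G"
  show "hpart (a + b) (f \<otimes>\<^bsub>ZG\<^esub> g) x = (f \<otimes>\<^bsub>ZG\<^esub> hpart b g) x"
  proof (cases "d x = a + b")
    case True
    have "(f \<otimes>\<^bsub>ZG\<^esub> g) x = (f \<otimes>\<^bsub>ZG\<^esub> hpart b g) x"
    proof (rule gr_mult_cong)
      fix y z assume yz: "y \<in> carrier G" "z \<in> carrier G" "y \<otimes> z = x"
      show "f y * g z = f y * hpart b g z"
      proof (cases "f y = 0 \<or> g z = 0")
        case False
        then have "d y + d z = a + b" "d y = a"
          using yz True d R_supp[OF f] R_supp[OF g] hom by auto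
        then show ?thesis by (simp add: hpart_def supp_on_def)
      qed (auto simp: hpart_def supp_on_def)
    qed (use f g x R_hpart R_carrier in auto)
    then show ?thesis using True by (simp add: hpart_def supp_on_def)
  next
    case False
    have "(f \<otimes>\<^bsub>ZG\<^esub> hpart b g) x = 0"
    proof (rule ccontr)
      assume "(f \<otimes>\<^bsub>ZG\<^esub> hpart b g) x \<noteq> 0"
      then obtain y z where "f y \<noteq> 0" "hpart b g z \<noteq> 0" "x = y \<otimes> z"
        using group_ring_mult_nonzeroD by metis
      then have "d x = a + b" using d R_supp[OF f] R_supp[OF g] hom by (auto simp: hpart_nonzero)
      then show False using False by simp
    qed
    then show ?thesis using False by (simp add: hpart_def supp_on_def)
  qed
qed (use f g in \<open>auto intro!: R_carrier R_hpart R_mult\<close>)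

text \<open>Degrees in the factors are at most \<open>a\<close> and \<open>b\<close>, so a product
  of degree \<open>a + b\<close> can only come from the two top components.\<close>

lemma hpart_mult_top:
  assumes f: "f \<in> R" and g: "g \<in> R"
    and fa: "\<And>x. f x \<noteq> 0 \<Longrightarrow> d x \<le> a" and gb: "\<And>x. g x \<noteq> 0 \<Longrightarrow> d x \<le> b"
  shows "hpart (a + b) (f \<otimes>\<^bsub>ZG\<^esub> g) = hpart a f \<otimes>\<^bsub>ZG\<^esub> hpart b g"
proof -
  have "hpart (a + b) (f \<otimes>\<^bsub>ZG\<^esub> g) x = hpart (a + b) (hpart a f \<otimes>\<^bsub>ZG\<^esub> g) x" if x: "x \<in> carrier G" for x
  proof (cases "d x = a + b")
    case True
    have "(f \<otimes>\<^bsub>ZG\<^esub> g) x = (hpart a f \<otimes>\<^bsub>ZG\<^esub> g) x"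
    proof (rule gr_mult_cong)
      fix y z assume yz: "y \<in> carrier G" "z \<in> carrier G" "y \<otimes> z = x"
      show "f y * g z = hpart a f y * g z"
      proof (cases "f y = 0 \<or> g z = 0")
        case False
        then have "d y + d z = a + b" "d y \<le> a" "d z \<le> b"
          using yz True d R_supp[OF f] R_supp[OF g] fa gb by auto
        then have "d y = a" by linarith
        then show ?thesis by (simp add: hpart_def supp_on_def)
      qed (auto simp: hpart_def supp_on_def)
    qed (use f g x R_hpart R_carrier in auto)
    then show ?thesis using True by (simp add: hpart_def supp_on_def)
  qed (simp add: hpart_def supp_on_def)
  then have "hpart (a + b) (f \<otimes>\<^bsub>ZG\<^esub> g) = hpart (a + b) (hpart a f \<otimes>\<^bsub>ZG\<^esub> g)"
    using f g by (intro gr_eqI) (auto intro!: R_carrier R_hpart R_mult)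
  then show ?thesis
    using hpart_mult_homogeneous[OF R_hpart[OF f] g, of a a b] by (simp add: hpart_nonzero)
qed

text \<open>If \<open>w\<close> had a homogeneous component of positive degree, its top component \<open>w\<^sub>a\<close> would satisfy
  \<open>w\<^sub>a w'\<^sub>-\<^sub>a = 1\<close>, since this product is a nonzero idempotent. Then \<open>w'\<close> has no component above degree
  \<open>-a\<close>, contradicting the symmetry of \<open>w'\<close>.\<close>

lemma symmetric_unit_degree_zero:
  assumes w: "w \<in> R" and w': "w' \<in> R" and ww: "w \<otimes>\<^bsub>ZG\<^esub> w' = \<one>\<^bsub>ZG\<^esub>"
    and star: "gr_star G w = w" "gr_star G w' = w'" and x: "w x \<noteq> 0"
  shows "d x = 0"
proof (rule ccontr)
  assume dx: "d x \<noteq> 0"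
  interpret ZG: monoid ZG by (rule monoid_group_ring)
  have wc: "w \<in> carrier ZG" "w' \<in> carrier ZG" using w w' R_carrier by auto
  have supp_fin: "finite {x. w x \<noteq> 0}" using wc by auto
  define a where "a = Max (d ` {x. w x \<noteq> 0})"
  have a_max: "d y \<le> a" if "w y \<noteq> 0" for y
    unfolding a_def using that supp_fin by (intro Max_ge) auto
  have "a \<in> d ` {x. w x \<noteq> 0}" unfolding a_def using supp_fin x by (intro Max_in) auto
  then obtain xa where xa: "w xa \<noteq> 0" "d xa = a" by auto
  \<comment> \<open>By symmetry the support contains \<open>x\<close> together with its inverse,
    whose degrees are opposite and nonzero.\<close>
  have "a > 0"
  proof -
    have "x \<in> H" using R_supp[OF w x] .
    then have "w (inv x) \<noteq> 0" using fun_cong[OF star(1), of x] x Hc by (auto simp: gr_star_def)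
    then have "d (inv x) \<le> a" "d x \<le> a" using a_max x by auto
    then show ?thesis using d_inv[OF \<open>x \<in> H\<close>] dx by linarith
  qed
  define t where "t = hpart a w"
  have t: "t \<in> R" unfolding t_def using w by (rule R_hpart)
  have t_hom: "d y = a" if "t y \<noteq> 0" for y using that by (simp add: t_def hpart_nonzero)
  \<comment> \<open>Since \<open>w z = t\<close> is homogeneous, comparing top components of the two
    sides will determine the top degree \<open>m\<close> of \<open>z\<close>.\<close>
  define z where "z = t \<otimes>\<^bsub>ZG\<^esub> w'"
  have z: "z \<in> R" unfolding z_def using t w' by (rule R_mult)
  have tc: "t \<in> carrier ZG" "z \<in> carrier ZG" using t z R_carrier by auto
  have wz: "w \<otimes>\<^bsub>ZG\<^esub> z = t"
    using R_comm[OF w t] tc wc ww by (simp add: z_def ZG.m_assoc[symmetric]) (simp add: ZG.m_assoc)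
  have txa: "t xa \<noteq> 0" using xa by (simp add: t_def hpart_nonzero)
  have z_nz: "{x. z x \<noteq> 0} \<noteq> {}"
  proof
    assume "{x. z x \<noteq> 0} = {}"
    then have "z = (\<lambda>_. 0)" by auto
    then have "w \<otimes>\<^bsub>ZG\<^esub> z = (\<lambda>_. 0)" by (auto simp: fun_eq_iff group_ring_mult)
    then show False using wz txa by simp
  qed
  have z_fin: "finite {x. z x \<noteq> 0}" using tc by auto
  define m where "m = Max (d ` {x. z x \<noteq> 0})"
  have m_max: "d y \<le> m" if "z y \<noteq> 0" for y
    unfolding m_def using that z_fin by (intro Max_ge) auto
  have "m \<in> d ` {x. z x \<noteq> 0}" unfolding m_def using z_fin z_nz by (intro Max_in) auto
  then obtain xm where xm: "z xm \<noteq> 0" "d xm = m" by auto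
  have zm: "hpart m z = t \<otimes>\<^bsub>ZG\<^esub> hpart (m - a) w'"
    using hpart_mult_homogeneous[OF t w' t_hom, of "m - a"] by (simp add: z_def)
  have top: "hpart (a + m) t = t \<otimes>\<^bsub>ZG\<^esub> hpart m z"
    using hpart_mult_top[OF w z a_max m_max] wz by (simp add: t_def)
  \<comment> \<open>For \<open>m\<close> nonzero the top component of \<open>w z\<close> vanishes,
    so \<open>t z_m = 0\<close>. As \<open>z_m\<close> is itself a multiple of \<open>t\<close>, its
    square would be zero, which \<open>gr_square_nonzero\<close> forbids.\<close>
  have "m = 0"
  proof (rule ccontr)
    assume "m \<noteq> 0"
    then have "hpart (a + m) t = (\<lambda>_. 0)"
      using t_hom by (force simp: hpart_def supp_on_def fun_eq_iff)
    then have t0: "t \<otimes>\<^bsub>ZG\<^esub> hpart m z = (\<lambda>_. 0)" using top by simp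
    let ?v = "hpart (m - a) w'"
    have v: "?v \<in> R" "?v \<in> carrier ZG" using R_hpart[OF w'] R_carrier by auto
    have hz: "hpart m z \<in> R" "hpart m z \<in> carrier ZG" using R_hpart[OF z] R_carrier by auto
    have "hpart m z \<otimes>\<^bsub>ZG\<^esub> hpart m z = (?v \<otimes>\<^bsub>ZG\<^esub> t) \<otimes>\<^bsub>ZG\<^esub> hpart m z"
      using zm R_comm[OF t v(1)] by simp
    also have "\<dots> = ?v \<otimes>\<^bsub>ZG\<^esub> (\<lambda>_. 0)" using t0 v tc hz by (simp add: ZG.m_assoc)
    also have "\<dots> = (\<lambda>_. 0)" by (auto simp: fun_eq_iff group_ring_mult)
    finally have "hpart m z \<otimes>\<^bsub>ZG\<^esub> hpart m z = (\<lambda>_. 0)" .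
    moreover have "hpart m z xm \<noteq> 0" using xm by (simp add: hpart_nonzero)
    ultimately show False
      using gr_square_nonzero[of "hpart m z" H xm] hz(1) Hc H_inv by (auto simp: R_def)
  qed
  \<comment> \<open>With \<open>m = 0\<close> the comparison of top components reads
    \<open>t e = t\<close>; multiplying by the component of \<open>w'\<close> of degree
    \<open>-a\<close> turns this into idempotence of \<open>e\<close>.\<close>
  define e where "e = hpart 0 z"
  have e: "e \<in> R" "e \<in> carrier ZG" using R_hpart[OF z] R_carrier by (auto simp: e_def)
  let ?v = "hpart (- a) w'"
  have v: "?v \<in> R" "?v \<in> carrier ZG" using R_hpart[OF w'] R_carrier by auto
  have e_eq: "e = t \<otimes>\<^bsub>ZG\<^esub> ?v" using zm \<open>m = 0\<close> by (simp add: e_def)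
  have "hpart a t = t" using t_hom by (auto simp: hpart_def supp_on_def fun_eq_iff)
  then have te: "t \<otimes>\<^bsub>ZG\<^esub> e = t" using top \<open>m = 0\<close> by (simp add: e_def)
  have "e \<otimes>\<^bsub>ZG\<^esub> e = (?v \<otimes>\<^bsub>ZG\<^esub> t) \<otimes>\<^bsub>ZG\<^esub> e" using e_eq R_comm[OF t v(1)] by simp
  also have "\<dots> = ?v \<otimes>\<^bsub>ZG\<^esub> t" using te v e tc by (simp add: ZG.m_assoc)
  finally have ee: "e \<otimes>\<^bsub>ZG\<^esub> e = e" using e_eq R_comm[OF t v(1)] by simp
  have "e xm \<noteq> 0" using xm \<open>m = 0\<close> by (simp add: e_def hpart_nonzero)
  then have e1: "e = \<one>\<^bsub>ZG\<^esub>"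
    using idempotent_trivial[of e H xm] e(1) ee Hc H_inv by (auto simp: R_def)
  \<comment> \<open>Because \<open>e = 1\<close>, multiplication by \<open>t\<close> is injective.
    It sends the component of \<open>w'\<close> of degree \<open>b\<close> to that of
    \<open>z\<close> of degree \<open>a + b\<close>, which is zero above degree
    \<open>0\<close>.\<close>
  have w'_top: "d y \<le> - a" if y: "w' y \<noteq> 0" for y
  proof (rule ccontr)
    assume "\<not> d y \<le> - a"
    then have "hpart (a + d y) z = (\<lambda>_. 0)"
      using m_max \<open>m = 0\<close> by (force simp: hpart_def supp_on_def fun_eq_iff)
    then have t0: "t \<otimes>\<^bsub>ZG\<^esub> hpart (d y) w' = (\<lambda>_. 0)"
      using hpart_mult_homogeneous[OF t w' t_hom, of "d y"] by (simp add: z_def)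
    let ?y = "hpart (d y) w'"
    have yR: "?y \<in> carrier ZG" using R_hpart[OF w'] R_carrier by auto
    have "?y = (?v \<otimes>\<^bsub>ZG\<^esub> t) \<otimes>\<^bsub>ZG\<^esub> ?y" using e1 e_eq R_comm[OF t v(1)] yR by simp
    also have "\<dots> = ?v \<otimes>\<^bsub>ZG\<^esub> (\<lambda>_. 0)" using t0 v tc yR by (simp add: ZG.m_assoc)
    also have "\<dots> = (\<lambda>_. 0)" by (auto simp: fun_eq_iff group_ring_mult)
    finally have "?y y = 0" by (simp add: fun_eq_iff)
    then show False using y by (simp add: hpart_def supp_on_def)
  qed
  have "\<exists>y. w' y \<noteq> 0"
  proof (rule ccontr)
    assume "\<nexists>y. w' y \<noteq> 0"
    then have "w \<otimes>\<^bsub>ZG\<^esub> w' = (\<lambda>_. 0)" by (auto simp: fun_eq_iff group_ring_mult)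
    then show False using ww by (auto simp: group_ring_one fun_eq_iff split: if_splits)
  qed
  then obtain y where y: "w' y \<noteq> 0" by blast
  then have yH: "y \<in> H" using R_supp[OF w'] by blast
  then have "w' (inv y) \<noteq> 0" using fun_cong[OF star(2), of y] y Hc by (auto simp: gr_star_def)
  then have "d (inv y) \<le> - a" "d y \<le> - a" using w'_top y by auto
  then show False using d_inv[OF yH] \<open>a > 0\<close> by linarith
qed

end

context group begin

text \<open>The conjugacy class of a support point stays inside the finite support.\<close>

lemma class_fun_supp_FC:
  assumes f: "f \<in> carrier ZG" and c: "class_fun G (carrier G) f" and x: "f x \<noteq> 0"
  shows "x \<in> FC_subgroup G"
proof -
  have xc: "x \<in> carrier G" using group_ring_nonzeroD[OF f x] .
  have "{y. conj_in G x y} \<subseteq> {y. f y \<noteq> 0}"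
    using c x xc by (auto simp: conj_in_def class_fun_def)
  then show ?thesis using f xc by (auto simp: FC_subgroup_def intro: finite_subset)
qed

lemma symmetric_central_unit_supp:
  assumes w: "w \<in> carrier ZG" "class_fun G (carrier G) w" "gr_star G w = w"
    and w': "w' \<in> carrier ZG" "class_fun G (carrier G) w'" "gr_star G w' = w'"
    and ww: "w \<otimes>\<^bsub>ZG\<^esub> w' = \<one>\<^bsub>ZG\<^esub>" and x: "w x \<noteq> 0"
  shows "x \<in> FC_torsion G"
proof (rule ccontr)
  assume "x \<notin> FC_torsion G"
  then have tor: "\<not> torsion_elt G x"
    using class_fun_supp_FC[OF w(1,2) x] by (simp add: FC_torsion_def)
  \<comment> \<open>The support of the inverse is included among the generators so that both
    \<open>w\<close> and \<open>w'\<close> lie in the graded ring \<open>R\<close>.\<close>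
  let ?F = "{x. w x \<noteq> 0} \<union> {x. w' x \<noteq> 0}"
  have F: "finite ?F" "?F \<subseteq> FC_subgroup G"
    using w w' class_fun_supp_FC by auto
  then have Fc: "?F \<subseteq> carrier G" by (auto simp: FC_subgroup_def)
  have x0: "x \<in> generate G ?F" using x by (intro generate.incl) auto
  obtain d where dd: "\<And>x y. x \<in> generate G ?F \<Longrightarrow> y \<in> generate G ?F \<Longrightarrow> d (x \<otimes> y) = d x + d y" "d x \<noteq> (0::real)"
    using FC_real_hom_nonzero[OF F x0 tor] by blast
  interpret graded_group_ring G "generate G ?F" d
    by (intro graded_group_ring.intro graded_group_ring_axioms.intro is_group generate_is_subgroup[OF Fc] dd(1))
  have "w \<in> R" "w' \<in> R"
    using w w' Hc by (auto simp: R_def class_fun_def subset_iff intro: generate.incl)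
  then show False using symmetric_unit_degree_zero[of w w' x] ww w(3) w'(3) x dd(2) by blast
qed

end

section \<open>Cut-groups from quotients and normal subgroups\<close>

lemma sum_squares_eq_one:
  fixes f :: "'a \<Rightarrow> int"
  assumes fin: "finite {x. f x \<noteq> 0}" and one: "(\<Sum>x | f x \<noteq> 0. (f x)\<^sup>2) = 1"
  shows "\<exists>x. f = gr_monom (f x) x \<and> f x \<in> {1, -1}"
proof -
  have "{x. f x \<noteq> 0} \<noteq> {}" using one by force
  then obtain x where x: "f x \<noteq> 0" by blast
  have "(\<Sum>x | f x \<noteq> 0. (f x)\<^sup>2) = (f x)\<^sup>2 + (\<Sum>y\<in>{x. f x \<noteq> 0} - {x}. (f y)\<^sup>2)"
    using x by (intro sum.remove[OF fin]) auto
  moreover have "(\<Sum>y\<in>{x. f x \<noteq> 0} - {x}. (f y)\<^sup>2) \<ge> 0" by (intro sum_nonneg) auto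
  moreover have "(f x)\<^sup>2 > 0" using x by simp
  ultimately have eq: "(f x)\<^sup>2 = 1" "(\<Sum>y\<in>{x. f x \<noteq> 0} - {x}. (f y)\<^sup>2) = 0" using one by linarith+
  have "f y = 0" if "y \<noteq> x" for y
    using eq(2) fin that by (subst (asm) sum_nonneg_eq_0_iff) auto
  then have "f = gr_monom (f x) x" by (auto simp: gr_monom_def fun_eq_iff)
  moreover have "f x \<in> {1, -1}" using eq(1) by (simp add: power2_eq_1_iff)
  ultimately show ?thesis by blast
qed

section \<open>Push-forward of group ring elements along a homomorphism\<close>

definition gr_push :: "('a \<Rightarrow> 'b) \<Rightarrow> ('a \<Rightarrow> int) \<Rightarrow> 'b \<Rightarrow> int" where
  "gr_push \<phi> f v = (\<Sum>x | f x \<noteq> 0. if \<phi> x = v then f x else 0)"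

lemma gr_push_sum:
  assumes "finite S" "{x. f x \<noteq> 0} \<subseteq> S"
  shows "gr_push \<phi> f v = (\<Sum>x\<in>S. if \<phi> x = v then f x else 0)"
  unfolding gr_push_def using assms by (intro sum.mono_neutral_left) auto

lemma gr_push_nonzeroD:
  assumes "gr_push \<phi> f v \<noteq> 0"
  shows "\<exists>x. f x \<noteq> 0 \<and> \<phi> x = v"
proof -
  obtain x where "x \<in> {x. f x \<noteq> 0}" "(if \<phi> x = v then f x else 0) \<noteq> 0"
    using sum.not_neutral_contains_not_neutral[OF assms[unfolded gr_push_def]] by blast
  then show ?thesis by (auto split: if_splits)
qed

lemma gr_mult_double_sum:
  assumes "finite S" "{x. f x \<noteq> 0} \<subseteq> S" "finite T" "{x. g x \<noteq> 0} \<subseteq> T"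
  shows "(f \<otimes>\<^bsub>group_ring G\<^esub> g) x = (\<Sum>y\<in>S. \<Sum>z\<in>T. if y \<otimes>\<^bsub>G\<^esub> z = x then f y * g z else 0)"
proof -
  have fin: "finite {z. g z \<noteq> 0}" using assms finite_subset by blast
  have "(\<Sum>z | g z \<noteq> 0 \<and> y \<otimes>\<^bsub>G\<^esub> z = x. f y * g z) = (\<Sum>z\<in>T. if y \<otimes>\<^bsub>G\<^esub> z = x then f y * g z else 0)" for y
  proof -
    have "(\<Sum>z\<in>T. if y \<otimes>\<^bsub>G\<^esub> z = x then f y * g z else 0) = (\<Sum>z | g z \<noteq> 0. if y \<otimes>\<^bsub>G\<^esub> z = x then f y * g z else 0)"
      using assms by (intro sum.mono_neutral_right) auto
    also have "\<dots> = (\<Sum>z | g z \<noteq> 0 \<and> y \<otimes>\<^bsub>G\<^esub> z = x. f y * g z)"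
      using sum.inter_filter[OF fin, of "\<lambda>z. f y * g z" "\<lambda>z. y \<otimes>\<^bsub>G\<^esub> z = x"] by simp
    finally show ?thesis by simp
  qed
  then have "(f \<otimes>\<^bsub>group_ring G\<^esub> g) x = (\<Sum>y | f y \<noteq> 0. \<Sum>z\<in>T. if y \<otimes>\<^bsub>G\<^esub> z = x then f y * g z else 0)"
    unfolding group_ring_mult by simp
  also have "\<dots> = (\<Sum>y\<in>S. \<Sum>z\<in>T. if y \<otimes>\<^bsub>G\<^esub> z = x then f y * g z else 0)"
    using assms by (intro sum.mono_neutral_left) (auto intro!: sum.neutral)
  finally show ?thesis .
qed

lemma gr_push_closed:
  assumes "\<phi> \<in> hom G Q" "f \<in> carrier (group_ring G)"
  shows "gr_push \<phi> f \<in> carrier (group_ring Q)"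
proof -
  have "{v. gr_push \<phi> f v \<noteq> 0} \<subseteq> \<phi> ` {x. f x \<noteq> 0}" using gr_push_nonzeroD[of \<phi> f] by blast
  moreover have "\<phi> ` {x. f x \<noteq> 0} \<subseteq> carrier Q"
    using assms by (auto simp: hom_def dest: group_ring_nonzeroD)
  moreover have "finite (\<phi> ` {x. f x \<noteq> 0})" using assms by auto
  ultimately show ?thesis unfolding group_ring_carrier by (meson finite_subset subset_trans)
qed

text \<open>Both sides are the sum of \<open>f y\<close> times \<open>g z\<close> over the pairs
  whose images multiply to \<open>v\<close>: on the left the sum over products collapses at
  \<open>x = y z\<close>, on the right the images \<open>Y\<close> and \<open>Z\<close> are inserted
  as summation indices.\<close>

lemma gr_push_mult:
  assumes \<phi>: "\<phi> \<in> hom G Q" and f: "f \<in> carrier (group_ring G)" and g: "g \<in> carrier (group_ring G)"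
  shows "gr_push \<phi> (f \<otimes>\<^bsub>group_ring G\<^esub> g) = gr_push \<phi> f \<otimes>\<^bsub>group_ring Q\<^esub> gr_push \<phi> g"
proof
  fix v
  let ?S = "{x. f x \<noteq> 0}" and ?T = "{x. g x \<noteq> 0}"
  have fin: "finite ?S" "finite ?T" using f g by auto
  let ?P = "(\<lambda>(y, z). y \<otimes>\<^bsub>G\<^esub> z) ` (?S \<times> ?T)"
  have finP: "finite ?P" using fin by auto
  have P: "{x. (f \<otimes>\<^bsub>group_ring G\<^esub> g) x \<noteq> 0} \<subseteq> ?P"
  proof
    fix x assume "x \<in> {x. (f \<otimes>\<^bsub>group_ring G\<^esub> g) x \<noteq> 0}"
    then obtain y z where "f y \<noteq> 0" "g z \<noteq> 0" "x = y \<otimes>\<^bsub>G\<^esub> z"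
      using group_ring_mult_nonzeroD[of G f g] by blast
    then show "x \<in> ?P" by (intro image_eqI[of _ _ "(y, z)"]) auto
  qed
  have "gr_push \<phi> (f \<otimes>\<^bsub>group_ring G\<^esub> g) v
      = (\<Sum>x\<in>?P. if \<phi> x = v then (f \<otimes>\<^bsub>group_ring G\<^esub> g) x else 0)"
    by (rule gr_push_sum[OF finP P])
  also have "\<dots> = (\<Sum>x\<in>?P. \<Sum>y\<in>?S. \<Sum>z\<in>?T. if y \<otimes>\<^bsub>G\<^esub> z = x then if \<phi> x = v then f y * g z else 0 else 0)"
    unfolding gr_mult_double_sum[OF fin(1) order_refl fin(2) order_refl]
  proof (rule sum.cong[OF HOL.refl])
    fix x
    show "(if \<phi> x = v then \<Sum>y\<in>?S. \<Sum>z\<in>?T. if y \<otimes>\<^bsub>G\<^esub> z = x then f y * g z else 0 else 0)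
        = (\<Sum>y\<in>?S. \<Sum>z\<in>?T. if y \<otimes>\<^bsub>G\<^esub> z = x then if \<phi> x = v then f y * g z else 0 else 0)"
      by (cases "\<phi> x = v") (simp_all cong: if_cong)
  qed
  also have "\<dots> = (\<Sum>y\<in>?S. \<Sum>x\<in>?P. \<Sum>z\<in>?T. if y \<otimes>\<^bsub>G\<^esub> z = x then if \<phi> x = v then f y * g z else 0 else 0)"
    by (rule sum.swap)
  also have "\<dots> = (\<Sum>y\<in>?S. \<Sum>z\<in>?T. \<Sum>x\<in>?P. if y \<otimes>\<^bsub>G\<^esub> z = x then if \<phi> x = v then f y * g z else 0 else 0)"
    by (intro sum.cong HOL.refl sum.swap)
  also have "\<dots> = (\<Sum>y\<in>?S. \<Sum>z\<in>?T. if \<phi> y \<otimes>\<^bsub>Q\<^esub> \<phi> z = v then f y * g z else 0)"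
  proof (intro sum.cong HOL.refl)
    fix y z assume yz: "y \<in> ?S" "z \<in> ?T"
    then have "y \<otimes>\<^bsub>G\<^esub> z \<in> ?P" by force
    moreover have "\<phi> (y \<otimes>\<^bsub>G\<^esub> z) = \<phi> y \<otimes>\<^bsub>Q\<^esub> \<phi> z"
      using yz group_ring_nonzeroD[OF f, of y] group_ring_nonzeroD[OF g, of z] \<phi> by (simp add: hom_def)
    ultimately show "(\<Sum>x\<in>?P. if y \<otimes>\<^bsub>G\<^esub> z = x then if \<phi> x = v then f y * g z else 0 else 0)
        = (if \<phi> y \<otimes>\<^bsub>Q\<^esub> \<phi> z = v then f y * g z else 0)"
      by (subst sum.delta'[OF finP]) simp
  qed
  also have "\<dots> = (\<Sum>y\<in>?S. \<Sum>z\<in>?T. \<Sum>Y\<in>\<phi> ` ?S. \<Sum>Z\<in>\<phi> ` ?T.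
      if \<phi> y = Y then if \<phi> z = Z then if Y \<otimes>\<^bsub>Q\<^esub> Z = v then f y * g z else 0 else 0 else 0)"
  proof (intro sum.cong HOL.refl)
    fix y z assume yz: "y \<in> ?S" "z \<in> ?T"
    have "(\<Sum>Y\<in>\<phi> ` ?S. \<Sum>Z\<in>\<phi> ` ?T.
      if \<phi> y = Y then if \<phi> z = Z then if Y \<otimes>\<^bsub>Q\<^esub> Z = v then f y * g z else 0 else 0 else 0)
      = (\<Sum>Y\<in>\<phi> ` ?S. if \<phi> y = Y then \<Sum>Z\<in>\<phi> ` ?T.
          if \<phi> z = Z then if Y \<otimes>\<^bsub>Q\<^esub> Z = v then f y * g z else 0 else 0 else 0)"
      by (intro sum.cong HOL.refl) auto
    also have "\<dots> = (if \<phi> y \<otimes>\<^bsub>Q\<^esub> \<phi> z = v then f y * g z else 0)"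
      using fin yz by (simp add: sum.delta')
    finally show "(if \<phi> y \<otimes>\<^bsub>Q\<^esub> \<phi> z = v then f y * g z else 0) = (\<Sum>Y\<in>\<phi> ` ?S. \<Sum>Z\<in>\<phi> ` ?T.
      if \<phi> y = Y then if \<phi> z = Z then if Y \<otimes>\<^bsub>Q\<^esub> Z = v then f y * g z else 0 else 0 else 0)" by simp
  qed
  also have "\<dots> = (\<Sum>y\<in>?S. \<Sum>Y\<in>\<phi> ` ?S. \<Sum>z\<in>?T. \<Sum>Z\<in>\<phi> ` ?T.
      if \<phi> y = Y then if \<phi> z = Z then if Y \<otimes>\<^bsub>Q\<^esub> Z = v then f y * g z else 0 else 0 else 0)"
    by (intro sum.cong HOL.refl sum.swap)
  also have "\<dots> = (\<Sum>Y\<in>\<phi> ` ?S. \<Sum>y\<in>?S. \<Sum>z\<in>?T. \<Sum>Z\<in>\<phi> ` ?T.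
      if \<phi> y = Y then if \<phi> z = Z then if Y \<otimes>\<^bsub>Q\<^esub> Z = v then f y * g z else 0 else 0 else 0)"
    by (rule sum.swap)
  also have "\<dots> = (\<Sum>Y\<in>\<phi> ` ?S. \<Sum>y\<in>?S. \<Sum>Z\<in>\<phi> ` ?T. \<Sum>z\<in>?T.
      if \<phi> y = Y then if \<phi> z = Z then if Y \<otimes>\<^bsub>Q\<^esub> Z = v then f y * g z else 0 else 0 else 0)"
    by (intro sum.cong HOL.refl sum.swap)
  also have "\<dots> = (\<Sum>Y\<in>\<phi> ` ?S. \<Sum>Z\<in>\<phi> ` ?T. \<Sum>y\<in>?S. \<Sum>z\<in>?T.
      if \<phi> y = Y then if \<phi> z = Z then if Y \<otimes>\<^bsub>Q\<^esub> Z = v then f y * g z else 0 else 0 else 0)"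
    by (intro sum.cong HOL.refl sum.swap)
  also have "\<dots> = (\<Sum>Y\<in>\<phi> ` ?S. \<Sum>Z\<in>\<phi> ` ?T. if Y \<otimes>\<^bsub>Q\<^esub> Z = v then gr_push \<phi> f Y * gr_push \<phi> g Z else 0)"
  proof (intro sum.cong HOL.refl)
    fix Y Z
    have "gr_push \<phi> f Y * gr_push \<phi> g Z
        = (\<Sum>y\<in>?S. \<Sum>z\<in>?T. if \<phi> y = Y then if \<phi> z = Z then f y * g z else 0 else 0)"
      unfolding gr_push_def sum_product by (intro sum.cong HOL.refl) simp
    then show "(\<Sum>y\<in>?S. \<Sum>z\<in>?T. if \<phi> y = Y then if \<phi> z = Z then if Y \<otimes>\<^bsub>Q\<^esub> Z = v then f y * g z else 0 else 0 else 0)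
        = (if Y \<otimes>\<^bsub>Q\<^esub> Z = v then gr_push \<phi> f Y * gr_push \<phi> g Z else 0)"
      by (cases "Y \<otimes>\<^bsub>Q\<^esub> Z = v") (simp_all cong: if_cong)
  qed
  also have "\<dots> = (gr_push \<phi> f \<otimes>\<^bsub>group_ring Q\<^esub> gr_push \<phi> g) v"
    using fin gr_push_nonzeroD[of \<phi> f] gr_push_nonzeroD[of \<phi> g]
    by (intro gr_mult_double_sum[symmetric]) blast+
  finally show "gr_push \<phi> (f \<otimes>\<^bsub>group_ring G\<^esub> g) v = (gr_push \<phi> f \<otimes>\<^bsub>group_ring Q\<^esub> gr_push \<phi> g) v" .
qed

lemma gr_push_one:
  assumes "\<phi> \<one>\<^bsub>G\<^esub> = \<one>\<^bsub>Q\<^esub>"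
  shows "gr_push \<phi> \<one>\<^bsub>group_ring G\<^esub> = \<one>\<^bsub>group_ring Q\<^esub>"
  using assms by (subst gr_push_sum[of "{\<one>\<^bsub>G\<^esub>}"] | auto simp: fun_eq_iff group_ring_one)+

context group begin

text \<open>With \<open>w = u u^*\<close>, a square sum of \<open>1\<close> makes \<open>w\<close>
  plus or minus a group element, and its positive coefficient at \<open>1\<close> makes it
  \<open>1\<close>. That coefficient is the square sum of \<open>u\<close>, so \<open>u\<close> is
  plus or minus a group element, central by conjugation invariance. The facts about
  \<open>w'\<close> are passed on for arguments that must control the support of the
  inverse.\<close>

lemma cut_groupI:
  assumes triv: "\<And>w w'. w \<in> carrier ZG \<Longrightarrow> w' \<in> carrier ZG \<Longrightarrow> class_fun G (carrier G) w \<Longrightarrow>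
    class_fun G (carrier G) w' \<Longrightarrow> gr_star G w = w \<Longrightarrow> gr_star G w' = w' \<Longrightarrow>
    w \<otimes>\<^bsub>ZG\<^esub> w' = \<one>\<^bsub>ZG\<^esub> \<Longrightarrow> w' \<otimes>\<^bsub>ZG\<^esub> w = \<one>\<^bsub>ZG\<^esub> \<Longrightarrow>
    {x. w x \<noteq> 0} \<subseteq> FC_torsion G \<Longrightarrow> {x. w' x \<noteq> 0} \<subseteq> FC_torsion G \<Longrightarrow> w \<one> > 0 \<Longrightarrow>
    (\<Sum>x | w x \<noteq> 0. (w x)\<^sup>2) = 1"
  shows "cut_group G"
  unfolding cut_group_def
proof (intro equalityI subsetI)
  interpret ZG: monoid ZG by (rule monoid_group_ring)
  fix u assume u: "u \<in> group_center (units_of ZG)"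
  have cu: "class_fun G (carrier G) u" using center_units_class_fun[OF u] .
  have "u \<in> Units ZG" using u by (simp add: group_center_def units_of_def)
  then obtain u' where uu: "u \<in> carrier ZG" "u' \<in> carrier ZG"
    "u \<otimes>\<^bsub>ZG\<^esub> u' = \<one>\<^bsub>ZG\<^esub>" "u' \<otimes>\<^bsub>ZG\<^esub> u = \<one>\<^bsub>ZG\<^esub>"
    by (auto simp: Units_def)
  have cu': "class_fun G (carrier G) u'" using class_fun_inverse[OF cu uu] .
  let ?s = "gr_star G u" and ?s' = "gr_star G u'"
  have s: "?s \<in> carrier ZG" "?s' \<in> carrier ZG" using uu gr_star_closed by auto
  have ss: "?s \<otimes>\<^bsub>ZG\<^esub> ?s' = \<one>\<^bsub>ZG\<^esub>" "?s' \<otimes>\<^bsub>ZG\<^esub> ?s = \<one>\<^bsub>ZG\<^esub>"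
    using gr_star_mult[OF uu(2,1)] gr_star_mult[OF uu(1,2)] uu gr_star_one by auto
  define w where "w = u \<otimes>\<^bsub>ZG\<^esub> ?s"
  define w' where "w' = ?s' \<otimes>\<^bsub>ZG\<^esub> u'"
  have w: "w \<in> carrier ZG" "w' \<in> carrier ZG" using uu s by (auto simp: w_def w'_def)
  have cw: "class_fun G (carrier G) w" "class_fun G (carrier G) w'"
    unfolding w_def w'_def using uu s cu cu' by (auto intro!: class_fun_mult class_fun_star)
  have sw: "gr_star G w = w" "gr_star G w' = w'"
    unfolding w_def w'_def using uu s by (simp_all add: gr_star_mult gr_star_star)
  have "w \<otimes>\<^bsub>ZG\<^esub> w' = u \<otimes>\<^bsub>ZG\<^esub> (?s \<otimes>\<^bsub>ZG\<^esub> ?s') \<otimes>\<^bsub>ZG\<^esub> u'"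
    unfolding w_def w'_def using uu(1,2) s by (simp add: ZG.m_assoc)
  then have ww: "w \<otimes>\<^bsub>ZG\<^esub> w' = \<one>\<^bsub>ZG\<^esub>" using ss uu by simp
  have "w' \<otimes>\<^bsub>ZG\<^esub> w = ?s' \<otimes>\<^bsub>ZG\<^esub> (u' \<otimes>\<^bsub>ZG\<^esub> u) \<otimes>\<^bsub>ZG\<^esub> ?s"
    unfolding w_def w'_def using uu(1,2) s by (simp add: ZG.m_assoc)
  then have ww': "w' \<otimes>\<^bsub>ZG\<^esub> w = \<one>\<^bsub>ZG\<^esub>" using ss uu s by simp
  have w1: "w \<one> = (\<Sum>x | u x \<noteq> 0. (u x)\<^sup>2)" unfolding w_def by (rule gr_mult_star_at_one[OF uu(1)])
  have finu: "finite {x. u x \<noteq> 0}" using uu by auto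
  have "{x. u x \<noteq> 0} \<noteq> {}"
  proof
    assume "{x. u x \<noteq> 0} = {}"
    then have "u \<otimes>\<^bsub>ZG\<^esub> u' = (\<lambda>_. 0)" by (auto simp: fun_eq_iff group_ring_mult)
    then show False using uu(3) by (auto simp: group_ring_one fun_eq_iff split: if_splits)
  qed
  then have pos: "w \<one> > 0" unfolding w1 using finu by (intro sum_pos) auto
  have "{x. w x \<noteq> 0} \<subseteq> FC_torsion G"
    using symmetric_central_unit_supp[OF w(1) cw(1) sw(1) w(2) cw(2) sw(2) ww] by (intro subsetI) simp
  moreover have "{x. w' x \<noteq> 0} \<subseteq> FC_torsion G"
    using symmetric_central_unit_supp[OF w(2) cw(2) sw(2) w(1) cw(1) sw(1) ww'] by (intro subsetI) simp
  ultimately have "(\<Sum>x | w x \<noteq> 0. (w x)\<^sup>2) = 1"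
    by (rule triv[OF w cw sw ww ww' _ _ pos])
  then obtain y where y: "w = gr_monom (w y) y" "w y \<in> {1, -1}"
    using sum_squares_eq_one[OF group_ring_finite_support[OF w(1)]] by blast
  have "w \<one> = (if \<one> = y then w y else 0)" using fun_cong[OF y(1), of \<one>] unfolding gr_monom_def .
  then have "w \<one> = 1" using pos y(2) by (auto split: if_splits)
  then obtain x where x: "u = gr_monom (u x) x" "u x \<in> {1, -1}"
    using sum_squares_eq_one[OF finu] w1 by metis
  then have xc: "x \<in> carrier G" using group_ring_nonzeroD[OF uu(1), of x] by auto
  have "x \<in> group_center G"
    unfolding group_center_def
  proof (simp add: xc, intro ballI)
    fix h assume h: "h \<in> carrier G"
    have "u (h \<otimes> x \<otimes> inv h) = u x" using cu h xc by (auto simp: class_fun_def)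
    then have "gr_monom (u x) x (h \<otimes> x \<otimes> inv h) \<noteq> 0" using x by auto
    then have "h \<otimes> x \<otimes> inv h = x" by (simp add: gr_monom_def split: if_splits)
    then have "h \<otimes> x \<otimes> inv h \<otimes> h = x \<otimes> h" by simp
    then show "x \<otimes> h = h \<otimes> x" using h xc by simp
  qed
  with x show "u \<in> {gr_monom e z |e z. e \<in> {1, -1} \<and> z \<in> group_center G}" by blast
next
  fix u assume "u \<in> {gr_monom e z |e z. e \<in> {1, -1} \<and> z \<in> group_center G}"
  then obtain e z where u: "u = gr_monom e z" "e \<in> {1, -1}" and z: "z \<in> group_center G" by blast
  have zc: "z \<in> carrier G" using z by (simp add: group_center_def)
  have "class_fun G (carrier G) u"
    unfolding class_fun_def
  proof (intro ballI)
    fix h x assume h: "h \<in> carrier G" and x: "x \<in> carrier G"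
    have zh: "z \<otimes> h = h \<otimes> z" using z h by (simp add: group_center_def)
    have "h \<otimes> x \<otimes> inv h = z \<longleftrightarrow> h \<otimes> x = z \<otimes> h" using h x zc inv_solve_right[of z "h \<otimes> x" h] by auto
    also have "\<dots> \<longleftrightarrow> x = z" using h x zc by (simp add: zh)
    finally show "u (h \<otimes> x \<otimes> inv h) = u x" by (simp add: u gr_monom_def)
  qed
  then show "u \<in> group_center (units_of ZG)"
    using gr_monom_unit[OF zc u(2)] u(1) class_fun_center_units by blast
qed

text \<open>Torsion elements are not closed under products in general; here any two of them lie in a
  common finite subgroup.\<close>

lemma subgroup_FC_torsion: "subgroup (FC_torsion G) G"
proof (rule subgroupI)
  show "FC_torsion G \<subseteq> carrier G" by (auto simp: FC_torsion_def FC_subgroup_def)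
  have *: "\<exists>T. subgroup T G \<and> F \<subseteq> T \<and> T \<subseteq> FC_torsion G" if "finite F" "F \<subseteq> FC_torsion G" for F
    using finite_FC_torsion_subset_subgroup[OF that] by blast
  from *[of "{}"] show "FC_torsion G \<noteq> {}" by (auto dest: subgroup.one_closed)
  fix a b assume a: "a \<in> FC_torsion G"
  from *[of "{a}"] a show "inv a \<in> FC_torsion G" by (auto dest: subgroup.m_inv_closed)
  assume "b \<in> FC_torsion G"
  then obtain T where T: "subgroup T G" "{a, b} \<subseteq> T" "T \<subseteq> FC_torsion G" using *[of "{a, b}"] a by auto
  then have "a \<otimes> b \<in> T" by (intro subgroup.m_closed[OF T(1)]) auto
  then show "a \<otimes> b \<in> FC_torsion G" using T by blast
qed

text \<open>By surjectivity, conjugation in \<open>Q\<close> lifts to conjugation by some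
  \<open>g\<close>, which permutes the support of \<open>f\<close> and carries fibres to
  fibres.\<close>

lemma class_fun_push:
  assumes Q: "group Q" and \<phi>: "\<phi> \<in> hom G Q" "\<phi> ` carrier G = carrier Q"
    and f: "f \<in> carrier ZG" "class_fun G (carrier G) f"
  shows "class_fun Q (carrier Q) (gr_push \<phi> f)"
  unfolding class_fun_def
proof (intro ballI)
  interpret Q: group Q by (rule Q)
  interpret phi: group_hom G Q \<phi> by (unfold_locales) (rule \<phi>(1))
  fix h x assume h: "h \<in> carrier Q" and x: "x \<in> carrier Q"
  obtain g where g: "g \<in> carrier G" "h = \<phi> g" using h \<phi>(2) by blast
  let ?S = "{x. f x \<noteq> 0}" and ?c = "\<lambda>y. g \<otimes> y \<otimes> inv g"
  have Sc: "y \<in> carrier G" if "y \<in> ?S" for y using that f(1) by (auto dest: group_ring_nonzeroD)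
  have fc: "f (?c y) = f y" if "y \<in> carrier G" for y using f(2) g that by (auto simp: class_fun_def)
  have bij: "bij_betw ?c ?S ?S"
  proof (rule bij_betwI[of _ _ _ "\<lambda>y. inv g \<otimes> y \<otimes> g"])
    show "?c \<in> ?S \<rightarrow> ?S" using Sc fc by auto
    have "f (inv g \<otimes> y \<otimes> g) = f y" if "y \<in> carrier G" for y
      using f(2) g that unfolding class_fun_def by (metis inv_closed inv_inv)
    then show "(\<lambda>y. inv g \<otimes> y \<otimes> g) \<in> ?S \<rightarrow> ?S" using Sc by auto
    show "inv g \<otimes> ?c y \<otimes> g = y" if "y \<in> ?S" for y using Sc[OF that] g by (simp add: m_assoc)
    show "?c (inv g \<otimes> y \<otimes> g) = y" if "y \<in> ?S" for y using Sc[OF that] g by (simp add: m_assoc)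
  qed
  have "gr_push \<phi> f (h \<otimes>\<^bsub>Q\<^esub> x \<otimes>\<^bsub>Q\<^esub> inv\<^bsub>Q\<^esub> h) = (\<Sum>y\<in>?S. if \<phi> (?c y) = h \<otimes>\<^bsub>Q\<^esub> x \<otimes>\<^bsub>Q\<^esub> inv\<^bsub>Q\<^esub> h then f (?c y) else 0)"
    unfolding gr_push_def
    using sum.reindex_bij_betw[OF bij, of "\<lambda>y. if \<phi> y = h \<otimes>\<^bsub>Q\<^esub> x \<otimes>\<^bsub>Q\<^esub> inv\<^bsub>Q\<^esub> h then f y else 0"] by simp
  also have "\<dots> = gr_push \<phi> f x"
    unfolding gr_push_def
  proof (rule sum.cong[OF HOL.refl])
    fix y assume "y \<in> ?S"
    then have y: "y \<in> carrier G" by (rule Sc)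
    have "\<phi> (?c y) = h \<otimes>\<^bsub>Q\<^esub> x \<otimes>\<^bsub>Q\<^esub> inv\<^bsub>Q\<^esub> h \<longleftrightarrow> \<phi> y = x"
      using y g h x by simp
    then show "(if \<phi> (?c y) = h \<otimes>\<^bsub>Q\<^esub> x \<otimes>\<^bsub>Q\<^esub> inv\<^bsub>Q\<^esub> h then f (?c y) else 0) = (if \<phi> y = x then f y else 0)"
      using fc[OF y] by simp
  qed
  finally show "gr_push \<phi> f (h \<otimes>\<^bsub>Q\<^esub> x \<otimes>\<^bsub>Q\<^esub> inv\<^bsub>Q\<^esub> h) = gr_push \<phi> f x" .
qed

text \<open>Two support points of \<open>w\<close> in one coset differ by an element of
  \<open>N\<close> that is also in \<open>\<Phi>\<^sup>+\<close>, hence are equal. The image of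
  \<open>w\<close> is plus or minus a single coset, so \<open>w\<close> has a single support point,
  and \<open>1\<close> is one.\<close>

theorem cut_group_from_quotient:
  assumes N: "N \<lhd> G" and cut: "cut_group (G Mod N)" and int: "N \<inter> FC_torsion G = {\<one>}"
  shows "cut_group G"
proof (rule cut_groupI)
  interpret N: normal N G by (rule N)
  let ?Q = "G Mod N" and ?\<phi> = "\<lambda>x. N #> x"
  have Q: "group ?Q" by (rule N.factorgroup_is_group)
  have hom: "?\<phi> \<in> hom G ?Q" by (rule N.r_coset_hom_Mod)
  have onto: "?\<phi> ` carrier G = carrier ?Q" by (auto simp: FactGroup_def RCOSETS_def)
  fix w w' assume w: "w \<in> carrier ZG" "w' \<in> carrier ZG" "class_fun G (carrier G) w"
    and ww: "w \<otimes>\<^bsub>ZG\<^esub> w' = \<one>\<^bsub>ZG\<^esub>" "w' \<otimes>\<^bsub>ZG\<^esub> w = \<one>\<^bsub>ZG\<^esub>"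
    and FC: "{x. w x \<noteq> 0} \<subseteq> FC_torsion G" and w1: "w \<one> > 0"
  have "?\<phi> \<one> = \<one>\<^bsub>?Q\<^esub>" by (simp add: coset_mult_one N.subset)
  note push_one = gr_push_one[of ?\<phi> G ?Q, OF this]
  have "gr_push ?\<phi> w \<in> Units (group_ring ?Q)"
    using gr_push_closed[OF hom w(1)] gr_push_closed[OF hom w(2)]
      gr_push_mult[OF hom w(1,2)] gr_push_mult[OF hom w(2,1)] ww push_one
    by (auto simp: Units_def intro!: bexI[of _ "gr_push ?\<phi> w'"])
  then have "gr_push ?\<phi> w \<in> group_center (units_of (group_ring ?Q))"
    using group.class_fun_center_units[OF Q] class_fun_push[OF Q hom onto w(1,3)] by blast
  then obtain e q where e: "gr_push ?\<phi> w = gr_monom e q" "e \<in> {1, -1}"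
    using cut by (auto simp: cut_group_def)
  have inj: "x = y" if xy: "w x \<noteq> 0" "w y \<noteq> 0" "?\<phi> x = ?\<phi> y" for x y
  proof -
    have FCxy: "x \<in> FC_torsion G" "y \<in> FC_torsion G" using FC xy by auto
    then have c: "x \<in> carrier G" "y \<in> carrier G" using subgroup.mem_carrier[OF subgroup_FC_torsion] by auto
    have "x \<in> N #> y" using xy(3) rcos_self[OF c(1) N.is_subgroup] by simp
    then obtain n where n: "n \<in> N" "x = n \<otimes> y" by (auto simp: r_coset_def)
    then have "n = x \<otimes> inv y" using c N.mem_carrier by simp
    then have "n \<in> FC_torsion G"
      using FCxy subgroup.m_closed[OF subgroup_FC_torsion] subgroup.m_inv_closed[OF subgroup_FC_torsion] by auto
    then have "n = \<one>" using int n by auto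
    then show "x = y" using n c by simp
  qed
  have push: "gr_push ?\<phi> w (?\<phi> x) = w x" if x: "w x \<noteq> 0" for x
  proof -
    have "gr_push ?\<phi> w (?\<phi> x) = (\<Sum>y | w y \<noteq> 0. if y = x then w y else 0)"
      unfolding gr_push_def using inj x by (intro sum.cong HOL.refl) auto
    then show ?thesis using w(1) x by (simp add: sum.delta group_ring_finite_support)
  qed
  have "x = \<one> \<and> w x = e" if x: "w x \<noteq> 0" for x
  proof -
    have "gr_monom e q (?\<phi> x) \<noteq> 0" "gr_monom e q (?\<phi> \<one>) \<noteq> 0"
      using push[OF x] push[of \<one>] x w1 e by auto
    then have "?\<phi> x = q" "?\<phi> \<one> = q" by (auto simp: gr_monom_def split: if_splits)
    then have "x = \<one>" "w x = e"
      using inj[OF x, of \<one>] w1 push[OF x] e by (auto simp: gr_monom_def)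
    then show ?thesis by blast
  qed
  then have "{x. w x \<noteq> 0} = {\<one>}" "w \<one> = e" using w1 by auto
  then show "(\<Sum>x | w x \<noteq> 0. (w x)\<^sup>2) = 1" using e by auto
qed

section \<open>Passage to a normal subgroup\<close>

lemma conj_in_subgroupD:
  assumes "subgroup N G" "conj_in (G\<lparr>carrier := N\<rparr>) x y"
  shows "conj_in G x y"
  using assms m_inv_consistent[OF assms(1)] subgroup.mem_carrier[OF assms(1)]
  by (auto simp: conj_in_def)

lemma FC_torsion_subgroup_subset:
  assumes N: "subgroup N G"
  shows "N \<inter> FC_torsion G \<subseteq> FC_torsion (G\<lparr>carrier := N\<rparr>)"
proof
  fix x assume x: "x \<in> N \<inter> FC_torsion G"
  have "{y. conj_in (G\<lparr>carrier := N\<rparr>) x y} \<subseteq> {y. conj_in G x y}"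
    using conj_in_subgroupD[OF N] by blast
  then show "x \<in> FC_torsion (G\<lparr>carrier := N\<rparr>)"
    using x by (auto simp: FC_torsion_def FC_subgroup_def torsion_elt_def nat_pow_consistent[symmetric]
        intro: finite_subset)
qed

lemma FC_torsion_quotient:
  assumes N: "N \<lhd> G" and x: "x \<in> FC_torsion G"
  shows "N #> x \<in> FC_torsion (G Mod N)"
proof -
  interpret N: normal N G by (rule N)
  interpret Q: group "G Mod N" by (rule N.factorgroup_is_group)
  interpret h: group_hom G "G Mod N" "\<lambda>x. N #> x" by unfold_locales (rule N.r_coset_hom_Mod)
  have xc: "x \<in> carrier G" using subgroup.mem_carrier[OF subgroup_FC_torsion x] .
  have "{Y. conj_in (G Mod N) (N #> x) Y} \<subseteq> (\<lambda>x. N #> x) ` {y. conj_in G x y}"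
  proof
    fix Y assume "Y \<in> {Y. conj_in (G Mod N) (N #> x) Y}"
    then obtain g where g: "g \<in> carrier G"
      "Y = (N #> g) \<otimes>\<^bsub>G Mod N\<^esub> (N #> x) \<otimes>\<^bsub>G Mod N\<^esub> inv\<^bsub>G Mod N\<^esub> (N #> g)"
      unfolding conj_in_def by (auto simp: FactGroup_def RCOSETS_def)
    then have "Y = N #> (g \<otimes> x \<otimes> inv g)" using xc by (simp only: h.hom_mult h.hom_inv inv_closed m_closed)
    then show "Y \<in> (\<lambda>x. N #> x) ` {y. conj_in G x y}" using g conj_inI by blast
  qed
  moreover have "finite {y. conj_in G x y}" using x by (auto simp: FC_torsion_def FC_subgroup_def)
  ultimately have "finite {Y. conj_in (G Mod N) (N #> x) Y}" by (meson finite_imageI finite_subset)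
  moreover obtain n :: nat where n: "n > 0" "x [^] n = \<one>"
    using x by (auto simp: FC_torsion_def torsion_elt_def)
  then have "(N #> x) [^]\<^bsub>G Mod N\<^esub> n = \<one>\<^bsub>G Mod N\<^esub>"
    using h.hom_nat_pow[OF xc, of n] h.hom_one by simp
  ultimately show ?thesis
    using n h.hom_closed[OF xc] by (auto simp: FC_torsion_def FC_subgroup_def torsion_elt_def)
qed

lemma FC_torsion_subset_normal:
  assumes N: "N \<lhd> G" and Q: "FC_torsion (G Mod N) = {\<one>\<^bsub>G Mod N\<^esub>}"
  shows "FC_torsion G \<subseteq> N"
proof
  interpret N: normal N G by (rule N)
  fix x assume x: "x \<in> FC_torsion G"
  then have xc: "x \<in> carrier G" using subgroup.mem_carrier[OF subgroup_FC_torsion] by blast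
  have "N #> x = N" using FC_torsion_quotient[OF N x] Q by (simp add: FactGroup_def)
  then show "x \<in> N" using rcos_self[OF xc N.is_subgroup] by simp
qed

text \<open>Both \<open>w\<close> and its inverse are supported in \<open>\<Phi>\<^sup>+\<close>,
  which lies in \<open>N\<close>; so \<open>w\<close> is a unit already in the group ring of
  \<open>N\<close>, and central there since invariance restricts.\<close>

theorem cut_group_from_normal_cut:
  assumes N: "N \<lhd> G" and Q: "FC_torsion (G Mod N) = {\<one>\<^bsub>G Mod N\<^esub>}"
    and cut: "cut_group (G\<lparr>carrier := N\<rparr>)"
  shows "cut_group G"
proof (rule cut_groupI)
  interpret N: normal N G by (rule N)
  let ?N = "G\<lparr>carrier := N\<rparr>"
  have Ngrp: "group ?N" by (rule N.subgroup_is_group[OF is_group])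
  fix w w' assume w: "w \<in> carrier ZG" "w' \<in> carrier ZG" "class_fun G (carrier G) w"
    and ww: "w \<otimes>\<^bsub>ZG\<^esub> w' = \<one>\<^bsub>ZG\<^esub>" "w' \<otimes>\<^bsub>ZG\<^esub> w = \<one>\<^bsub>ZG\<^esub>"
    and FC: "{x. w x \<noteq> 0} \<subseteq> FC_torsion G" "{x. w' x \<noteq> 0} \<subseteq> FC_torsion G" and w1: "w \<one> > 0"
  have sub: "FC_torsion G \<subseteq> N" by (rule FC_torsion_subset_normal[OF N Q])
  have wN: "w \<in> carrier (group_ring ?N)" "w' \<in> carrier (group_ring ?N)"
    using w FC sub by (auto simp: group_ring_carrier)
  have "w \<in> Units (group_ring ?N)"
    using wN ww by (auto simp: Units_def group_ring_def intro!: bexI[of _ w'])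
  moreover have "class_fun ?N (carrier ?N) w"
    using w(3) m_inv_consistent[OF N.is_subgroup] N.mem_carrier by (auto simp: class_fun_def)
  ultimately have "w \<in> group_center (units_of (group_ring ?N))"
    by (rule group.class_fun_center_units[OF Ngrp])
  then obtain e z where "w = gr_monom e z" "e \<in> {1, -1}" using cut by (auto simp: cut_group_def)
  then have "{x. w x \<noteq> 0} = {z}" "w z = e" by (auto simp: gr_monom_def)
  then show "(\<Sum>x | w x \<noteq> 0. (w x)\<^sup>2) = 1" using \<open>e \<in> {1, -1}\<close> by auto
qed

end

section \<open>Rational power sums\<close>

definition mat_trace :: "'a::comm_monoid_add mat \<Rightarrow> 'a" where
  "mat_trace A = (\<Sum>i<dim_row A. A $$ (i, i))"

lemma mat_trace_comm:
  fixes A B :: "'a::comm_semiring_0 mat"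
  assumes "A \<in> carrier_mat n n" "B \<in> carrier_mat n n"
  shows "mat_trace (A * B) = mat_trace (B * A)"
proof -
  have "mat_trace (A * B) = (\<Sum>i<n. \<Sum>j<n. A $$ (i, j) * B $$ (j, i))"
    using assms by (simp add: mat_trace_def scalar_prod_def atLeast0LessThan)
  also have "\<dots> = (\<Sum>j<n. \<Sum>i<n. A $$ (i, j) * B $$ (j, i))" by (rule sum.swap)
  also have "\<dots> = mat_trace (B * A)"
    using assms by (simp add: mat_trace_def scalar_prod_def atLeast0LessThan mult.commute)
  finally show ?thesis .
qed

lemma upper_triangular_pow:
  fixes B :: "'a::comm_semiring_1 mat"
  assumes B: "B \<in> carrier_mat n n" "upper_triangular B"
  shows "upper_triangular (B ^\<^sub>m k) \<and> (\<forall>i<n. (B ^\<^sub>m k) $$ (i, i) = (B $$ (i, i)) ^ k)"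
proof (induction k)
  case 0
  then show ?case using B by auto
next
  case (Suc k)
  let ?C = "B ^\<^sub>m k"
  have C: "?C \<in> carrier_mat n n" using B by simp
  have entry: "(?C * B) $$ (i, j) = (\<Sum>l<n. ?C $$ (i, l) * B $$ (l, j))" if "i < n" "j < n" for i j
    using that B C by (simp add: scalar_prod_def atLeast0LessThan)
  have ut: "?C $$ (i, l) = 0" if "l < i" "i < n" for i l using Suc that C by auto
  have utB: "B $$ (l, j) = 0" if "j < l" "l < n" for l j using B that by auto
  have "upper_triangular (?C * B)"
  proof (rule upper_triangularI)
    fix i j assume ij: "j < i" "i < dim_row (?C * B)"
    then have i: "i < n" using B by simp
    have "?C $$ (i, l) * B $$ (l, j) = 0" if "l < n" for l
      using ut[of l i] utB[of j l] that i ij(1) by (cases "l < i") auto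
    then show "(?C * B) $$ (i, j) = 0" using entry[of i j] i ij(1) by simp
  qed
  moreover have "(?C * B) $$ (i, i) = (B $$ (i, i)) ^ Suc k" if i: "i < n" for i
  proof -
    have "(?C * B) $$ (i, i) = (\<Sum>l<n. if l = i then ?C $$ (i, i) * B $$ (i, i) else 0)"
      unfolding entry[OF i i]
    proof (rule sum.cong[OF HOL.refl])
      fix l assume "l \<in> {..<n}"
      then show "?C $$ (i, l) * B $$ (l, i) = (if l = i then ?C $$ (i, i) * B $$ (i, i) else 0)"
        using ut[of l i] utB[of i l] i by (cases "l < i"; cases "i < l") auto
    qed
    also have "\<dots> = (B $$ (i, i)) ^ Suc k" using i Suc by (simp add: mult.commute)
    finally show ?thesis .
  qed
  ultimately show ?case by simp
qed

text \<open>Schur triangularisation over the complex numbers puts the eigenvalues, with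
  multiplicity, on the diagonal, where the traces of powers and the determinant are read off. The
  monic integral characteristic polynomial makes them algebraic integers.\<close>

lemma int_mat_eigenvalues:
  fixes M :: "int mat"
  assumes M: "M \<in> carrier_mat n n"
  shows "\<exists>L :: complex list. length L = n \<and> (\<forall>k. of_int (mat_trace (M ^\<^sub>m k)) = (\<Sum>ev\<leftarrow>L. ev ^ k)) \<and>
    of_int (det M) = prod_list L \<and> (\<forall>ev\<in>set L. algebraic_int ev)"
proof -
  let ?A = "map_mat of_int M :: complex mat"
  have A: "?A \<in> carrier_mat n n" using M by simp
  obtain L where L: "char_poly ?A = (\<Prod>a\<leftarrow>L. [:- a, 1:])" "length L = n"
    using char_poly_factorized[OF A] by blast
  obtain B P Q where BPQ: "schur_decomposition ?A L = (B, P, Q)" by (metis prod_cases3)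
  from schur_decomposition[OF A L(1) BPQ]
  have sim: "similar_mat_wit ?A B P Q" and ut: "upper_triangular B" and diag: "diag_mat B = L" by auto
  have c: "B \<in> carrier_mat n n" "P \<in> carrier_mat n n" "Q \<in> carrier_mat n n" "Q * P = 1\<^sub>m n"
    using similar_mat_witD2[OF A sim] by auto
  have Li: "L ! i = B $$ (i, i)" if "i < n" for i using diag c that by (auto simp: diag_mat_def)
  have "of_int (mat_trace (M ^\<^sub>m k)) = (\<Sum>ev\<leftarrow>L. ev ^ k)" for k
  proof -
    have "complex_of_int (mat_trace (M ^\<^sub>m k)) = mat_trace (map_mat of_int (M ^\<^sub>m k))"
      using M by (simp add: mat_trace_def)
    also have "\<dots> = mat_trace (?A ^\<^sub>m k)" by (simp only: of_int_hom.mat_hom_pow[OF M])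
    also have "\<dots> = mat_trace (P * (B ^\<^sub>m k * Q))"
      using similar_mat_wit_pow_id[OF sim, of k] c by (simp add: assoc_mult_mat[of _ n n _ n _ n])
    also have "\<dots> = mat_trace (B ^\<^sub>m k * Q * P)" using c by (intro mat_trace_comm) auto
    also have "\<dots> = mat_trace (B ^\<^sub>m k)" using c by (simp add: assoc_mult_mat[of _ n n _ n _ n])
    also have "\<dots> = (\<Sum>i<n. (L ! i) ^ k)"
      using upper_triangular_pow[OF c(1) ut, of k] c Li by (simp add: mat_trace_def)
    also have "\<dots> = (\<Sum>ev\<leftarrow>L. ev ^ k)"
      using L(2) by (simp add: sum_list_sum_nth atLeast0LessThan)
    finally show ?thesis .
  qed
  moreover have "of_int (det M) = prod_list L"
  proof -
    have "of_int (det M) = det ?A" by simp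
    also have "\<dots> = det B" using sim det_similar[of ?A B] by (auto simp: similar_mat_def)
    also have "\<dots> = prod_list L" using det_upper_triangular[OF ut c(1)] diag by simp
    finally show ?thesis .
  qed
  moreover have "algebraic_int ev" if "ev \<in> set L" for ev
  proof -
    have "poly (char_poly ?A) ev = 0"
      unfolding L(1) using that by (induction L) auto
    then have "poly (map_poly of_int (char_poly M)) ev = 0"
      using of_int_hom.char_poly_hom[OF M, where ?'a = complex] by simp
    moreover have "lead_coeff (char_poly M) = 1" using degree_monic_char_poly[OF M] by simp
    ultimately show ?thesis unfolding algebraic_int_altdef_ipoly by blast
  qed
  ultimately show ?thesis using L(2) by blast
qed

definition rational_power_sum :: "(nat \<Rightarrow> complex) \<Rightarrow> bool" where
  "rational_power_sum a \<longleftrightarrow> (\<exists>S c. finite S \<and> 0 \<notin> S \<and> (\<forall>s\<in>S. c s \<in> \<rat>) \<and>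
     (\<forall>k\<ge>1. a k = (\<Sum>s\<in>S. c s * s ^ k)))"

text \<open>By linearity the sum of \<open>c r * r * p(r)\<close> over \<open>S\<close> vanishes for
  every polynomial \<open>p\<close>, and a \<open>p\<close> vanishing on all of \<open>S\<close>
  except \<open>s\<close> isolates one term. This is the linear independence of geometric
  sequences.\<close>

lemma power_sum_zero:
  fixes c :: "'a::field \<Rightarrow> 'a"
  assumes S: "finite S" "0 \<notin> S" and zero: "\<And>k. k \<ge> 1 \<Longrightarrow> (\<Sum>s\<in>S. c s * s ^ k) = 0" and s: "s \<in> S"
  shows "c s = 0"
proof -
  have poly0: "(\<Sum>r\<in>S. c r * r * poly p r) = 0" for p
  proof -
    have "(\<Sum>r\<in>S. c r * r * poly p r) = (\<Sum>r\<in>S. \<Sum>i\<le>degree p. coeff p i * (c r * r ^ Suc i))"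
      by (intro sum.cong HOL.refl) (simp add: poly_altdef sum_distrib_left mult_ac)
    also have "\<dots> = (\<Sum>i\<le>degree p. coeff p i * (\<Sum>r\<in>S. c r * r ^ Suc i))"
      by (subst sum.swap) (simp only: sum_distrib_left)
    also have "\<dots> = (\<Sum>i\<le>degree p. coeff p i * 0)"
      by (intro sum.cong HOL.refl arg_cong2[of _ _ _ _ "(*)"] zero) simp
    also have "\<dots> = 0" by simp
    finally show ?thesis .
  qed
  let ?p = "\<Prod>r\<in>S - {s}. [:- r, 1:]"
  have p: "poly ?p r = 0" if "r \<in> S" "r \<noteq> s" for r
    using that S by (auto simp: poly_prod prod_zero_iff)
  have "(\<Sum>r\<in>S. c r * r * poly ?p r) = c s * s * poly ?p s + (\<Sum>r\<in>S - {s}. c r * r * poly ?p r)"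
    using S s by (intro sum.remove) auto
  also have "(\<Sum>r\<in>S - {s}. c r * r * poly ?p r) = 0" by (intro sum.neutral) (auto simp: p)
  finally have "c s * s * poly ?p s = 0" using poly0 by simp
  moreover have "poly ?p s \<noteq> 0" using S by (auto simp: poly_prod prod_zero_iff)
  ultimately show ?thesis using S s by auto
qed

lemma rational_power_sum_add:
  assumes "rational_power_sum a" "rational_power_sum b"
  shows "rational_power_sum (\<lambda>k. a k + b k)"
proof -
  obtain S c where S: "finite S" "0 \<notin> S" "\<forall>s\<in>S. c s \<in> \<rat>" "\<forall>k\<ge>1. a k = (\<Sum>s\<in>S. c s * s ^ k)"
    using assms(1) unfolding rational_power_sum_def by blast
  obtain T e where T: "finite T" "0 \<notin> T" "\<forall>s\<in>T. e s \<in> \<rat>" "\<forall>k\<ge>1. b k = (\<Sum>s\<in>T. e s * s ^ k)"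
    using assms(2) unfolding rational_power_sum_def by blast
  let ?f = "\<lambda>s. (if s \<in> S then c s else 0) + (if s \<in> T then e s else 0)"
  have "a k + b k = (\<Sum>s\<in>S \<union> T. ?f s * s ^ k)" if "k \<ge> 1" for k
  proof -
    have "(\<Sum>s\<in>S. c s * s ^ k) = (\<Sum>s\<in>S \<union> T. (if s \<in> S then c s else 0) * s ^ k)"
      using S T by (intro sum.mono_neutral_cong_left) auto
    moreover have "(\<Sum>s\<in>T. e s * s ^ k) = (\<Sum>s\<in>S \<union> T. (if s \<in> T then e s else 0) * s ^ k)"
      using S T by (intro sum.mono_neutral_cong_left) auto
    ultimately show ?thesis using S T that by (simp add: distrib_right sum.distrib)
  qed
  moreover have "\<forall>s\<in>S \<union> T. ?f s \<in> \<rat>" using S T by auto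
  ultimately show ?thesis unfolding rational_power_sum_def using S T
    by (intro exI[of _ "S \<union> T"] exI[of _ ?f]) auto
qed

lemma rational_power_sum_scale:
  assumes "rational_power_sum a" "q \<in> \<rat>"
  shows "rational_power_sum (\<lambda>k. q * a k)"
proof -
  obtain S c where S: "finite S" "0 \<notin> S" "\<forall>s\<in>S. c s \<in> \<rat>" "\<forall>k\<ge>1. a k = (\<Sum>s\<in>S. c s * s ^ k)"
    using assms unfolding rational_power_sum_def by metis
  then show ?thesis unfolding rational_power_sum_def using assms
    by (intro exI[of _ S] exI[of _ "\<lambda>s. q * c s"]) (auto simp: sum_distrib_left mult_ac)
qed

lemma rational_power_sum_zero: "rational_power_sum (\<lambda>k. 0)"
  unfolding rational_power_sum_def by (intro exI[of _ "{}"]) auto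

lemma rational_power_sum_sum:
  "finite I \<Longrightarrow> (\<And>i. i \<in> I \<Longrightarrow> rational_power_sum (a i)) \<Longrightarrow> rational_power_sum (\<lambda>k. \<Sum>i\<in>I. a i k)"
  by (induction I rule: finite_induct) (auto intro: rational_power_sum_zero rational_power_sum_add)

lemma rational_power_sum_geometric: "rational_power_sum (\<lambda>k. ev ^ k)"
proof (cases "ev = 0")
  case True
  then show ?thesis unfolding rational_power_sum_def by (intro exI[of _ "{}"]) auto
next
  case False
  then show ?thesis unfolding rational_power_sum_def
    by (intro exI[of _ "{ev}"] exI[of _ "\<lambda>_. 1"]) auto
qed

lemma rational_power_sum_list: "rational_power_sum (\<lambda>k. \<Sum>ev\<leftarrow>L. (f ev) ^ k)"
  by (induction L) (auto intro: rational_power_sum_zero rational_power_sum_add rational_power_sum_geometric)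

lemma rational_power_sum_cong:
  "(\<And>k. k \<ge> 1 \<Longrightarrow> a k = b k) \<Longrightarrow> rational_power_sum a \<Longrightarrow> rational_power_sum b"
  unfolding rational_power_sum_def by metis

lemma sum_list_eq_sum_count:
  fixes f :: "'a \<Rightarrow> 'b::semiring_1"
  assumes "finite S" "set L \<subseteq> S"
  shows "(\<Sum>x\<leftarrow>L. f x) = (\<Sum>x\<in>S. of_nat (count_list L x) * f x)"
  using assms(2)
proof (induction L)
  case (Cons a L)
  have "(\<Sum>x\<in>S. of_nat (count_list (a # L) x) * f x)
      = (\<Sum>x\<in>S. (if x = a then f a else 0) + of_nat (count_list L x) * f x)"
    by (intro sum.cong HOL.refl) (auto simp: distrib_right)
  also have "\<dots> = f a + (\<Sum>x\<in>S. of_nat (count_list L x) * f x)"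
    using Cons.prems assms(1) by (simp add: sum.distrib sum.delta)
  finally show ?case using Cons by simp
qed simp

lemma sum_list_count_nonzero:
  assumes "k \<ge> 1"
  shows "(\<Sum>ev\<leftarrow>L. (ev::complex) ^ k) = (\<Sum>ev\<in>set L - {0}. of_nat (count_list L ev) * ev ^ k)"
proof -
  have "(\<Sum>ev\<leftarrow>L. ev ^ k) = (\<Sum>ev\<in>set L. of_nat (count_list L ev) * ev ^ k)"
    by (rule sum_list_eq_sum_count) auto
  also have "\<dots> = (\<Sum>ev\<in>set L - {0}. of_nat (count_list L ev) * ev ^ k)"
    using assms by (intro sum.mono_neutral_right) auto
  finally show ?thesis .
qed

text \<open>Comparing the coefficients of \<open>\<mu>^k\<close> identifies multiplicity times
  \<open>\<mu>\<close> with a rational number. The exponent \<open>Suc k\<close> on the left is the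
  source of the factor \<open>\<mu>\<close>.\<close>

lemma eigenvalue_rational:
  assumes r: "rational_power_sum (\<lambda>k. \<Sum>ev\<leftarrow>L. ev ^ Suc k)" and m: "\<mu> \<in> set L" "\<mu> \<noteq> 0"
  shows "\<mu> \<in> \<rat>"
proof -
  obtain S c where S: "finite S" "0 \<notin> S" "\<forall>s\<in>S. c s \<in> \<rat>"
    "\<forall>k\<ge>1. (\<Sum>ev\<leftarrow>L. ev ^ Suc k) = (\<Sum>s\<in>S. c s * s ^ k)"
    using r unfolding rational_power_sum_def by metis
  let ?T = "set L - {0}"
  let ?f = "\<lambda>s. (if s \<in> ?T then of_nat (count_list L s) * s else 0) - (if s \<in> S then c s else 0)"
  have "(\<Sum>s\<in>?T \<union> S. ?f s * s ^ k) = 0" if k: "k \<ge> 1" for k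
  proof -
    have "(\<Sum>ev\<leftarrow>L. ev ^ Suc k) = (\<Sum>s\<in>?T. of_nat (count_list L s) * s ^ Suc k)"
      by (rule sum_list_count_nonzero) simp
    also have "\<dots> = (\<Sum>s\<in>?T \<union> S. (if s \<in> ?T then of_nat (count_list L s) * s else 0) * s ^ k)"
      using S by (intro sum.mono_neutral_cong_left) auto
    finally have 1: "(\<Sum>s\<in>S. c s * s ^ k) = \<dots>" using S(4) k by simp
    have "(\<Sum>s\<in>S. c s * s ^ k) = (\<Sum>s\<in>?T \<union> S. (if s \<in> S then c s else 0) * s ^ k)"
      using S by (intro sum.mono_neutral_cong_left) auto
    then show ?thesis using 1 by (simp add: left_diff_distrib sum_subtractf)
  qed
  then have "?f \<mu> = 0"
    using S m by (intro power_sum_zero[of "?T \<union> S" ?f]) auto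
  then have "of_nat (count_list L \<mu>) * \<mu> \<in> \<rat>"
    using S m by (auto split: if_splits)
  moreover have "count_list L \<mu> \<noteq> 0" using m by (simp add: count_list_0_iff)
  ultimately have "(of_nat (count_list L \<mu>) * \<mu>) / of_nat (count_list L \<mu>) \<in> \<rat>"
    by (intro Rats_divide) auto
  then show ?thesis using \<open>count_list L \<mu> \<noteq> 0\<close> by simp
qed

lemma int_prod_list_unit:
  fixes L :: "complex list"
  assumes "\<forall>ev\<in>set L. ev \<in> \<int>" "prod_list L \<in> {1, -1}" "ev \<in> set L"
  shows "ev\<^sup>2 = 1"
proof -
  obtain K where K: "L = map of_int K"
    using assms(1) by (metis Ints_cases ex_map_conv)
  have "complex_of_int (prod_list K) = prod_list L" unfolding K by (induction K) auto
  then have "complex_of_int (prod_list K) = of_int 1 \<or> complex_of_int (prod_list K) = of_int (-1)"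
    using assms(2) by auto
  then have u: "prod_list K dvd 1" unfolding of_int_eq_iff by auto
  obtain i where i: "i \<in> set K" "ev = of_int i" using assms(3) K by auto
  have "i dvd prod_list K" using i(1) by (induction K) (auto intro: dvd_mult)
  then have "i dvd 1" using u dvd_trans by blast
  then have "i\<^sup>2 = 1" by (auto simp: power2_eq_1_iff)
  then have "complex_of_int (i\<^sup>2) = 1" by simp
  then show ?thesis using i(2) by simp
qed

text \<open>An integral inverse makes the determinant a unit, so zero is not an eigenvalue and
  \<open>eigenvalue_rational\<close> covers the whole list; rational algebraic integers are
  integers, and each of them divides the determinant.\<close>

lemma unit_mat_rational_trace_square:
  fixes M M' :: "int mat"
  assumes M: "M \<in> carrier_mat n n" "M' \<in> carrier_mat n n" "M * M' = 1\<^sub>m n"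
    and r: "rational_power_sum (\<lambda>k. of_int (mat_trace (M ^\<^sub>m Suc k)))"
  shows "mat_trace (M ^\<^sub>m 2) = int n"
proof -
  obtain L :: "complex list" where L: "length L = n" "\<And>k. of_int (mat_trace (M ^\<^sub>m k)) = (\<Sum>ev\<leftarrow>L. ev ^ k)"
    "of_int (det M) = prod_list L" "\<forall>ev\<in>set L. algebraic_int ev"
    using int_mat_eigenvalues[OF M(1)] by blast
  have "det M * det M' = 1" using det_mult[OF M(1,2)] M(3) by simp
  then have "det M dvd 1" by (metis dvd_triv_left)
  then have "det M \<in> {1, -1}" by auto
  then have pl: "prod_list L \<in> {1, -1}" using L(3) by (auto simp flip: L(3))
  have nz: "0 \<notin> set L"
  proof
    assume "0 \<in> set L"
    then have "prod_list L = 0" using prod_list_zero_iff[of L] by blast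
    then show False using pl by (metis insertE singletonD one_neq_zero neg_equal_0_iff_equal)
  qed
  have "rational_power_sum (\<lambda>k. \<Sum>ev\<leftarrow>L. ev ^ Suc k)" using r unfolding L(2) .
  then have "\<forall>ev\<in>set L. ev \<in> \<int>"
    using eigenvalue_rational nz L(4) rational_algebraic_int_is_int by metis
  then have sq: "ev\<^sup>2 = 1" if "ev \<in> set L" for ev using int_prod_list_unit[OF _ pl that] by blast
  have "complex_of_int (mat_trace (M ^\<^sub>m 2)) = (\<Sum>ev\<leftarrow>L. 1)"
    unfolding L(2) using sq by (intro arg_cong[of _ _ sum_list] map_cong) auto
  also have "\<dots> = of_int (int n)" using L(1) by (simp add: sum_list_triv)
  finally show ?thesis by (simp only: of_int_eq_iff)
qed

section \<open>The RS-criterion\<close>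

context group begin

text \<open>The matrix of left multiplication by \<open>f\<close> in the basis \<open>ts\<close> of
  the group ring of a finite group: entry \<open>(i, j)\<close> is the coefficient of
  \<open>t_i\<close> in \<open>f t_j\<close>.\<close>

definition gr_mat :: "'a list \<Rightarrow> ('a \<Rightarrow> int) \<Rightarrow> int mat" where
  "gr_mat ts f = mat (length ts) (length ts) (\<lambda>(i, j). f (ts ! i \<otimes> inv (ts ! j)))"

lemma gr_mat_carrier: "gr_mat ts f \<in> carrier_mat (length ts) (length ts)"
  by (simp add: gr_mat_def)

lemma gr_mat_one:
  assumes ts: "set ts \<subseteq> carrier G" "distinct ts"
  shows "gr_mat ts \<one>\<^bsub>ZG\<^esub> = 1\<^sub>m (length ts)"
proof (rule eq_matI)
  fix i j assume "i < dim_row (1\<^sub>m (length ts) :: int mat)" "j < dim_col (1\<^sub>m (length ts) :: int mat)"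
  then have ij: "i < length ts" "j < length ts" by auto
  then have c: "ts ! i \<in> carrier G" "ts ! j \<in> carrier G" using ts by auto
  have "ts ! i \<otimes> inv (ts ! j) = \<one> \<longleftrightarrow> ts ! i = ts ! j"
    using c inv_solve_right[of \<one> "ts ! i" "ts ! j"] by auto
  also have "\<dots> \<longleftrightarrow> i = j" using ts(2) ij by (simp add: nth_eq_iff_index_eq)
  finally show "gr_mat ts \<one>\<^bsub>ZG\<^esub> $$ (i, j) = 1\<^sub>m (length ts) $$ (i, j)"
    using ij by (simp add: gr_mat_def group_ring_one)
qed (simp_all add: gr_mat_def)

text \<open>The support of the right factor confines the convolution sum to \<open>T\<close>, and
  the substitution \<open>z = t t_j^-1\<close> turns it into the sum of a matrix product.\<close>

lemma gr_mat_mult: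
  assumes T: "subgroup T G" "set ts = T" "distinct ts"
    and f: "f \<in> carrier ZG" and g: "g \<in> carrier ZG" "{x. g x \<noteq> 0} \<subseteq> T"
  shows "gr_mat ts (f \<otimes>\<^bsub>ZG\<^esub> g) = gr_mat ts f * gr_mat ts g"
proof (rule eq_matI)
  let ?n = "length ts"
  have Tc: "T \<subseteq> carrier G" using T(1) by (rule subgroup.subset)
  have finT: "finite T" using T(2) by auto
  fix i j assume "i < dim_row (gr_mat ts f * gr_mat ts g)" "j < dim_col (gr_mat ts f * gr_mat ts g)"
  then have ij: "i < ?n" "j < ?n" by (auto simp: gr_mat_def)
  then have tT: "ts ! i \<in> T" "ts ! j \<in> T" using T(2) by auto
  then have c: "ts ! i \<in> carrier G" "ts ! j \<in> carrier G" using Tc by auto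
  have bij: "bij_betw (\<lambda>t. t \<otimes> inv (ts ! j)) T T"
  proof (rule bij_betwI[of _ _ _ "\<lambda>t. t \<otimes> ts ! j"])
    show "(\<lambda>t. t \<otimes> inv (ts ! j)) \<in> T \<rightarrow> T" "(\<lambda>t. t \<otimes> ts ! j) \<in> T \<rightarrow> T"
      using tT subgroup.m_closed[OF T(1)] subgroup.m_inv_closed[OF T(1)] by auto
    show "t \<otimes> inv (ts ! j) \<otimes> ts ! j = t" "t \<otimes> ts ! j \<otimes> inv (ts ! j) = t" if "t \<in> T" for t
      using that Tc c by auto
  qed
  have "(f \<otimes>\<^bsub>ZG\<^esub> g) (ts ! i \<otimes> inv (ts ! j)) = (\<Sum>z\<in>T. f (ts ! i \<otimes> inv (ts ! j) \<otimes> inv z) * g z)"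
    using f g finT Tc c by (intro gr_mult_right) auto
  also have "\<dots> = (\<Sum>t\<in>T. f (ts ! i \<otimes> inv (ts ! j) \<otimes> inv (t \<otimes> inv (ts ! j))) * g (t \<otimes> inv (ts ! j)))"
    using sum.reindex_bij_betw[OF bij, of "\<lambda>z. f (ts ! i \<otimes> inv (ts ! j) \<otimes> inv z) * g z"] by simp
  also have "\<dots> = (\<Sum>t\<in>T. f (ts ! i \<otimes> inv t) * g (t \<otimes> inv (ts ! j)))"
  proof (rule sum.cong[OF HOL.refl])
    fix t assume "t \<in> T"
    then have "t \<in> carrier G" using Tc by auto
    then have "ts ! i \<otimes> inv (ts ! j) \<otimes> inv (t \<otimes> inv (ts ! j)) = ts ! i \<otimes> inv t"
      using c by (simp add: inv_mult_group m_assoc)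
    then show "f (ts ! i \<otimes> inv (ts ! j) \<otimes> inv (t \<otimes> inv (ts ! j))) * g (t \<otimes> inv (ts ! j)) =
      f (ts ! i \<otimes> inv t) * g (t \<otimes> inv (ts ! j))" by simp
  qed
  also have "\<dots> = (\<Sum>l<?n. f (ts ! i \<otimes> inv (ts ! l)) * g (ts ! l \<otimes> inv (ts ! j)))"
    using sum.reindex_bij_betw[OF bij_betw_nth[OF T(3), of "{..<?n}" T],
        of "\<lambda>t. f (ts ! i \<otimes> inv t) * g (t \<otimes> inv (ts ! j))"] T(2) by simp
  finally show "gr_mat ts (f \<otimes>\<^bsub>ZG\<^esub> g) $$ (i, j) = (gr_mat ts f * gr_mat ts g) $$ (i, j)"
    using ij by (simp add: gr_mat_def scalar_prod_def atLeast0LessThan)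
qed (simp_all add: gr_mat_def)

lemma gr_mat_trace:
  assumes "set ts \<subseteq> carrier G"
  shows "mat_trace (gr_mat ts f) = int (length ts) * f \<one>"
proof -
  have "ts ! i \<otimes> inv (ts ! i) = \<one>" if "i < length ts" for i
    using that assms by (meson nth_mem r_inv subsetD)
  then show ?thesis by (simp add: mat_trace_def gr_mat_def)
qed

lemma gr_pow_closed: "f \<in> carrier ZG \<Longrightarrow> f [^]\<^bsub>ZG\<^esub> (k::nat) \<in> carrier ZG"
  by (rule monoid.nat_pow_closed[OF monoid_group_ring])

lemma gr_mat_pow:
  assumes T: "subgroup T G" "set ts = T" "distinct ts"
    and f: "f \<in> carrier ZG" "{x. f x \<noteq> 0} \<subseteq> T"
  shows "gr_mat ts (f [^]\<^bsub>ZG\<^esub> (k::nat)) = gr_mat ts f ^\<^sub>m k"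
proof (induction k)
  case 0
  have "set ts \<subseteq> carrier G" using T subgroup.subset by blast
  then show ?case using gr_mat_one[OF _ T(3)] by (simp add: gr_mat_def)
next
  case (Suc k)
  have "gr_mat ts (f [^]\<^bsub>ZG\<^esub> k \<otimes>\<^bsub>ZG\<^esub> f) = gr_mat ts (f [^]\<^bsub>ZG\<^esub> k) * gr_mat ts f"
    by (rule gr_mat_mult[OF T gr_pow_closed[OF f(1)] f])
  then show ?case using Suc by simp
qed

text \<open>The trace of left multiplication by \<open>f\<^sup>k\<close> on the group ring of \<open>T\<close>.\<close>

lemma gr_pow_at_one_eigenvalues:
  assumes T: "subgroup T G" "finite T" and f: "f \<in> carrier ZG" "{x. f x \<noteq> 0} \<subseteq> T"
  shows "\<exists>L :: complex list. \<forall>k. of_int (int (card T) * (f [^]\<^bsub>ZG\<^esub> (k::nat)) \<one>) = (\<Sum>ev\<leftarrow>L. ev ^ k)"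
proof -
  obtain ts where ts: "set ts = T" "distinct ts" using finite_distinct_list[OF T(2)] by blast
  have c: "set ts \<subseteq> carrier G" using ts T subgroup.subset by blast
  have len: "length ts = card T" using ts distinct_card by metis
  obtain L :: "complex list" where
    L: "\<And>k. of_int (mat_trace (gr_mat ts f ^\<^sub>m k)) = (\<Sum>ev\<leftarrow>L. ev ^ k)"
    using int_mat_eigenvalues[OF gr_mat_carrier] by blast
  then show ?thesis
    using gr_mat_pow[OF T(1) ts f] gr_mat_trace[OF c] len by (intro exI[of _ L] allI) metis
qed

definition ind :: "'a set \<Rightarrow> 'a \<Rightarrow> int" where "ind S = (\<lambda>x. if x \<in> S then 1 else 0)"

lemma ind_closed: "finite S \<Longrightarrow> S \<subseteq> carrier G \<Longrightarrow> ind S \<in> carrier ZG"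
  by (auto simp: ind_def group_ring_carrier)

text \<open>Left translation by an element of \<open>C\<close> maps \<open>C\<close> onto itself, so
  all terms of the convolution are equal. Divided by the order of \<open>C\<close>,
  \<open>ind C\<close> becomes idempotent over the rationals.\<close>

lemma ind_subgroup_square:
  assumes C: "subgroup C G" "finite C"
  shows "ind C \<otimes>\<^bsub>ZG\<^esub> ind C = (\<lambda>x. int (card C) * ind C x)"
proof (rule gr_eqI)
  have Cc: "C \<subseteq> carrier G" using C(1) by (rule subgroup.subset)
  show "ind C \<otimes>\<^bsub>ZG\<^esub> ind C \<in> carrier ZG" using ind_closed[OF C(2) Cc] by (intro gr_mult_closed)
  show "(\<lambda>x. int (card C) * ind C x) \<in> carrier ZG"
    using C Cc by (auto simp: group_ring_carrier ind_def)
  fix x assume x: "x \<in> carrier G"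
  have "(ind C \<otimes>\<^bsub>ZG\<^esub> ind C) x = (\<Sum>y\<in>C. ind C y * ind C (inv y \<otimes> x))"
    using C Cc x ind_closed[OF C(2) Cc] by (intro gr_mult_left) (auto simp: ind_def)
  also have "\<dots> = (\<Sum>y\<in>C. ind C x)"
  proof (rule sum.cong[OF HOL.refl])
    fix y assume y: "y \<in> C"
    have "inv y \<otimes> x \<in> C \<longleftrightarrow> x \<in> C"
    proof
      assume "inv y \<otimes> x \<in> C"
      then have "y \<otimes> (inv y \<otimes> x) \<in> C" using y subgroup.m_closed[OF C(1)] by blast
      then show "x \<in> C" using x y Cc by auto
    next
      assume "x \<in> C"
      then show "inv y \<otimes> x \<in> C"
        using y subgroup.m_closed[OF C(1)] subgroup.m_inv_closed[OF C(1)] by blast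
    qed
    then show "ind C y * ind C (inv y \<otimes> x) = ind C x" using y by (simp add: ind_def)
  qed
  finally show "(ind C \<otimes>\<^bsub>ZG\<^esub> ind C) x = int (card C) * ind C x" by simp
qed

lemma gr_mult_scale_right:
  assumes "f \<in> carrier ZG" "g \<in> carrier ZG"
  shows "f \<otimes>\<^bsub>ZG\<^esub> (\<lambda>x. c * g x) = (\<lambda>x. c * (f \<otimes>\<^bsub>ZG\<^esub> g) x)"
proof (rule gr_eqI)
  have cg: "(\<lambda>x. c * g x) \<in> carrier ZG"
    using assms(2) by (auto simp: group_ring_carrier intro: finite_subset)
  have fg: "f \<otimes>\<^bsub>ZG\<^esub> g \<in> carrier ZG" using assms by (rule gr_mult_closed)
  show "f \<otimes>\<^bsub>ZG\<^esub> (\<lambda>x. c * g x) \<in> carrier ZG" using assms(1) cg by (rule gr_mult_closed)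
  show "(\<lambda>x. c * (f \<otimes>\<^bsub>ZG\<^esub> g) x) \<in> carrier ZG"
    using fg by (auto simp: group_ring_carrier intro: finite_subset)
  fix x assume x: "x \<in> carrier G"
  have S: "finite {y. f y \<noteq> 0}" "{y. f y \<noteq> 0} \<subseteq> carrier G" using assms(1) by (auto simp: group_ring_carrier)
  show "(f \<otimes>\<^bsub>ZG\<^esub> (\<lambda>x. c * g x)) x = c * (f \<otimes>\<^bsub>ZG\<^esub> g) x"
    using gr_mult_left[OF cg S(1) order_refl S(2) x] gr_mult_left[OF assms(2) S(1) order_refl S(2) x]
    by (simp add: sum_distrib_left mult_ac)
qed

text \<open>Invariance under \<open>C\<close> makes \<open>v\<close> commute with
  \<open>ind C\<close>, so the powers of \<open>ind C\<close> can be collected, and each further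
  factor contributes only the scalar \<open>card C\<close>.\<close>

lemma gr_pow_mult_ind:
  assumes v: "v \<in> carrier ZG" "class_fun G C v" and C: "subgroup C G" "finite C"
  shows "(v \<otimes>\<^bsub>ZG\<^esub> ind C) [^]\<^bsub>ZG\<^esub> Suc k = (\<lambda>x. int (card C) ^ k * (v [^]\<^bsub>ZG\<^esub> Suc k \<otimes>\<^bsub>ZG\<^esub> ind C) x)"
proof (induction k)
  interpret ZG: monoid ZG by (rule monoid_group_ring)
  case 0
  have "ind C \<in> carrier ZG" using C subgroup.subset ind_closed by blast
  then show ?case using v by simp
next
  interpret ZG: monoid ZG by (rule monoid_group_ring)
  case (Suc k)
  let ?E = "ind C" and ?p = "v [^]\<^bsub>ZG\<^esub> Suc k"
  have E: "?E \<in> carrier ZG" using C subgroup.subset ind_closed by blast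
  have p: "?p \<in> carrier ZG" using v by (intro gr_pow_closed)
  have comm: "v \<otimes>\<^bsub>ZG\<^esub> ?E = ?E \<otimes>\<^bsub>ZG\<^esub> v"
    using v E by (intro class_fun_comm) (auto simp: ind_def)
  have vE: "v \<otimes>\<^bsub>ZG\<^esub> ?E \<in> carrier ZG" using v E by simp
  have pE: "?p \<otimes>\<^bsub>ZG\<^esub> ?E \<in> carrier ZG" using p E by simp
  have "(v \<otimes>\<^bsub>ZG\<^esub> ?E) [^]\<^bsub>ZG\<^esub> Suc (Suc k) = (v \<otimes>\<^bsub>ZG\<^esub> ?E) \<otimes>\<^bsub>ZG\<^esub> (v \<otimes>\<^bsub>ZG\<^esub> ?E) [^]\<^bsub>ZG\<^esub> Suc k"
    using ZG.nat_pow_Suc2[OF vE, of "Suc k"] .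
  also have "\<dots> = (\<lambda>x. int (card C) ^ k * ((v \<otimes>\<^bsub>ZG\<^esub> ?E) \<otimes>\<^bsub>ZG\<^esub> (?p \<otimes>\<^bsub>ZG\<^esub> ?E)) x)"
    unfolding Suc by (rule gr_mult_scale_right[OF vE pE])
  also have "(v \<otimes>\<^bsub>ZG\<^esub> ?E) \<otimes>\<^bsub>ZG\<^esub> (?p \<otimes>\<^bsub>ZG\<^esub> ?E) = (v \<otimes>\<^bsub>ZG\<^esub> ?p) \<otimes>\<^bsub>ZG\<^esub> (?E \<otimes>\<^bsub>ZG\<^esub> ?E)"
  proof -
    have pw: "v [^]\<^bsub>ZG\<^esub> m \<otimes>\<^bsub>ZG\<^esub> ?E = ?E \<otimes>\<^bsub>ZG\<^esub> v [^]\<^bsub>ZG\<^esub> m" for m :: nat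
    proof (induction m)
      case (Suc m)
      have vm: "v [^]\<^bsub>ZG\<^esub> m \<in> carrier ZG" using v by (intro gr_pow_closed)
      have "v [^]\<^bsub>ZG\<^esub> m \<otimes>\<^bsub>ZG\<^esub> v \<otimes>\<^bsub>ZG\<^esub> ?E = v [^]\<^bsub>ZG\<^esub> m \<otimes>\<^bsub>ZG\<^esub> (?E \<otimes>\<^bsub>ZG\<^esub> v)"
        using vm v E by (simp add: ZG.m_assoc comm)
      also have "\<dots> = (v [^]\<^bsub>ZG\<^esub> m \<otimes>\<^bsub>ZG\<^esub> ?E) \<otimes>\<^bsub>ZG\<^esub> v" using vm v E by (simp only: ZG.m_assoc)
      also have "\<dots> = ?E \<otimes>\<^bsub>ZG\<^esub> (v [^]\<^bsub>ZG\<^esub> m \<otimes>\<^bsub>ZG\<^esub> v)" unfolding Suc using vm v E by (simp only: ZG.m_assoc)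
      finally show ?case by simp
    qed (use E in simp)
    have "(v \<otimes>\<^bsub>ZG\<^esub> ?E) \<otimes>\<^bsub>ZG\<^esub> (?p \<otimes>\<^bsub>ZG\<^esub> ?E) = v \<otimes>\<^bsub>ZG\<^esub> ((?E \<otimes>\<^bsub>ZG\<^esub> ?p) \<otimes>\<^bsub>ZG\<^esub> ?E)"
      using v E p by (simp only: ZG.m_assoc ZG.m_closed)
    also have "\<dots> = v \<otimes>\<^bsub>ZG\<^esub> ((?p \<otimes>\<^bsub>ZG\<^esub> ?E) \<otimes>\<^bsub>ZG\<^esub> ?E)" using pw[of "Suc k"] by simp
    also have "\<dots> = (v \<otimes>\<^bsub>ZG\<^esub> ?p) \<otimes>\<^bsub>ZG\<^esub> (?E \<otimes>\<^bsub>ZG\<^esub> ?E)" using v E p by (simp only: ZG.m_assoc ZG.m_closed)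
    finally show ?thesis .
  qed
  also have "v \<otimes>\<^bsub>ZG\<^esub> ?p = v [^]\<^bsub>ZG\<^esub> Suc (Suc k)" using ZG.nat_pow_Suc2[OF v(1), of "Suc k"] by simp
  also have "v [^]\<^bsub>ZG\<^esub> Suc (Suc k) \<otimes>\<^bsub>ZG\<^esub> (?E \<otimes>\<^bsub>ZG\<^esub> ?E)
      = (\<lambda>x. int (card C) * (v [^]\<^bsub>ZG\<^esub> Suc (Suc k) \<otimes>\<^bsub>ZG\<^esub> ?E) x)"
    unfolding ind_subgroup_square[OF C] using v E by (intro gr_mult_scale_right gr_pow_closed)
  finally show ?case by (simp add: mult_ac)
qed

end

context group begin

lemma gr_mult_ind_at_one:
  assumes "f \<in> carrier ZG" "finite S" "S \<subseteq> carrier G"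
  shows "(f \<otimes>\<^bsub>ZG\<^esub> ind S) \<one> = (\<Sum>z\<in>S. f (inv z))"
proof -
  have "(f \<otimes>\<^bsub>ZG\<^esub> ind S) \<one> = (\<Sum>z\<in>S. f (\<one> \<otimes> inv z) * ind S z)"
    using assms by (intro gr_mult_right ind_closed) (auto simp: ind_def)
  also have "\<dots> = (\<Sum>z\<in>S. f (inv z))"
    using assms(3) by (intro sum.cong) (auto simp: ind_def)
  finally show ?thesis .
qed

text \<open>The sum is the coefficient at \<open>1\<close> of \<open>v^k E\<close> with
  \<open>E = ind C\<close>. Up to the scalar from \<open>gr_pow_mult_ind\<close> this is the
  coefficient of \<open>(v E)^k\<close>, hence a trace. Collecting the scalars leaves the constant
  \<open>card C / card T\<close> and the bases \<open>ev / card C\<close>, where \<open>ev\<close>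
  runs over the eigenvalues of \<open>v E\<close>.\<close>

lemma rational_power_sum_subgroup:
  assumes T: "subgroup T G" "finite T" and C: "subgroup C G" "C \<subseteq> T"
    and v: "v \<in> carrier ZG" "class_fun G C v" "{x. v x \<noteq> 0} \<subseteq> T"
  shows "rational_power_sum (\<lambda>k. \<Sum>z\<in>C. of_int ((v [^]\<^bsub>ZG\<^esub> (k::nat)) (inv z)))"
proof -
  have Cc: "C \<subseteq> carrier G" and finC: "finite C"
    using C T finite_subset subgroup.subset by blast+
  let ?E = "ind C" and ?m = "complex_of_nat (card C)" and ?n = "complex_of_nat (card T)"
  have E: "?E \<in> carrier ZG" by (rule ind_closed[OF finC Cc])
  let ?f = "v \<otimes>\<^bsub>ZG\<^esub> ?E"
  have f: "?f \<in> carrier ZG" using v E by (intro gr_mult_closed)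
  have "{x. ?f x \<noteq> 0} \<subseteq> T"
  proof
    fix x assume "x \<in> {x. ?f x \<noteq> 0}"
    then obtain y z where "v y \<noteq> 0" "?E z \<noteq> 0" "x = y \<otimes> z"
      using group_ring_mult_nonzeroD[of G v ?E] by blast
    then show "x \<in> T" using v(3) C(2) subgroup.m_closed[OF T(1)] by (auto simp: ind_def split: if_splits)
  qed
  then obtain L :: "complex list" where
    L: "\<And>k. of_int (int (card T) * (?f [^]\<^bsub>ZG\<^esub> (k::nat)) \<one>) = (\<Sum>ev\<leftarrow>L. ev ^ k)"
    using gr_pow_at_one_eigenvalues[OF T f] by blast
  have m0: "?m \<noteq> 0" and n0: "?n \<noteq> 0"
    using finC T subgroup.one_closed[OF C(1)] subgroup.one_closed[OF T(1)] by auto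
  have "rational_power_sum (\<lambda>k. (?m / ?n) * (\<Sum>ev\<leftarrow>L. (ev / ?m) ^ k))"
    by (intro rational_power_sum_scale rational_power_sum_list) auto
  then show ?thesis
  proof (rule rational_power_sum_cong[rotated])
    fix k :: nat assume "k \<ge> 1"
    then obtain j where k: "k = Suc j" by (cases k) auto
    let ?q = "complex_of_int ((v [^]\<^bsub>ZG\<^esub> k \<otimes>\<^bsub>ZG\<^esub> ?E) \<one>)"
    have "(\<Sum>ev\<leftarrow>L. (ev / ?m) ^ k) = (\<Sum>ev\<leftarrow>L. ev ^ k) / ?m ^ k"
      by (induction L) (auto simp: add_divide_distrib power_divide)
    also have "(\<Sum>ev\<leftarrow>L. ev ^ k) = ?n * (?m ^ j * ?q)"
      unfolding L[symmetric] k gr_pow_mult_ind[OF v(1,2) C(1) finC] by simp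
    finally have "(?m / ?n) * (\<Sum>ev\<leftarrow>L. (ev / ?m) ^ k) = ?q"
      using m0 n0 by (simp add: k field_simps)
    also have "?q = (\<Sum>z\<in>C. of_int ((v [^]\<^bsub>ZG\<^esub> k) (inv z)))"
      using gr_mult_ind_at_one[OF gr_pow_closed[OF v(1)] finC Cc, of k] by simp
    finally show "(?m / ?n) * (\<Sum>ev\<leftarrow>L. (ev / ?m) ^ k) = (\<Sum>z\<in>C. of_int ((v [^]\<^bsub>ZG\<^esub> k) (inv z)))" .
  qed
qed

lemma generate_singleton_mono:
  "y \<in> generate G {x} \<Longrightarrow> x \<in> carrier G \<Longrightarrow> generate G {y} \<subseteq> generate G {x}"
  using generate_subgroup_incl[of "{y}" "generate G {x}"] generate_is_subgroup[of "{x}"] by auto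

text \<open>Inclusion-exclusion over the cyclic subgroups of a cyclic group, which passes from the sum over
  a cyclic group to the sum over its generators.\<close>

lemma rational_power_sum_generators:
  assumes T: "subgroup T G" "finite T"
    and v: "v \<in> carrier ZG" "class_fun G T v" "{x. v x \<noteq> 0} \<subseteq> T" and x: "x \<in> T"
  shows "rational_power_sum
    (\<lambda>k. \<Sum>z\<in>{z\<in>T. generate G {z} = generate G {x}}. of_int ((v [^]\<^bsub>ZG\<^esub> (k::nat)) (inv z)))"
  using x
proof (induction "card (generate G {x})" arbitrary: x rule: less_induct)
  case less
  let ?c = "\<lambda>x. generate G {x}"
  let ?F = "\<lambda>(k::nat) z. complex_of_int ((v [^]\<^bsub>ZG\<^esub> k) (inv z))"
  have Tc: "T \<subseteq> carrier G" using T(1) by (rule subgroup.subset)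
  have xc: "x \<in> carrier G" using less.prems Tc by blast
  have C: "subgroup (?c x) G" using xc by (intro generate_is_subgroup) auto
  have CT: "?c x \<subseteq> T" using generate_subgroup_incl[OF _ T(1), of "{x}"] less.prems by auto
  have fin: "finite (?c x)" using CT T finite_subset by blast
  have self: "z \<in> ?c z" for z by (rule generate.incl) simp
  \<comment> \<open>A generator of a subgroup \<open>D\<close> of \<open><x>\<close> lies in
    \<open><x>\<close>, so looking for generators of \<open>D\<close> in \<open><x>\<close> or in
    \<open>T\<close> gives the same set; the induction hypothesis speaks of
    \<open>T\<close>.\<close>
  have eq: "{z \<in> ?c x. ?c z = D} = {z \<in> T. ?c z = D}" if "D \<in> ?c ` ?c x" for D
    using that CT self generate_singleton_mono[OF _ xc] by blast
  have split: "(\<Sum>z\<in>?c x. ?F k z) = (\<Sum>z\<in>{z\<in>T. ?c z = ?c x}. ?F k z) +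
      (\<Sum>D\<in>?c ` ?c x - {?c x}. \<Sum>z\<in>{z\<in>T. ?c z = D}. ?F k z)" for k
  proof -
    have "(\<Sum>z\<in>?c x. ?F k z) = (\<Sum>D\<in>?c ` ?c x. \<Sum>z\<in>{z \<in> ?c x. ?c z = D}. ?F k z)"
      using fin by (intro sum.group[symmetric]) auto
    also have "\<dots> = (\<Sum>D\<in>?c ` ?c x. \<Sum>z\<in>{z\<in>T. ?c z = D}. ?F k z)"
      by (intro sum.cong HOL.refl eq)
    also have "\<dots> = (\<Sum>z\<in>{z\<in>T. ?c z = ?c x}. ?F k z) +
      (\<Sum>D\<in>?c ` ?c x - {?c x}. \<Sum>z\<in>{z\<in>T. ?c z = D}. ?F k z)"
      using fin self[of x] by (intro sum.remove) auto
    finally show ?thesis .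
  qed
  have "rational_power_sum (\<lambda>k. \<Sum>D\<in>?c ` ?c x - {?c x}. \<Sum>z\<in>{z\<in>T. ?c z = D}. ?F k z)"
  proof (rule rational_power_sum_sum)
    show "finite (?c ` ?c x - {?c x})" using fin by simp
    fix D assume "D \<in> ?c ` ?c x - {?c x}"
    then obtain y where y: "y \<in> ?c x" "D = ?c y" "D \<noteq> ?c x" by blast
    have "?c y \<subset> ?c x" using generate_singleton_mono[OF y(1) xc] y by blast
    then have "card (?c y) < card (?c x)" using fin by (intro psubset_card_mono)
    then show "rational_power_sum (\<lambda>k. \<Sum>z\<in>{z\<in>T. ?c z = D}. ?F k z)"
      unfolding y(2) using less.hyps[of y] y(1) CT by blast
  qed
  moreover have "rational_power_sum (\<lambda>k. \<Sum>z\<in>?c x. ?F k z)"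
    using v CT by (intro rational_power_sum_subgroup[OF T C]) (auto simp: class_fun_def)
  ultimately have "rational_power_sum (\<lambda>k. (\<Sum>z\<in>?c x. ?F k z) +
      (-1) * (\<Sum>D\<in>?c ` ?c x - {?c x}. \<Sum>z\<in>{z\<in>T. ?c z = D}. ?F k z))"
    by (intro rational_power_sum_add rational_power_sum_scale) auto
  then show ?case unfolding split by simp
qed

lemma same_cyclic_coprime_power:
  assumes z: "z \<in> carrier G" "torsion_elt G z" and y: "y \<in> carrier G"
    and eq: "generate G {y} = generate G {z}"
  shows "\<exists>j\<in>totatives (ord z). y = z [^] j"
proof -
  obtain n :: nat where n: "n > 0" "z [^] n = \<one>" using z by (auto simp: torsion_elt_def)
  then have "ord z dvd n" using z pow_eq_id by blast
  then have oz: "ord z > 0" using n by (cases "ord z = 0") auto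
  have oy: "ord y = ord z" using generate_pow_card y z(1) eq by simp
  show ?thesis
  proof (cases "ord z = 1")
    \<comment> \<open>For order \<open>1\<close> the reduced exponent would be \<open>0\<close>,
      which is not a totative of \<open>1\<close>; the exponent \<open>1\<close> has to be
      supplied.\<close>
    case True
    then have "z = \<one>" "y = \<one>" using oy ord_eq_1 z y by auto
    then show ?thesis using True by (intro bexI[of _ 1]) (auto simp: totatives_def)
  next
    case False
    have "y \<in> generate G {z}" using eq generate.incl[of y "{y}" G] by auto
    then obtain k :: nat where k: "y = z [^] k" using generate_pow_nat[OF z(1)] oz by auto
    let ?j = "k mod ord z"
    have yj: "y = z [^] ?j" using k pow_ord_eq_1[OF z(1)] z(1)
      by (metis mod_mult_div_eq mult.commute nat_pow_closed nat_pow_mult nat_pow_one nat_pow_pow r_one)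
    have "ord z = (if ?j = 0 then 1 else ord z div gcd (ord z) ?j)"
      using ord_pow_gen[OF z(1), of ?j] oy yj by simp
    then have j: "?j \<noteq> 0" "ord z div gcd (ord z) ?j = ord z" using False by (auto split: if_splits)
    then have "gcd (ord z) ?j = 1" using oz by (simp add: div_eq_dividend_iff)
    then have "?j \<in> totatives (ord z)"
      using j(1) oz by (auto simp: totatives_def coprime_iff_gcd_eq_1 gcd.commute intro: less_imp_le)
    then show ?thesis using yj by blast
  qed
qed

text \<open>Invariance settles the case where \<open>z^j\<close> is conjugate to \<open>z\<close>,
  and the symmetry of \<open>v\<close> turns conjugacy to \<open>z^-1\<close> into the same
  conclusion.\<close>

lemma RS_central_const:
  assumes RS: "RS_element G z" and v: "class_fun G (carrier G) v" "gr_star G v = v"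
    and j: "j \<in> totatives (ord z)"
  shows "v (z [^] j) = v z"
proof -
  have zc: "z \<in> carrier G" using RS by (simp add: RS_element_def)
  have conj: "v b = v a" if "conj_in G a b" "a \<in> carrier G" for a b
    using that v(1) by (auto simp: conj_in_def class_fun_def)
  have inv: "v (inv z) = v z" using fun_cong[OF v(2), of z] zc by (simp add: gr_star_def)
  from RS j have "conj_in G (z [^] j) z \<or> conj_in G (z [^] j) (inv z)" by (auto simp: RS_element_def)
  then show ?thesis using conj inv zc by (metis nat_pow_closed)
qed

theorem RS_cut_group:
  assumes RS: "\<And>x. x \<in> FC_torsion G \<Longrightarrow> RS_element G x"
  shows "cut_group G"
proof (rule cut_groupI)
  fix w w' assume w: "w \<in> carrier ZG" "class_fun G (carrier G) w" "gr_star G w = w"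
    and w': "w' \<in> carrier ZG"
    and ww: "w \<otimes>\<^bsub>ZG\<^esub> w' = \<one>\<^bsub>ZG\<^esub>"
    and FC: "{x. w x \<noteq> 0} \<subseteq> FC_torsion G" "{x. w' x \<noteq> 0} \<subseteq> FC_torsion G"
  interpret ZG: monoid ZG by (rule monoid_group_ring)
  \<comment> \<open>\<open>T\<close> contains the support of the inverse as well, so that the matrix
    of \<open>w\<close> on the group ring of \<open>T\<close> is invertible over the
    integers.\<close>
  obtain T where T: "subgroup T G" "finite T" "{x. w x \<noteq> 0} \<union> {x. w' x \<noteq> 0} \<subseteq> T" "T \<subseteq> FC_torsion G"
    using finite_FC_torsion_subset_subgroup[of "{x. w x \<noteq> 0} \<union> {x. w' x \<noteq> 0}"] FC w w' by auto
  have wT: "{x. w x \<noteq> 0} \<subseteq> T" "{x. w' x \<noteq> 0} \<subseteq> T" using T(3) by auto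
  have Tc: "T \<subseteq> carrier G" using T(1) by (rule subgroup.subset)
  have clT: "class_fun G T w" using w(2) Tc by (auto simp: class_fun_def)
  obtain ts where ts: "set ts = T" "distinct ts" using finite_distinct_list[OF T(2)] by blast
  let ?c = "\<lambda>x. generate G {x}"
  let ?F = "\<lambda>(k::nat) z. complex_of_int ((w [^]\<^bsub>ZG\<^esub> k) (inv z))"
  have const: "w y = w z" if yz: "y \<in> T" "z \<in> T" "?c y = ?c z" for y z
  proof -
    have RSz: "RS_element G z" using RS yz T by blast
    then have "torsion_elt G z" by (simp add: RS_element_def)
    then obtain j where "j \<in> totatives (ord z)" "y = z [^] j"
      using same_cyclic_coprime_power[of z y] yz Tc by auto
    then show ?thesis using RS_central_const[OF RSz w(2,3)] by simp
  qed
  define r where "r D = (SOME z. z \<in> T \<and> ?c z = D)" for D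
  have r: "r D \<in> T \<and> ?c (r D) = D" if "D \<in> ?c ` T" for D
    unfolding r_def by (rule someI_ex) (use that in auto)
  \<comment> \<open>The product \<open>w^k w\<close> is evaluated at \<open>1\<close> and its second
    factor grouped by generated cyclic subgroup. There \<open>w\<close> is constant, so each group
    is an integer times a sum of \<open>w^k\<close> over the generators of one cyclic group.
    Splitting off one factor is the origin of the shift \<open>Suc k\<close>.\<close>
  have pow: "of_int ((w [^]\<^bsub>ZG\<^esub> Suc k) \<one>) = (\<Sum>D\<in>?c ` T. of_int (w (r D)) * (\<Sum>z\<in>{z\<in>T. ?c z = D}. ?F k z))" for k
  proof -
    have "(w [^]\<^bsub>ZG\<^esub> Suc k) \<one> = (w [^]\<^bsub>ZG\<^esub> k \<otimes>\<^bsub>ZG\<^esub> w) \<one>" by simp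
    also have "\<dots> = (\<Sum>z\<in>T. (w [^]\<^bsub>ZG\<^esub> k) (\<one> \<otimes> inv z) * w z)"
      using w(1) wT T(2) Tc by (intro gr_mult_right gr_pow_closed) auto
    finally have "of_int ((w [^]\<^bsub>ZG\<^esub> Suc k) \<one>) = (\<Sum>z\<in>T. of_int (w z) * ?F k z)"
      using Tc by (simp add: mult.commute subset_iff cong: sum.cong)
    also have "\<dots> = (\<Sum>D\<in>?c ` T. \<Sum>z\<in>{z\<in>T. ?c z = D}. of_int (w z) * ?F k z)"
      using T(2) by (intro sum.group[symmetric]) auto
    also have "\<dots> = (\<Sum>D\<in>?c ` T. \<Sum>z\<in>{z\<in>T. ?c z = D}. of_int (w (r D)) * ?F k z)"
      using const r by (intro sum.cong HOL.refl) (metis (mono_tags, lifting) mem_Collect_eq)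
    also have "\<dots> = (\<Sum>D\<in>?c ` T. of_int (w (r D)) * (\<Sum>z\<in>{z\<in>T. ?c z = D}. ?F k z))"
      by (simp add: sum_distrib_left)
    finally show ?thesis .
  qed
  have "rational_power_sum (\<lambda>k. of_int ((w [^]\<^bsub>ZG\<^esub> Suc k) \<one>))"
    unfolding pow
  proof (rule rational_power_sum_sum)
    fix D assume "D \<in> ?c ` T"
    then obtain x where "x \<in> T" "D = ?c x" by blast
    then show "rational_power_sum (\<lambda>k. of_int (w (r D)) * (\<Sum>z\<in>{z\<in>T. ?c z = D}. ?F k z))"
      using rational_power_sum_generators[OF T(1,2) w(1) clT wT(1)]
      by (intro rational_power_sum_scale) auto
  qed (use T in simp)
  then have "rational_power_sum (\<lambda>k. of_nat (card T) * of_int ((w [^]\<^bsub>ZG\<^esub> Suc k) \<one>))"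
    by (intro rational_power_sum_scale) auto
  moreover have tr: "mat_trace (gr_mat ts w ^\<^sub>m k) = int (card T) * (w [^]\<^bsub>ZG\<^esub> k) \<one>" for k
    using gr_mat_pow[OF T(1) ts w(1) wT(1), of k] gr_mat_trace[of ts] ts Tc distinct_card[OF ts(2)] by metis
  ultimately have rps: "rational_power_sum (\<lambda>k. of_int (mat_trace (gr_mat ts w ^\<^sub>m Suc k)))"
    unfolding tr by simp
  have "gr_mat ts w * gr_mat ts w' = 1\<^sub>m (length ts)"
    using gr_mat_mult[OF T(1) ts w(1) w' wT(2)] ww gr_mat_one[of ts] ts Tc by simp
  then have "mat_trace (gr_mat ts w ^\<^sub>m 2) = int (length ts)"
    by (rule unit_mat_rational_trace_square[OF gr_mat_carrier gr_mat_carrier _ rps])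
  then have "int (card T) * (w [^]\<^bsub>ZG\<^esub> (2::nat)) \<one> = int (card T)"
    using tr[of 2] distinct_card[OF ts(2)] ts(1) by simp
  moreover have "card T \<noteq> 0" using T(2) subgroup.one_closed[OF T(1)] by auto
  ultimately have "(w [^]\<^bsub>ZG\<^esub> (2::nat)) \<one> = 1" by simp
  \<comment> \<open>Symmetry identifies \<open>w^2\<close> with \<open>w w^*\<close>, so its
    coefficient at \<open>1\<close>, just found to be \<open>1\<close>, is the square sum demanded
    by \<open>cut_groupI\<close>.\<close>
  moreover have "w [^]\<^bsub>ZG\<^esub> (2::nat) = w \<otimes>\<^bsub>ZG\<^esub> gr_star G w"
    using w by (simp add: numeral_2_eq_2)
  ultimately show "(\<Sum>x | w x \<noteq> 0. (w x)\<^sup>2) = 1" using gr_mult_star_at_one[OF w(1)] by simp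
qed

end

section \<open>Normal forms in HNN extensions\<close>

lemma words_simps [simp]:
  "[] \<in> words S" "(a # u) \<in> words S \<longleftrightarrow> fst a \<in> S \<and> u \<in> words S"
  "u @ v \<in> words S \<longleftrightarrow> u \<in> words S \<and> v \<in> words S"
  by (auto simp: words_def mem_Times_iff)

lemma word_eq_words: "word_eq S R u v \<Longrightarrow> u \<in> words S \<and> v \<in> words S"
  by (induction rule: word_eq.induct) auto

lemma word_class_eq_iff:
  "u \<in> words S \<Longrightarrow> word_class S R u = word_class S R v \<longleftrightarrow> word_eq S R u v"
  by (auto simp: word_class_def intro: word_eq.refl word_eq.sym word_eq.trans)

lemma word_class_eqI: "word_eq S R u v \<Longrightarrow> word_class S R u = word_class S R v"
  using word_class_eq_iff word_eq_words by blast

lemma presented_group_carrier: "carrier (presented_group S R) = word_class S R ` words S"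
  by (simp add: presented_group_def)

lemma presented_group_one: "\<one>\<^bsub>presented_group S R\<^esub> = word_class S R []"
  by (simp add: presented_group_def)

lemma presented_group_mult:
  assumes "u \<in> words S" "v \<in> words S"
  shows "word_class S R u \<otimes>\<^bsub>presented_group S R\<^esub> word_class S R v = word_class S R (u @ v)"
proof -
  have eq: "word_class S R (u' @ v') = word_class S R (u @ v)"
    if "u' \<in> word_class S R u" "v' \<in> word_class S R v" for u' v'
    using that by (intro word_class_eqI) (auto simp: word_class_def intro: word_eq.cong word_eq.sym)
  have "u \<in> word_class S R u" "v \<in> word_class S R v"
    using assms by (auto simp: word_class_def intro: word_eq.refl)
  then have ne: "word_class S R u \<noteq> {}" "word_class S R v \<noteq> {}" by blast+
  have "(\<Union>u'\<in>word_class S R u. \<Union>v'\<in>word_class S R v. word_class S R (u' @ v'))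
      = (\<Union>u'\<in>word_class S R u. \<Union>v'\<in>word_class S R v. word_class S R (u @ v))"
    by (intro SUP_cong HOL.refl eq)
  also have "\<dots> = word_class S R (u @ v)" using ne by simp
  finally have "(\<Union>u'\<in>word_class S R u. \<Union>v'\<in>word_class S R v. word_class S R (u' @ v')) = word_class S R (u @ v)" .
  then show ?thesis by (simp add: presented_group_def)
qed

definition word_inv :: "'s word \<Rightarrow> 's word" where
  "word_inv u = rev (map (\<lambda>(s, b). (s, \<not> b)) u)"

lemma word_inv_words: "u \<in> words S \<Longrightarrow> word_inv u \<in> words S"
  by (auto simp: words_def word_inv_def)

lemma word_inv_left: "u \<in> words S \<Longrightarrow> word_eq S R (word_inv u @ u) []"
proof (induction u)
  case Nil
  then show ?case by (auto simp: word_inv_def intro: word_eq.refl)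
next
  case (Cons a u)
  obtain s b where a: "a = (s, b)" by force
  have s: "s \<in> S" and u: "u \<in> words S" using Cons.prems a by auto
  have "word_eq S R ([(s, \<not> b), (s, b)] @ u) ([] @ u)"
    using word_eq.cancel[OF s, of R "\<not> b"] word_eq.refl[OF u] by (intro word_eq.cong) auto
  then have "word_eq S R (word_inv u @ ([(s, \<not> b), (s, b)] @ u)) (word_inv u @ u)"
    using word_eq.refl[OF word_inv_words[OF u]] by (intro word_eq.cong) auto
  then have "word_eq S R (word_inv u @ ([(s, \<not> b), (s, b)] @ u)) []"
    using Cons.IH[OF u] by (rule word_eq.trans)
  then show ?case by (simp add: word_inv_def a)
qed

lemma group_presented_group: "group (presented_group S R)"
proof (rule groupI)
  let ?D = "presented_group S R"
  show "\<one>\<^bsub>?D\<^esub> \<in> carrier ?D" by (simp add: presented_group_one presented_group_carrier)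
next
  fix x y assume "x \<in> carrier (presented_group S R)" "y \<in> carrier (presented_group S R)"
  then show "x \<otimes>\<^bsub>presented_group S R\<^esub> y \<in> carrier (presented_group S R)"
    by (auto simp: presented_group_carrier presented_group_mult)
next
  fix x y z assume "x \<in> carrier (presented_group S R)" "y \<in> carrier (presented_group S R)"
    "z \<in> carrier (presented_group S R)"
  then show "x \<otimes>\<^bsub>presented_group S R\<^esub> y \<otimes>\<^bsub>presented_group S R\<^esub> z =
    x \<otimes>\<^bsub>presented_group S R\<^esub> (y \<otimes>\<^bsub>presented_group S R\<^esub> z)"
    by (auto simp: presented_group_carrier presented_group_mult)
next
  fix x assume "x \<in> carrier (presented_group S R)"
  then show "\<one>\<^bsub>presented_group S R\<^esub> \<otimes>\<^bsub>presented_group S R\<^esub> x = x"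
    using presented_group_mult[of "[]" S _ R] by (auto simp: presented_group_carrier presented_group_one)
next
  fix x assume "x \<in> carrier (presented_group S R)"
  then obtain u where u: "u \<in> words S" "x = word_class S R u" by (auto simp: presented_group_carrier)
  then show "\<exists>y\<in>carrier (presented_group S R). y \<otimes>\<^bsub>presented_group S R\<^esub> x = \<one>\<^bsub>presented_group S R\<^esub>"
    using word_inv_words[OF u(1)] word_class_eqI[OF word_inv_left[OF u(1), of R]]
    by (intro bexI[of _ "word_class S R (word_inv u)"])
       (auto simp: presented_group_carrier presented_group_mult presented_group_one)
qed

text \<open>Induction over the derivation: an action of the letters that respects cancellation and
  the relations cannot tell equal words apart. Conversely, different effects on \<open>W\<close> are
  how words will be distinguished in a presented group.\<close>

lemma word_eq_act:
  assumes act: "\<And>s b w. s \<in> S \<Longrightarrow> w \<in> W \<Longrightarrow> act (s, b) w \<in> W"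
    and cancel: "\<And>s b w. s \<in> S \<Longrightarrow> w \<in> W \<Longrightarrow> act (s, b) (act (s, \<not> b) w) = w"
    and rel: "\<And>u v w. (u, v) \<in> R \<Longrightarrow> u \<in> words S \<Longrightarrow> v \<in> words S \<Longrightarrow> w \<in> W \<Longrightarrow> foldr act u w = foldr act v w"
    and eq: "word_eq S R u v"
  shows "w \<in> W \<Longrightarrow> foldr act u w = foldr act v w"
  using eq
proof (induction arbitrary: w rule: word_eq.induct)
  case (cong u v u' v')
  have "foldr act u' w \<in> W" if "u' \<in> words S" for u'
    using that by (induction u') (auto simp: cong.prems act split: prod.splits)
  then have "foldr act u' w \<in> W" using word_eq_words[OF cong.hyps(2)] by blast
  then show ?case using cong by simp
qed (auto simp: rel cancel)

text \<open>Elements of a presented group are classes, so some word is chosen from the class; by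
  \<open>word_act_class\<close> the choice does not matter on \<open>W\<close>.\<close>

definition word_act :: "('s \<times> bool \<Rightarrow> 'w \<Rightarrow> 'w) \<Rightarrow> 's word set \<Rightarrow> 'w \<Rightarrow> 'w" where
  "word_act act x = foldr act (SOME u. u \<in> x)"

lemma word_act_class:
  assumes act: "\<And>s b w. s \<in> S \<Longrightarrow> w \<in> W \<Longrightarrow> act (s, b) w \<in> W"
    and cancel: "\<And>s b w. s \<in> S \<Longrightarrow> w \<in> W \<Longrightarrow> act (s, b) (act (s, \<not> b) w) = w"
    and rel: "\<And>u v w. (u, v) \<in> R \<Longrightarrow> u \<in> words S \<Longrightarrow> v \<in> words S \<Longrightarrow> w \<in> W \<Longrightarrow> foldr act u w = foldr act v w"
    and u: "u \<in> words S" and w: "w \<in> W"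
  shows "word_act act (word_class S R u) w = foldr act u w"
proof -
  have "u \<in> word_class S R u" using u by (simp add: word_class_def word_eq.refl)
  then have "(SOME v. v \<in> word_class S R u) \<in> word_class S R u" by (rule someI)
  then have "word_eq S R u (SOME v. v \<in> word_class S R u)" by (simp add: word_class_def)
  then have "foldr act u w = foldr act (SOME v. v \<in> word_class S R u) w"
    using w word_eq_act[of S W act R, OF act cancel rel] by blast
  then show ?thesis by (simp add: word_act_def)
qed

text \<open>Normal forms for a multiple HNN extension of \<open>K\<close>. The stable letters come with their inverses:
  \<open>t\<^sub>e\<close> for \<open>e \<in> E\<close>, where \<open>t (bar e)\<close> is the inverse of \<open>t e\<close> and \<open>t e \<cdot> c = \<psi> e c \<cdot> t e\<close> for \<open>c \<in> C e\<close>.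
  A pair \<open>(g, [(e\<^sub>1, s\<^sub>1), \<dots>])\<close> stands for \<open>g t\<^sub>e\<^sub>1 s\<^sub>1 t\<^sub>e\<^sub>2 s\<^sub>2 \<dots>\<close>, with \<open>s\<^sub>i\<close> a representative of its coset \<open>C e\<^sub>i s\<^sub>i\<close>.\<close>

locale hnn_system = K: group K for K (structure) +
  fixes E :: "'e set" and bar :: "'e \<Rightarrow> 'e" and C :: "'e \<Rightarrow> 'a set" and \<psi> :: "'e \<Rightarrow> 'a \<Rightarrow> 'a"
  assumes bar_closed: "e \<in> E \<Longrightarrow> bar e \<in> E" and bar_bar: "e \<in> E \<Longrightarrow> bar (bar e) = e"
    and C_subgroup: "e \<in> E \<Longrightarrow> subgroup (C e) K"
    and psi_closed: "e \<in> E \<Longrightarrow> c \<in> C e \<Longrightarrow> \<psi> e c \<in> C (bar e)"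
    and psi_mult: "e \<in> E \<Longrightarrow> c \<in> C e \<Longrightarrow> c' \<in> C e \<Longrightarrow> \<psi> e (c \<otimes> c') = \<psi> e c \<otimes> \<psi> e c'"
    and psi_psi: "e \<in> E \<Longrightarrow> c \<in> C e \<Longrightarrow> \<psi> (bar e) (\<psi> e c) = c"
begin

lemma C_carrier: "e \<in> E \<Longrightarrow> c \<in> C e \<Longrightarrow> c \<in> carrier K"
  by (rule subgroup.mem_carrier[OF C_subgroup])

lemma C_mult: "e \<in> E \<Longrightarrow> c \<in> C e \<Longrightarrow> c' \<in> C e \<Longrightarrow> c \<otimes> c' \<in> C e"
  by (rule subgroup.m_closed[OF C_subgroup])

lemma C_inv: "e \<in> E \<Longrightarrow> c \<in> C e \<Longrightarrow> inv c \<in> C e"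
  by (rule subgroup.m_inv_closed[OF C_subgroup])

lemma C_one: "e \<in> E \<Longrightarrow> \<one> \<in> C e"
  by (rule subgroup.one_closed[OF C_subgroup])

lemma psi_carrier: "e \<in> E \<Longrightarrow> c \<in> C e \<Longrightarrow> \<psi> e c \<in> carrier K"
  using psi_closed bar_closed C_carrier by blast

text \<open>The subgroup \<open>C e\<close> itself is represented by \<open>1\<close>, so that
  \<open>rep e g = \<one>\<close> detects membership; this is the cancellation test in
  \<open>actT\<close>.\<close>

definition rep :: "'e \<Rightarrow> 'a \<Rightarrow> 'a" where
  "rep e g = (if g \<in> C e then \<one> else (SOME r. r \<in> C e #> g))"

lemma rep_coset:
  assumes e: "e \<in> E" and g: "g \<in> carrier K"
  shows "\<exists>c\<in>C e. g = c \<otimes> rep e g" "rep e g \<in> carrier K"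
proof -
  have "rep e g \<in> C e #> g"
  proof (cases "g \<in> C e")
    case True
    then have "\<one> = inv g \<otimes> g" "inv g \<in> C e" using e g C_inv by auto
    then show ?thesis using True by (auto simp: rep_def r_coset_def)
  next
    case False
    have "g \<in> C e #> g" using K.rcos_self[OF g C_subgroup[OF e]] .
    then show ?thesis using False someI[of "\<lambda>r. r \<in> C e #> g" g] by (simp add: rep_def)
  qed
  then obtain c where c: "c \<in> C e" "rep e g = c \<otimes> g" by (auto simp: r_coset_def)
  then show "rep e g \<in> carrier K" using C_carrier[OF e] g by simp
  have "g = inv c \<otimes> rep e g" using c C_carrier[OF e c(1)] g by simp
  then show "\<exists>c\<in>C e. g = c \<otimes> rep e g" using C_inv[OF e c(1)] by blast
qed

lemma rep_mult:
  assumes e: "e \<in> E" and c: "c \<in> C e" and g: "g \<in> carrier K"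
  shows "rep e (c \<otimes> g) = rep e g"
proof -
  have cc: "c \<in> carrier K" using C_carrier e c by blast
  have "c \<otimes> g \<in> C e \<longleftrightarrow> g \<in> C e"
  proof
    assume "c \<otimes> g \<in> C e"
    then have "inv c \<otimes> (c \<otimes> g) \<in> C e" using e c C_mult C_inv by blast
    then show "g \<in> C e" using cc g by simp
  qed (use e c C_mult in blast)
  moreover have "C e #> (c \<otimes> g) = C e #> g"
    using K.coset_mult_assoc[of "C e" c g] K.coset_join2[OF cc C_subgroup[OF e] c]
      subgroup.subset[OF C_subgroup[OF e]] cc g by simp
  ultimately show ?thesis by (simp add: rep_def)
qed

lemma rep_rep: "e \<in> E \<Longrightarrow> g \<in> carrier K \<Longrightarrow> rep e (rep e g) = rep e g"
  using rep_coset rep_mult by metis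

lemma rep_eq_one_iff: "e \<in> E \<Longrightarrow> g \<in> carrier K \<Longrightarrow> rep e g = \<one> \<longleftrightarrow> g \<in> C e"
  using rep_coset[of e g] C_carrier[of e] by (auto simp: rep_def split: if_splits)

definition cp :: "'e \<Rightarrow> 'a \<Rightarrow> 'a" where "cp e g = g \<otimes> inv (rep e g)"

lemma cp_rep:
  assumes e: "e \<in> E" and c: "c \<in> C e" and s: "s \<in> carrier K" "rep e s = s"
  shows "cp e (c \<otimes> s) = c" "rep e (c \<otimes> s) = s"
  using assms rep_mult C_carrier[OF e c] by (simp_all add: cp_def)

lemma decompose:
  assumes "e \<in> E" "g \<in> carrier K"
  obtains c s where "c \<in> C e" "s \<in> carrier K" "rep e s = s" "g = c \<otimes> s"
  using rep_coset[OF assms] rep_rep[OF assms] by metis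

text \<open>A coset representative lies in \<open>C e\<close> only if it is \<open>1\<close>, so the
  last clause forbids exactly the subwords that could still cancel.\<close>

fun normal :: "('e \<times> 'a) list \<Rightarrow> bool" where
  "normal [] \<longleftrightarrow> True"
| "normal ((e, s) # l) \<longleftrightarrow> e \<in> E \<and> s \<in> carrier K \<and> rep e s = s \<and> normal l \<and>
     (l \<noteq> [] \<longrightarrow> s = \<one> \<longrightarrow> fst (hd l) \<noteq> bar e)"

definition W :: "('a \<times> ('e \<times> 'a) list) set" where
  "W = {(g, l). g \<in> carrier K \<and> normal l}"

definition actK :: "'a \<Rightarrow> 'a \<times> ('e \<times> 'a) list \<Rightarrow> 'a \<times> ('e \<times> 'a) list" where
  "actK g = (\<lambda>(x, l). (g \<otimes> x, l))"

text \<open>Left multiplication by \<open>t_e\<close>: with \<open>x = c s\<close>, the relation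
  gives \<open>t_e c s = psi_e(c) t_e s\<close>. If \<open>s\<close> is trivial and the next letter
  is the inverse of \<open>t_e\<close>, the two letters disappear and the following representative
  joins the group element.\<close>

definition actT :: "'e \<Rightarrow> 'a \<times> ('e \<times> 'a) list \<Rightarrow> 'a \<times> ('e \<times> 'a) list" where
  "actT e = (\<lambda>(x, l). if rep e x = \<one> \<and> l \<noteq> [] \<and> fst (hd l) = bar e
     then (\<psi> e (cp e x) \<otimes> snd (hd l), tl l) else (\<psi> e (cp e x), (e, rep e x) # l))"

lemma actT_decomposed:
  assumes "e \<in> E" "c \<in> C e" "s \<in> carrier K" "rep e s = s"
  shows "actT e (c \<otimes> s, l) = (if s = \<one> \<and> l \<noteq> [] \<and> fst (hd l) = bar e
     then (\<psi> e c \<otimes> snd (hd l), tl l) else (\<psi> e c, (e, s) # l))"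
  by (simp only: actT_def prod.case cp_rep[OF assms])

lemma actK_W: "g \<in> carrier K \<Longrightarrow> w \<in> W \<Longrightarrow> actK g w \<in> W"
  by (auto simp: actK_def W_def)

lemma actK_mult: "g \<in> carrier K \<Longrightarrow> h \<in> carrier K \<Longrightarrow> w \<in> W \<Longrightarrow> actK (g \<otimes> h) w = actK g (actK h w)"
  by (auto simp: actK_def W_def K.m_assoc)

lemma actK_one: "w \<in> W \<Longrightarrow> actK \<one> w = w"
  by (auto simp: actK_def W_def)

lemma actT_W:
  assumes e: "e \<in> E" and w: "w \<in> W"
  shows "actT e w \<in> W"
proof -
  obtain x l where xl: "w = (x, l)" "x \<in> carrier K" "normal l" using w by (auto simp: W_def)
  obtain c s where cs: "c \<in> C e" "s \<in> carrier K" "rep e s = s" "x = c \<otimes> s"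
    using decompose[OF e xl(2)] by blast
  have "\<psi> e c \<in> carrier K" using e cs psi_carrier by blast
  then show ?thesis
    using xl cs e actT_decomposed[OF e cs(1-3), of l]
    by (cases l) (auto simp: W_def split: if_splits)
qed

text \<open>Prepending and cancelling undo each other: a prepended letter is cancelled at once
  because \<open>1\<close> represents \<open>C (bar e)\<close>, and a cancelled letter is restored
  because normality rules out a second cancellation.\<close>

lemma actT_bar:
  assumes e: "e \<in> E" and w: "w \<in> W"
  shows "actT (bar e) (actT e w) = w"
proof -
  obtain x l where xl: "w = (x, l)" "x \<in> carrier K" "normal l" using w by (auto simp: W_def)
  obtain c s where cs: "c \<in> C e" "s \<in> carrier K" "rep e s = s" "x = c \<otimes> s"
    using decompose[OF e xl(2)] by blast
  have be: "bar e \<in> E" "bar (bar e) = e" using e bar_closed bar_bar by auto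
  have pc: "\<psi> e c \<in> C (bar e)" "\<psi> (bar e) (\<psi> e c) = c" using e cs psi_closed psi_psi by auto
  have pcc: "\<psi> e c \<in> carrier K" "c \<in> carrier K" using C_carrier be e pc cs by auto
  show ?thesis
  proof (cases "s = \<one> \<and> l \<noteq> [] \<and> fst (hd l) = bar e")
    case True
    then obtain s' l' where l: "l = (bar e, s') # l'" by (cases l) auto
    have s': "s' \<in> carrier K" "rep (bar e) s' = s'" using xl(3) l by auto
    have "actT e w = (\<psi> e c \<otimes> s', l')"
      using actT_decomposed[OF e cs(1-3), of l] True l xl cs by simp
    moreover have "actT (bar e) (\<psi> e c \<otimes> s', l') = (c, (bar e, s') # l')"
      using actT_decomposed[OF be(1) pc(1) s', of l'] xl(3) l be pc by auto
    ultimately show ?thesis using True xl cs l pcc by simp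
  next
    case False
    have one: "rep (bar e) \<one> = \<one>" using rep_eq_one_iff[OF be(1), of \<one>] C_one[OF be(1)] by simp
    have "actT e w = (\<psi> e c, (e, s) # l)"
      using actT_decomposed[OF e cs(1-3), of l] False xl cs by simp
    moreover have "actT (bar e) (\<psi> e c, (e, s) # l) = (c \<otimes> s, l)"
      using actT_decomposed[OF be(1) pc(1) _ one, of "(e, s) # l"] be pc pcc by simp
    ultimately show ?thesis using xl cs by simp
  qed
qed

text \<open>The relation \<open>t_e c = psi_e(c) t_e\<close> on normal forms: multiplying by
  \<open>c\<close> changes the \<open>C e\<close> part of the first coordinate but not its
  representative.\<close>

lemma actT_actK:
  assumes e: "e \<in> E" and c: "c \<in> C e" and w: "w \<in> W"
  shows "actT e (actK c w) = actK (\<psi> e c) (actT e w)"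
proof -
  obtain x l where xl: "w = (x, l)" "x \<in> carrier K" "normal l" using w by (auto simp: W_def)
  obtain d s where ds: "d \<in> C e" "s \<in> carrier K" "rep e s = s" "x = d \<otimes> s"
    using decompose[OF e xl(2)] by blast
  have car: "c \<in> carrier K" "d \<in> carrier K" using C_carrier e c ds by auto
  have cd: "c \<otimes> d \<in> C e" using C_mult e c ds by blast
  have "c \<otimes> x = (c \<otimes> d) \<otimes> s" using ds car by (simp add: K.m_assoc)
  moreover have "\<psi> e (c \<otimes> d) = \<psi> e c \<otimes> \<psi> e d" using psi_mult e c ds by blast
  moreover have "\<psi> e c \<in> carrier K" "\<psi> e d \<in> carrier K" using psi_carrier e c ds by auto
  moreover have "snd (hd l) \<in> carrier K" if "l \<noteq> []" using xl(3) that by (cases l) auto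
  ultimately show ?thesis
    using actT_decomposed[OF e cd ds(2,3), of l] actT_decomposed[OF e ds(1-3), of l] xl(1) ds(4)
    by (auto simp: actK_def K.m_assoc)
qed

definition actL :: "('e \<times> 'a) list \<Rightarrow> 'a \<times> ('e \<times> 'a) list \<Rightarrow> 'a \<times> ('e \<times> 'a) list" where
  "actL p w = foldr (\<lambda>(e, g) w. actT e (actK g w)) p w"

lemma actL_simps [simp]: "actL [] w = w" "actL ((e, g) # p) w = actT e (actK g (actL p w))"
  by (simp_all add: actL_def)

lemma actL_append: "actL (p @ q) w = actL p (actL q w)"
  by (simp add: actL_def)

text \<open>Britton-reduced words, with arbitrary group elements where \<open>normal\<close> has
  coset representatives; the last clause excludes pinches \<open>t_e c t_e^-1\<close> with
  \<open>c\<close> in \<open>C e\<close>.\<close>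

fun reduced :: "('e \<times> 'a) list \<Rightarrow> bool" where
  "reduced [] \<longleftrightarrow> True"
| "reduced ((e, g) # p) \<longleftrightarrow> e \<in> E \<and> g \<in> carrier K \<and> reduced p \<and>
     (p \<noteq> [] \<longrightarrow> g \<in> C e \<longrightarrow> fst (hd p) \<noteq> bar e)"

lemma reduced_letters: "reduced p \<Longrightarrow> (e, g) \<in> set p \<Longrightarrow> e \<in> E \<and> g \<in> carrier K"
  by (induction p rule: reduced.induct) auto

lemma actL_W: "reduced p \<Longrightarrow> w \<in> W \<Longrightarrow> actL p w \<in> W"
  by (induction p rule: reduced.induct) (auto intro: actT_W actK_W)

lemma base_W: "(\<one>, []) \<in> W" by (simp add: W_def)

text \<open>The invariant is that the first coordinate stays in \<open>C (bar e)\<close> for the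
  leading letter \<open>e\<close>. If the next letter cancelled, its slot \<open>g\<close> times an
  element of \<open>C e\<close> would lie in \<open>C e\<close>, hence \<open>g\<close> as well,
  against reducedness; so every letter survives.\<close>

lemma britton:
  assumes "reduced p" "p \<noteq> []"
  shows "\<exists>c l. actL p (\<one>, []) = (c, l) \<and> c \<in> C (bar (fst (hd p))) \<and> length l = length p \<and>
    fst (hd l) = fst (hd p)"
  using assms
proof (induction p rule: reduced.induct)
  case (2 e g q)
  then have e: "e \<in> E" and g: "g \<in> carrier K" by auto
  obtain x l where xl: "actK g (actL q (\<one>, [])) = (x, l)" by force
  have "(x, l) \<in> W" unfolding xl[symmetric] using 2 g base_W by (intro actK_W actL_W) auto
  then have x: "x \<in> carrier K" by (simp add: W_def)
  have len: "length l = length q" and nc: "\<not> (rep e x = \<one> \<and> l \<noteq> [] \<and> fst (hd l) = bar e)"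
  proof -
    show "length l = length q"
      using 2 xl by (cases "q = []") (auto simp: actK_def)
    show "\<not> (rep e x = \<one> \<and> l \<noteq> [] \<and> fst (hd l) = bar e)"
    proof
      assume cancel: "rep e x = \<one> \<and> l \<noteq> [] \<and> fst (hd l) = bar e"
      have q: "q \<noteq> []"
      proof
        assume "q = []"
        then have "l = []" using xl by (simp add: actK_def)
        then show False using cancel by simp
      qed
      then obtain c where c: "actL q (\<one>, []) = (c, l)" "c \<in> C (bar (fst (hd q)))" "fst (hd l) = fst (hd q)"
        using 2 xl by (auto simp: actK_def)
      have "fst (hd q) = bar e" using c(3) cancel by simp
      then have cC: "c \<in> C e" using c(2) bar_bar[OF e] by simp
      have xgc: "x = g \<otimes> c" using xl c by (simp add: actK_def)
      have "x \<in> C e" using cancel rep_eq_one_iff[OF e x] by blast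
      then have "x \<otimes> inv c \<in> C e" using cC e C_mult C_inv by blast
      then have "g \<in> C e" using xgc g C_carrier[OF e cC] by simp
      then show False using 2(2) q c cancel by auto
    qed
  qed
  have "actL ((e, g) # q) (\<one>, []) = (\<psi> e (cp e x), (e, rep e x) # l)"
    using nc by (auto simp: xl actT_def)
  moreover have "cp e x \<in> C e"
    using decompose[OF e x] cp_rep[OF e] by metis
  then have "\<psi> e (cp e x) \<in> C (bar e)" using psi_closed[OF e] by blast
  ultimately show ?case using len by simp
qed simp

lemma reduced_append:
  "reduced p \<Longrightarrow> reduced q \<Longrightarrow> p \<noteq> [] \<Longrightarrow> q \<noteq> [] \<Longrightarrow> fst (hd q) \<noteq> bar (fst (last p)) \<Longrightarrow> reduced (p @ q)"
  by (induction p rule: reduced.induct) (auto split: if_splits)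

lemma reduced_last_mult:
  "reduced (p @ [(e, g)]) \<Longrightarrow> h \<in> carrier K \<Longrightarrow> reduced (p @ [(e, g \<otimes> h)])"
proof (induction p rule: reduced.induct)
  case (2 e' g' q)
  then show ?case by (cases q) auto
qed auto

end

text \<open>The acting group is left abstract so that HNN extensions and amalgams, whose elements
  correspond to different words in the stable letters, share the length arguments.\<close>

locale hnn_action = hnn_system K E bar C \<psi> + D: group D
  for K (structure) and E :: "'e set" and bar C \<psi> and D :: "('d, 'n) monoid_scheme" +
  fixes Act :: "'d \<Rightarrow> 'a \<times> ('e \<times> 'a) list \<Rightarrow> 'a \<times> ('e \<times> 'a) list"
  assumes Act_closed: "x \<in> carrier D \<Longrightarrow> w \<in> W \<Longrightarrow> Act x w \<in> W"
    and Act_mult: "x \<in> carrier D \<Longrightarrow> y \<in> carrier D \<Longrightarrow> w \<in> W \<Longrightarrow> Act (x \<otimes>\<^bsub>D\<^esub> y) w = Act x (Act y w)"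
begin

text \<open>Reducedness is expressed through the action because in an amalgam the stable letters are
  not elements of \<open>D\<close>. The end letters \<open>e\<close> and \<open>e'\<close> decide
  which products are free of cancellation.\<close>

definition redn :: "'d \<Rightarrow> 'e \<Rightarrow> 'e \<Rightarrow> nat \<Rightarrow> bool" where
  "redn x e e' n \<longleftrightarrow> x \<in> carrier D \<and> (\<exists>g p. g \<in> carrier K \<and> reduced p \<and> p \<noteq> [] \<and> fst (hd p) = e \<and>
     fst (last p) = e' \<and> length p = n \<and> (\<forall>w\<in>W. Act x w = actK g (actL p w)))"

lemma rednI:
  assumes "x \<in> carrier D" "g \<in> carrier K" "reduced p" "p \<noteq> []" "\<And>w. w \<in> W \<Longrightarrow> Act x w = actK g (actL p w)"
  shows "redn x (fst (hd p)) (fst (last p)) (length p)"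
  using assms unfolding redn_def by blast

lemma redn_length: "redn x e e' n \<Longrightarrow> length (snd (Act x (\<one>, []))) = n"
proof -
  assume "redn x e e' n"
  then obtain g p where gp: "reduced p" "p \<noteq> []" "length p = n" "Act x (\<one>, []) = actK g (actL p (\<one>, []))"
    using base_W unfolding redn_def by blast
  obtain c l where "actL p (\<one>, []) = (c, l)" "length l = length p"
    using britton[OF gp(1,2)] by blast
  then show ?thesis using gp by (simp add: actK_def)
qed

lemma redn_pos: "redn x e e' n \<Longrightarrow> n > 0"
  by (auto simp: redn_def)

text \<open>The leading group element of \<open>y\<close> is absorbed into the last slot of
  \<open>x\<close>; as \<open>f\<close> is not the inverse letter of \<open>e'\<close>, no pinch
  arises there whatever the slot then contains.\<close>

lemma redn_mult:
  assumes x: "redn x e e' n" and y: "redn y f f' m" and ne: "f \<noteq> bar e'"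
  shows "redn (x \<otimes>\<^bsub>D\<^esub> y) e f' (n + m)"
proof -
  obtain g p where g: "x \<in> carrier D" "g \<in> carrier K" "reduced p" "p \<noteq> []" "fst (hd p) = e" "fst (last p) = e'"
    "length p = n" "\<And>w. w \<in> W \<Longrightarrow> Act x w = actK g (actL p w)" using x unfolding redn_def by blast
  obtain h q where h: "y \<in> carrier D" "h \<in> carrier K" "reduced q" "q \<noteq> []" "fst (hd q) = f" "fst (last q) = f'"
    "length q = m" "\<And>w. w \<in> W \<Longrightarrow> Act y w = actK h (actL q w)" using y unfolding redn_def by blast
  obtain p' k where p: "p = p' @ [(e', k)]" using g(4,6) by (metis append_butlast_last_id prod.collapse)
  have k: "k \<in> carrier K" using reduced_letters[OF g(3)] p by auto
  let ?p = "p' @ [(e', k \<otimes> h)]"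
  have rp: "reduced ?p" using reduced_last_mult g(3) h(2) p by blast
  have r: "reduced (?p @ q)" using reduced_append[OF rp h(3) _ h(4)] ne h(5) by simp
  have "Act (x \<otimes>\<^bsub>D\<^esub> y) w = actK g (actL (?p @ q) w)" if w: "w \<in> W" for w
  proof -
    have qw: "actL q w \<in> W" using actL_W[OF h(3) w] .
    have "Act (x \<otimes>\<^bsub>D\<^esub> y) w = actK g (actL p (actK h (actL q w)))"
      using Act_mult[OF g(1) h(1) w] g(8) h(8)[OF w] actK_W[OF h(2) qw] by simp
    also have "\<dots> = actK g (actL (?p @ q) w)"
      using actK_mult[OF k h(2) qw] by (simp add: p actL_append)
    finally show ?thesis .
  qed
  then have "redn (x \<otimes>\<^bsub>D\<^esub> y) (fst (hd (?p @ q))) (fst (last (?p @ q))) (length (?p @ q))"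
    using r g h by (intro rednI) auto
  moreover have "fst (hd (?p @ q)) = e" using g(5) p by (cases p') auto
  moreover have "fst (last (?p @ q)) = f'" using h(4,6) by simp
  moreover have "length (?p @ q) = n + m" using g(7) h(7) p by simp
  ultimately show ?thesis by simp
qed

text \<open>A cyclically reduced element has infinite order; any other can be conjugated to arbitrarily long
  reduced words.\<close>

lemma redn_not_FC_torsion:
  assumes x: "redn x e e' n" and e: "e = bar e' \<Longrightarrow> e \<in> Q" "e' \<in> E" and QE: "Q \<subseteq> E"
    and ext: "\<And>e. e \<in> Q \<Longrightarrow> \<exists>y f l l' m m'. f \<in> Q \<and> redn y f l m \<and> redn (inv\<^bsub>D\<^esub> y) l' (bar f) m' \<and>
      e \<noteq> bar l \<and> l' \<noteq> e"
  shows "x \<notin> FC_torsion D"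
proof
  assume FC: "x \<in> FC_torsion D"
  have xc: "x \<in> carrier D" using x by (simp add: redn_def)
  show False
  proof (cases "e = bar e'")
    case False
    have pow: "redn (x [^]\<^bsub>D\<^esub> Suc k) e e' (Suc k * n)" for k
    proof (induction k)
      case 0
      then show ?case using x xc by simp
    next
      case (Suc k)
      have "redn (x [^]\<^bsub>D\<^esub> Suc k \<otimes>\<^bsub>D\<^esub> x) e e' (Suc k * n + n)" using redn_mult[OF Suc x False] .
      then show ?case by (simp add: algebra_simps)
    qed
    obtain m :: nat where m: "m > 0" "x [^]\<^bsub>D\<^esub> m = \<one>\<^bsub>D\<^esub>"
      using FC by (auto simp: FC_torsion_def torsion_elt_def)
    then have "x [^]\<^bsub>D\<^esub> Suc m = x" using xc by simp
    then have "Suc m * n = n" using redn_length[OF pow[of m]] redn_length[OF x] by simp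
    then show False using m redn_pos[OF x] by simp
  next
    case True
    \<comment> \<open>Each conjugation by a \<open>y\<close> from \<open>ext\<close> lengthens the
      word and again produces one from \<open>f\<close> to \<open>bar f\<close> with
      \<open>f\<close> in \<open>Q\<close>, so it can be repeated. Lengths then exceed the bound
      that a finite conjugacy class would impose.\<close>
    have long: "\<exists>x' f n'. conj_in D x x' \<and> redn x' f (bar f) n' \<and> n' \<ge> N \<and> f \<in> Q" for N
    proof (induction N)
      case 0
      have "conj_in D x x" using xc by (auto simp: conj_in_def intro!: bexI[of _ "\<one>\<^bsub>D\<^esub>"])
      moreover have "e' = bar e" using True bar_bar e by simp
      ultimately show ?case using x e True by blast
    next
      case (Suc N)
      then obtain x' f n' where x': "conj_in D x x'" "redn x' f (bar f) n'" "n' \<ge> N" "f \<in> Q" by blast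
      obtain y f' l l' m m' where y: "f' \<in> Q" "redn y f' l m" "redn (inv\<^bsub>D\<^esub> y) l' (bar f') m'"
        "f \<noteq> bar l" "l' \<noteq> f" using ext[OF x'(4)] by blast
      have yc: "y \<in> carrier D" using y(2) by (simp add: redn_def)
      have ne: "l' \<noteq> bar (bar f)" using y(5) bar_bar x'(4) QE by auto
      have "redn (y \<otimes>\<^bsub>D\<^esub> x' \<otimes>\<^bsub>D\<^esub> inv\<^bsub>D\<^esub> y) f' (bar f') (m + n' + m')"
        using redn_mult[OF redn_mult[OF y(2) x'(2) y(4)] y(3) ne] .
      moreover have "conj_in D x (y \<otimes>\<^bsub>D\<^esub> x' \<otimes>\<^bsub>D\<^esub> inv\<^bsub>D\<^esub> y)"
        using D.conj_in_trans[OF x'(1) D.conj_inI[OF yc] xc] .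
      moreover have "m + n' + m' \<ge> Suc N" using x'(3) redn_pos[OF y(2)] by simp
      ultimately show ?case using y(1) by blast
    qed
    have "finite ((\<lambda>x'. length (snd (Act x' (\<one>, [])))) ` {x'. conj_in D x x'})"
      using FC by (intro finite_imageI) (auto simp: FC_torsion_def FC_subgroup_def)
    then obtain N where N: "\<And>x'. conj_in D x x' \<Longrightarrow> length (snd (Act x' (\<one>, []))) \<le> N"
      by (meson Max_ge image_eqI mem_Collect_eq)
    obtain x' f n' where "conj_in D x x'" "redn x' f (bar f) n'" "n' \<ge> Suc N" using long by blast
    then show False using N redn_length by fastforce
  qed
qed

end

text \<open>Injectivity on \<open>A\<close> preserves the order of \<open>x\<close>, hence the set
  of exponents to be tested, and conjugacies in \<open>G\<close> map to conjugacies in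
  \<open>D\<close>.\<close>

lemma RS_element_hom:
  assumes G: "group G" and D: "group D" and \<iota>: "\<iota> \<in> hom G D" and A: "RS_subgroup A G" and x: "x \<in> A"
    and inj: "\<And>a. a \<in> A \<Longrightarrow> \<iota> a = \<one>\<^bsub>D\<^esub> \<Longrightarrow> a = \<one>\<^bsub>G\<^esub>" and tor: "torsion_elt D (\<iota> x)"
  shows "RS_element D (\<iota> x)"
proof -
  interpret h: group_hom G D \<iota> by (intro group_hom.intro group_hom_axioms.intro G D \<iota>)
  have sub: "subgroup A G" using A by (simp add: RS_subgroup_def)
  have xc: "x \<in> carrier G" using subgroup.mem_carrier[OF sub x] .
  have powA: "x [^]\<^bsub>G\<^esub> (n::nat) \<in> A" for n
    by (induction n) (auto simp: x subgroup.one_closed[OF sub] subgroup.m_closed[OF sub])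
  have pow: "\<iota> x [^]\<^bsub>D\<^esub> (n::nat) = \<one>\<^bsub>D\<^esub> \<longleftrightarrow> x [^]\<^bsub>G\<^esub> n = \<one>\<^bsub>G\<^esub>" for n
    using h.hom_nat_pow[OF xc, of n] inj[OF powA[of n]] h.hom_one by metis
  have "torsion_elt G x" using tor pow by (simp add: torsion_elt_def)
  then have RS: "RS_element G x" using A x by (simp add: RS_subgroup_def)
  have dvd: "group.ord D (\<iota> x) dvd n \<longleftrightarrow> group.ord G x dvd n" for n
    using pow[of n] group.pow_eq_id[OF D h.hom_closed[OF xc], of n] group.pow_eq_id[OF G xc, of n] by simp
  have ord: "group.ord D (\<iota> x) = group.ord G x"
    using dvd[of "group.ord D (\<iota> x)"] dvd[of "group.ord G x"] by (simp add: dvd_antisym)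
  have conj: "conj_in D (\<iota> y) (\<iota> z)" if yz: "conj_in G y z" "y \<in> carrier G" for y z
  proof -
    obtain g where g: "g \<in> carrier G" "z = g \<otimes>\<^bsub>G\<^esub> y \<otimes>\<^bsub>G\<^esub> inv\<^bsub>G\<^esub> g"
      using yz(1) unfolding conj_in_def by blast
    have "\<iota> z = \<iota> g \<otimes>\<^bsub>D\<^esub> \<iota> y \<otimes>\<^bsub>D\<^esub> inv\<^bsub>D\<^esub> (\<iota> g)"
      using g yz(2) by simp
    then show ?thesis using h.hom_closed[OF g(1)] unfolding conj_in_def by blast
  qed
  show ?thesis
    unfolding RS_element_def ord
  proof (intro conjI ballI)
    show "\<iota> x \<in> carrier D" using xc by simp
    show "torsion_elt D (\<iota> x)" by (rule tor)
    fix j assume "j \<in> totatives (group.ord G x)"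
    then have "conj_in G (x [^]\<^bsub>G\<^esub> j) x \<or> conj_in G (x [^]\<^bsub>G\<^esub> j) (inv\<^bsub>G\<^esub> x)"
      using RS unfolding RS_element_def by blast
    then have "conj_in D (\<iota> (x [^]\<^bsub>G\<^esub> j)) (\<iota> x) \<or> conj_in D (\<iota> (x [^]\<^bsub>G\<^esub> j)) (\<iota> (inv\<^bsub>G\<^esub> x))"
      using conj[of "x [^]\<^bsub>G\<^esub> j"] monoid.nat_pow_closed[OF group.is_monoid[OF G] xc] by blast
    then show "conj_in D (\<iota> x [^]\<^bsub>D\<^esub> j) (\<iota> x) \<or> conj_in D (\<iota> x [^]\<^bsub>D\<^esub> j) (inv\<^bsub>D\<^esub> (\<iota> x))"
      using h.hom_nat_pow[OF xc, of j] xc by simp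
  qed
qed

section \<open>HNN extensions with one stable letter\<close>

locale hnn_extension_data = group G for G (structure) +
  fixes A B :: "'a set" and \<phi> :: "'a \<Rightarrow> 'a"
  assumes A: "subgroup A G" and B: "subgroup B G"
    and \<phi>: "\<phi> \<in> iso (G\<lparr>carrier := A\<rparr>) (G\<lparr>carrier := B\<rparr>)"
begin

text \<open>\<open>True\<close> stands for the stable letter \<open>t\<close> and
  \<open>False\<close> for its inverse, as in words. The relation \<open>t^-1 a t = \<phi> a\<close>
  reads \<open>t^-1 a = \<phi>(a) t^-1\<close>, so \<open>A\<close> and \<open>\<phi>\<close> belong
  to \<open>False\<close>, and \<open>B\<close> with the inverse map to \<open>True\<close>.\<close>

definition C :: "bool \<Rightarrow> 'a set" where "C e = (if e then B else A)"
definition psi :: "bool \<Rightarrow> 'a \<Rightarrow> 'a" where "psi e = (if e then inv_into A \<phi> else \<phi>)"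

lemma phi_bij: "bij_betw \<phi> A B" using \<phi> by (simp add: iso_def)

lemma phi_mult: "a \<in> A \<Longrightarrow> b \<in> A \<Longrightarrow> \<phi> (a \<otimes> b) = \<phi> a \<otimes> \<phi> b"
  using \<phi> by (simp add: iso_def hom_def)

lemma phi_B: "a \<in> A \<Longrightarrow> \<phi> a \<in> B" using phi_bij by (auto simp: bij_betw_def)

lemma phi_inv:
  "b \<in> B \<Longrightarrow> inv_into A \<phi> b \<in> A" "b \<in> B \<Longrightarrow> \<phi> (inv_into A \<phi> b) = b" "a \<in> A \<Longrightarrow> inv_into A \<phi> (\<phi> a) = a"
  using phi_bij by (auto simp: bij_betw_def inv_into_into f_inv_into_f)

sublocale hnn_system G UNIV Not C psi
proof (intro hnn_system.intro hnn_system_axioms.intro is_group)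
  fix e c c'
  show "subgroup (C e) G" using A B by (simp add: C_def)
  assume c: "c \<in> C e"
  show "psi e c \<in> C (\<not> e)" using c phi_inv phi_B by (auto simp: C_def psi_def)
  show "psi (\<not> e) (psi e c) = c" using c phi_inv by (auto simp: C_def psi_def)
  assume c': "c' \<in> C e"
  show "psi e (c \<otimes> c') = psi e c \<otimes> psi e c'"
  proof (cases e)
    case True
    then have "\<phi> (psi e c \<otimes> psi e c') = c \<otimes> c'" "psi e c \<otimes> psi e c' \<in> A"
      using c c' phi_inv phi_mult subgroup.m_closed[OF A] by (auto simp: C_def psi_def)
    then show ?thesis using True phi_inv(3) by (metis psi_def)
  qed (use c c' phi_mult in \<open>simp add: C_def psi_def\<close>)
qed auto

definition S :: "'a option set" where "S = insert None (Some ` carrier G)"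

lemma S_iff [simp]: "None \<in> S" "Some g \<in> S \<longleftrightarrow> g \<in> carrier G"
  by (auto simp: S_def)

definition R :: "('a option word \<times> 'a option word) set" where
  "R = mult_table Some G \<union>
    {([(None, False), (Some a, True), (None, True)], [(Some (\<phi> a), True)]) |a. a \<in> A}"

abbreviation "D \<equiv> presented_group S R"

lemma HNN_extension_eq: "HNN_extension G A \<phi> = D"
  by (simp add: HNN_extension_def S_def R_def)

sublocale D: group D by (rule group_presented_group)

definition letter :: "'a option \<times> bool \<Rightarrow> 'a \<times> (bool \<times> 'a) list \<Rightarrow> 'a \<times> (bool \<times> 'a) list" where
  "letter = (\<lambda>(s, b). case s of None \<Rightarrow> actT b | Some g \<Rightarrow> actK (if b then g else inv g))"

lemma letter_W:
  assumes "s \<in> S" "w \<in> W"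
  shows "letter (s, b) w \<in> W"
proof (cases s)
  case None
  then show ?thesis using actT_W[OF UNIV_I assms(2)] by (simp add: letter_def)
next
  case (Some g)
  then show ?thesis using actK_W[OF _ assms(2), of "if b then g else inv g"] assms(1) by (simp add: letter_def)
qed

lemma letter_cancel: "s \<in> S \<Longrightarrow> w \<in> W \<Longrightarrow> letter (s, b) (letter (s, \<not> b) w) = w"
  using actT_bar[of "\<not> b" w] by (auto simp: S_def letter_def actK_mult[symmetric] actK_one)

lemma letter_rel:
  assumes "(u, v) \<in> R" "w \<in> W"
  shows "foldr letter u w = foldr letter v w"
proof -
  consider (mult) x y where "x \<in> carrier G" "y \<in> carrier G" "u = [(Some x, True), (Some y, True)]" "v = [(Some (x \<otimes> y), True)]"
    | (conj) a where "a \<in> A" "u = [(None, False), (Some a, True), (None, True)]" "v = [(Some (\<phi> a), True)]"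
    using assms(1) by (auto simp: R_def mult_table_def)
  then show ?thesis
  proof cases
    case mult
    then show ?thesis using actK_mult[OF mult(1,2) assms(2)] by (simp add: letter_def)
  next
    case conj
    have tw: "actT True w \<in> W" using actT_W assms(2) by simp
    have "actT False (actK a (actT True w)) = actK (\<phi> a) (actT False (actT True w))"
      using actT_actK[of False a "actT True w"] conj(1) tw by (simp add: C_def psi_def)
    then show ?thesis using actT_bar[of True w] assms(2) conj by (simp add: letter_def)
  qed
qed

definition Act :: "'a option word set \<Rightarrow> 'a \<times> (bool \<times> 'a) list \<Rightarrow> 'a \<times> (bool \<times> 'a) list" where
  "Act = word_act letter"

lemma Act_class: "u \<in> words S \<Longrightarrow> w \<in> W \<Longrightarrow> Act (word_class S R u) w = foldr letter u w"
  unfolding Act_def by (rule word_act_class[of S W]) (auto intro: letter_W letter_cancel letter_rel)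

lemma foldr_letter_W: "u \<in> words S \<Longrightarrow> w \<in> W \<Longrightarrow> foldr letter u w \<in> W"
  by (induction u) (auto intro: letter_W)

sublocale hnn_action G UNIV Not C psi D Act
proof
  fix x w assume "x \<in> carrier D" and w: "w \<in> W"
  then obtain u where u: "u \<in> words S" "x = word_class S R u" by (auto simp: presented_group_carrier)
  show "Act x w \<in> W" using Act_class[OF u(1) w] foldr_letter_W[OF u(1) w] u by simp
  fix y assume "y \<in> carrier D"
  then obtain v where v: "v \<in> words S" "y = word_class S R v" by (auto simp: presented_group_carrier)
  show "Act (x \<otimes>\<^bsub>D\<^esub> y) w = Act x (Act y w)"
    using u v w foldr_letter_W[OF v(1) w] by (simp add: presented_group_mult Act_class)
qed

definition \<iota> :: "'a \<Rightarrow> 'a option word set" where "\<iota> g = word_class S R [(Some g, True)]"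
definition t :: "bool \<Rightarrow> 'a option word set" where "t b = word_class S R [(None, b)]"

lemma iota_closed: "g \<in> carrier G \<Longrightarrow> \<iota> g \<in> carrier D"
  by (auto simp: \<iota>_def presented_group_carrier)

lemma t_closed: "t b \<in> carrier D"
  by (auto simp: t_def presented_group_carrier)

lemma iota_mult:
  assumes "g \<in> carrier G" "h \<in> carrier G"
  shows "\<iota> (g \<otimes> h) = \<iota> g \<otimes>\<^bsub>D\<^esub> \<iota> h"
proof -
  have eq: "word_eq S R [(Some g, True), (Some h, True)] [(Some (g \<otimes> h), True)]"
    using assms by (intro word_eq.rel) (auto simp: R_def mult_table_def)
  show ?thesis using assms by (simp add: \<iota>_def presented_group_mult word_class_eqI[OF eq])
qed

lemma iota_hom: "\<iota> \<in> hom G D"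
  by (auto simp: hom_def iota_closed iota_mult)

sublocale iota: group_hom G D \<iota>
  by unfold_locales (rule iota_hom)

lemma t_t: "t b \<otimes>\<^bsub>D\<^esub> t (\<not> b) = \<one>\<^bsub>D\<^esub>"
  using word_class_eqI[OF word_eq.cancel[of None S R b]]
  by (simp add: t_def presented_group_mult presented_group_one)

lemma inv_t: "inv\<^bsub>D\<^esub> (t b) = t (\<not> b)"
  using t_t[of "\<not> b"] t_closed by (intro D.inv_equality) auto

lemma t_relation:
  assumes "a \<in> A"
  shows "t False \<otimes>\<^bsub>D\<^esub> \<iota> a \<otimes>\<^bsub>D\<^esub> t True = \<iota> (\<phi> a)"
proof -
  have c: "a \<in> carrier G" "\<phi> a \<in> carrier G"
    using subgroup.mem_carrier[OF A assms] subgroup.mem_carrier[OF B phi_B[OF assms]] by auto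
  then have "word_eq S R [(None, False), (Some a, True), (None, True)] [(Some (\<phi> a), True)]"
    using assms by (intro word_eq.rel) (auto simp: R_def)
  then show ?thesis
    using word_class_eqI c by (simp add: t_def \<iota>_def presented_group_mult)
qed

lemma t_iota:
  assumes c: "c \<in> C e"
  shows "t e \<otimes>\<^bsub>D\<^esub> \<iota> c = \<iota> (psi e c) \<otimes>\<^bsub>D\<^esub> t e"
proof (cases e)
  case False
  then have cA: "c \<in> A" using c by (simp add: C_def)
  have ic: "\<iota> c \<in> carrier D" using iota_closed subgroup.mem_carrier[OF A cA] by blast
  have "\<iota> (\<phi> c) \<otimes>\<^bsub>D\<^esub> t False = t False \<otimes>\<^bsub>D\<^esub> \<iota> c \<otimes>\<^bsub>D\<^esub> (t True \<otimes>\<^bsub>D\<^esub> t False)"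
    unfolding t_relation[OF cA, symmetric] using t_closed ic by (simp add: D.m_assoc)
  then show ?thesis using t_t[of True] t_closed ic False by (simp add: psi_def)
next
  case True
  then have cB: "c \<in> B" using c by (simp add: C_def)
  let ?a = "inv_into A \<phi> c"
  have a: "?a \<in> A" "\<phi> ?a = c" using phi_inv cB by auto
  have ia: "\<iota> ?a \<in> carrier D" using iota_closed subgroup.mem_carrier[OF A a(1)] by blast
  have "t True \<otimes>\<^bsub>D\<^esub> \<iota> c = t True \<otimes>\<^bsub>D\<^esub> (t False \<otimes>\<^bsub>D\<^esub> \<iota> ?a \<otimes>\<^bsub>D\<^esub> t True)"
    using t_relation[OF a(1)] a(2) by simp
  also have "\<dots> = (t True \<otimes>\<^bsub>D\<^esub> t False) \<otimes>\<^bsub>D\<^esub> (\<iota> ?a \<otimes>\<^bsub>D\<^esub> t True)"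
    using t_closed ia by (simp add: D.m_assoc)
  also have "\<dots> = \<iota> ?a \<otimes>\<^bsub>D\<^esub> t True" using t_t[of True] t_closed ia by simp
  finally show ?thesis using True by (simp add: psi_def)
qed

definition delt :: "(bool \<times> 'a) list \<Rightarrow> 'a option word set" where
  "delt p = foldr (\<lambda>(e, g) x. t e \<otimes>\<^bsub>D\<^esub> (\<iota> g \<otimes>\<^bsub>D\<^esub> x)) p \<one>\<^bsub>D\<^esub>"

lemma delt_simps [simp]: "delt [] = \<one>\<^bsub>D\<^esub>" "delt ((e, g) # p) = t e \<otimes>\<^bsub>D\<^esub> (\<iota> g \<otimes>\<^bsub>D\<^esub> delt p)"
  by (simp_all add: delt_def)

lemma delt_closed: "reduced p \<Longrightarrow> delt p \<in> carrier D"
  by (induction p rule: reduced.induct) (auto simp: t_closed iota_closed)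

lemma Act_iota: "g \<in> carrier G \<Longrightarrow> w \<in> W \<Longrightarrow> Act (\<iota> g) w = actK g w"
  by (simp add: \<iota>_def Act_class letter_def)

lemma Act_t: "w \<in> W \<Longrightarrow> Act (t e) w = actT e w"
  by (simp add: t_def Act_class letter_def)

lemma Act_one: "w \<in> W \<Longrightarrow> Act \<one>\<^bsub>D\<^esub> w = w"
  by (simp add: presented_group_one Act_class)

lemma Act_delt: "reduced p \<Longrightarrow> w \<in> W \<Longrightarrow> Act (delt p) w = actL p w"
proof (induction p rule: reduced.induct)
  case (2 e g p)
  then show ?case
    using actL_W[of p w] by (simp add: Act_mult t_closed iota_closed delt_closed Act_iota Act_t actK_W)
qed (simp add: Act_one)

text \<open>If \<open>t_e\<close> meets its inverse across an element of \<open>C e\<close>, the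
  relation moves that element to the left and the letters cancel; otherwise the word grows by one
  letter.\<close>

lemma t_mult_delt:
  assumes g: "g \<in> carrier G" and p: "reduced p"
  shows "\<exists>g' p'. g' \<in> carrier G \<and> reduced p' \<and> t e \<otimes>\<^bsub>D\<^esub> (\<iota> g \<otimes>\<^bsub>D\<^esub> delt p) = \<iota> g' \<otimes>\<^bsub>D\<^esub> delt p'"
proof (cases "p \<noteq> [] \<and> g \<in> C e \<and> fst (hd p) = (\<not> e)")
  case False
  then have "reduced ((e, g) # p)" using g p by auto
  moreover have "t e \<otimes>\<^bsub>D\<^esub> (\<iota> g \<otimes>\<^bsub>D\<^esub> delt p) = \<iota> \<one> \<otimes>\<^bsub>D\<^esub> delt ((e, g) # p)"
    using delt_closed[OF p] t_closed iota_closed[OF g] by (simp add: iota.hom_one)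
  ultimately show ?thesis by blast
next
  case True
  then obtain h q where q: "p = (\<not> e, h) # q" by (cases p) auto
  have h: "h \<in> carrier G" "reduced q" using p q by auto
  have gc: "psi e g \<in> carrier G" using psi_carrier True by blast
  note cl = t_closed iota_closed[OF g] iota_closed[OF h(1)] iota_closed[OF gc] delt_closed[OF h(2)]
  have "t e \<otimes>\<^bsub>D\<^esub> (\<iota> g \<otimes>\<^bsub>D\<^esub> delt p) = (t e \<otimes>\<^bsub>D\<^esub> \<iota> g) \<otimes>\<^bsub>D\<^esub> (t (\<not> e) \<otimes>\<^bsub>D\<^esub> (\<iota> h \<otimes>\<^bsub>D\<^esub> delt q))"
    using cl by (simp add: q D.m_assoc)
  also have "t e \<otimes>\<^bsub>D\<^esub> \<iota> g = \<iota> (psi e g) \<otimes>\<^bsub>D\<^esub> t e" using t_iota True by blast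
  also have "\<iota> (psi e g) \<otimes>\<^bsub>D\<^esub> t e \<otimes>\<^bsub>D\<^esub> (t (\<not> e) \<otimes>\<^bsub>D\<^esub> (\<iota> h \<otimes>\<^bsub>D\<^esub> delt q))
      = \<iota> (psi e g) \<otimes>\<^bsub>D\<^esub> ((t e \<otimes>\<^bsub>D\<^esub> t (\<not> e)) \<otimes>\<^bsub>D\<^esub> (\<iota> h \<otimes>\<^bsub>D\<^esub> delt q))"
    using cl by (simp only: D.m_assoc D.m_closed)
  also have "\<dots> = \<iota> (psi e g \<otimes> h) \<otimes>\<^bsub>D\<^esub> delt q"
    using cl by (simp add: t_t iota_mult[OF gc h(1)] D.m_assoc)
  finally show ?thesis using gc h by blast
qed

lemma reduced_form:
  assumes "x \<in> carrier D"
  shows "\<exists>g p. g \<in> carrier G \<and> reduced p \<and> x = \<iota> g \<otimes>\<^bsub>D\<^esub> delt p"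
proof -
  obtain u where u: "u \<in> words S" "x = word_class S R u" using assms by (auto simp: presented_group_carrier)
  have "\<exists>g p. g \<in> carrier G \<and> reduced p \<and> word_class S R u = \<iota> g \<otimes>\<^bsub>D\<^esub> delt p"
    using u(1)
  proof (induction u)
    case Nil
    show ?case by (intro exI[of _ \<one>] exI[of _ "[]"]) (simp add: iota.hom_one presented_group_one[symmetric])
  next
    case (Cons a u)
    then obtain g p where gp: "g \<in> carrier G" "reduced p" "word_class S R u = \<iota> g \<otimes>\<^bsub>D\<^esub> delt p" by auto
    obtain s b where a: "a = (s, b)" by force
    have s: "s \<in> S" "u \<in> words S" using Cons.prems a by auto
    have split: "word_class S R (a # u) = word_class S R [a] \<otimes>\<^bsub>D\<^esub> (\<iota> g \<otimes>\<^bsub>D\<^esub> delt p)"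
      unfolding gp(3)[symmetric] using presented_group_mult[of "[a]" S u R] s a by simp
    show ?case
    proof (cases s)
      case None
      then have "word_class S R [a] = t b" by (simp add: a t_def)
      then show ?thesis using split t_mult_delt[OF gp(1,2)] by simp
    next
      case (Some k)
      then have k: "k \<in> carrier G" using s by (auto simp: S_def)
      have "word_class S R [a] = \<iota> (if b then k else inv k)"
      proof (cases b)
        case False
        have "word_class S R [(Some k, False)] \<otimes>\<^bsub>D\<^esub> \<iota> k = \<one>\<^bsub>D\<^esub>"
          using word_class_eqI[OF word_eq.cancel[of s S R False]] s Some
          by (simp add: \<iota>_def presented_group_mult presented_group_one)
        moreover have "word_class S R [(Some k, False)] \<in> carrier D"
          using s Some by (auto simp: presented_group_carrier)
        ultimately have "inv\<^bsub>D\<^esub> (\<iota> k) = word_class S R [(Some k, False)]"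
          using iota_closed[OF k] by (intro D.inv_equality) auto
        then show ?thesis using False k Some by (simp add: a iota.hom_inv)
      qed (simp add: a Some \<iota>_def)
      then have "word_class S R (a # u) = \<iota> ((if b then k else inv k) \<otimes> g) \<otimes>\<^bsub>D\<^esub> delt p"
        using split k gp iota_closed delt_closed by (simp add: iota_mult D.m_assoc)
      moreover have "(if b then k else inv k) \<otimes> g \<in> carrier G" using k gp by simp
      ultimately show ?thesis using gp(2) by blast
    qed
  qed
  then show ?thesis using u by blast
qed

text \<open>The conjugator \<open>t_e\<close> serves: it begins and ends with \<open>e\<close>, and
  its inverse with the opposite letter, so neither junction cancels.\<close>

lemma ext_condition:
  "\<exists>y f l l' m m'. f \<in> UNIV \<and> redn y f l m \<and> redn (inv\<^bsub>D\<^esub> y) l' (\<not> f) m' \<and> e \<noteq> (\<not> l) \<and> l' \<noteq> e"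
proof -
  have "redn (t b) b b 1" for b
    using rednI[of "t b" \<one> "[(b, \<one>)]"] t_closed actK_one actT_W by (simp add: Act_t)
  from this[of e] this[of "\<not> e"] show ?thesis unfolding inv_t[symmetric] by blast
qed

text \<open>A stable letter in the reduced form is excluded by \<open>redn_not_FC_torsion\<close>.
  Membership in both subgroups at once is what lets an RS hypothesis on either of them
  suffice.\<close>

lemma FC_torsion_subset:
  assumes x: "x \<in> FC_torsion D"
  shows "\<exists>g\<in>A \<inter> B. x = \<iota> g"
proof -
  have xc: "x \<in> carrier D" using subgroup.mem_carrier[OF D.subgroup_FC_torsion x] .
  have no_redn: "\<not> redn y e e' n" if "y \<in> FC_torsion D" for y e e' n
    using redn_not_FC_torsion[of y e e' n UNIV] ext_condition that by blast
  obtain g p where gp: "g \<in> carrier G" "reduced p" "x = \<iota> g \<otimes>\<^bsub>D\<^esub> delt p" using reduced_form[OF xc] by blast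
  have "p = []"
  proof (rule ccontr)
    assume "p \<noteq> []"
    then have "redn x (fst (hd p)) (fst (last p)) (length p)"
      using gp xc iota_closed delt_closed actL_W
      by (intro rednI[of x g p]) (auto simp: Act_mult Act_delt Act_iota)
    then show False using no_redn[OF x] by blast
  qed
  then have xg: "x = \<iota> g" using gp iota_closed by simp
  \<comment> \<open>For \<open>g\<close> outside \<open>C e\<close>, conjugation by
    \<open>t_e\<close> would give a reduced word with two letters, although the conjugate still lies
    in \<open>\<Phi>\<^sup>+\<close>.\<close>
  have "g \<in> C e" for e
  proof (rule ccontr)
    assume g: "g \<notin> C e"
    let ?y = "t e \<otimes>\<^bsub>D\<^esub> \<iota> g \<otimes>\<^bsub>D\<^esub> inv\<^bsub>D\<^esub> (t e)"
    have yc: "?y \<in> carrier D" using t_closed iota_closed gp by simp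
    have "Act ?y w = actK \<one> (actL [(e, g), (\<not> e, \<one>)] w)" if "w \<in> W" for w
      using that gp t_closed iota_closed actT_W actK_W
      by (simp add: inv_t Act_mult Act_t Act_iota actK_one)
    then have "redn ?y e (\<not> e) 2"
      using rednI[of ?y \<one> "[(e, g), (\<not> e, \<one>)]"] yc g gp(1) by (simp add: numeral_2_eq_2)
    moreover have "conj_in D x ?y" unfolding xg by (rule D.conj_inI[OF t_closed])
    then have "?y \<in> FC_torsion D"
      using x D.FC_subgroup_conj_closed D.torsion_elt_conj[OF xc] by (auto simp: FC_torsion_def)
    ultimately show False using no_redn by blast
  qed
  from this[of True] this[of False] show ?thesis using xg by (auto simp: C_def)
qed

lemma iota_inj: "g \<in> carrier G \<Longrightarrow> \<iota> g = \<one>\<^bsub>D\<^esub> \<Longrightarrow> g = \<one>"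
  using Act_iota[OF _ base_W, of g] Act_one[OF base_W] by (simp add: actK_def)

lemma FC_torsion_RS:
  assumes RS: "RS_subgroup A G \<or> RS_subgroup B G" and x: "x \<in> FC_torsion D"
  shows "RS_element D x"
proof -
  obtain g where g: "g \<in> A" "g \<in> B" "x = \<iota> g" using FC_torsion_subset[OF x] by blast
  have tor: "torsion_elt D (\<iota> g)" using x g by (simp add: FC_torsion_def)
  from RS show ?thesis
  proof
    assume "RS_subgroup A G"
    then show ?thesis
      using RS_element_hom[OF is_group D.is_group iota_hom _ g(1) _ tor] iota_inj subgroup.mem_carrier[OF A] g(3)
      by blast
  next
    assume "RS_subgroup B G"
    then show ?thesis
      using RS_element_hom[OF is_group D.is_group iota_hom _ g(2) _ tor] iota_inj subgroup.mem_carrier[OF B] g(3)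
      by blast
  qed
qed

end

section \<open>Amalgams and free products\<close>

text \<open>The amalgam of subgroups \<open>Gs i\<close> of \<open>K\<close> along isomorphisms \<open>\<psi> i\<close> from \<open>A i\<close> to a common
  subgroup \<open>A0\<close>, presented with one generator \<open>gen i g\<close> for each \<open>i\<close> and \<open>g \<in> Gs i\<close>. It acts on the
  normal forms of the HNN extension of \<open>K\<close> with stable letters \<open>t\<^sub>i\<close>, where \<open>t\<^sub>i\<inverse> a t\<^sub>i = \<psi> i a\<close>:
  the generator \<open>gen i g\<close> acts as \<open>t\<^sub>i\<inverse> g t\<^sub>i\<close>, with \<open>t\<^sub>i\<close> written \<open>(i, True)\<close>.\<close>

locale amalgam_data = group K for K (structure) +
  fixes I :: "'i set" and Gs A :: "'i \<Rightarrow> 'a set" and A0 :: "'a set" and \<psi> :: "'i \<Rightarrow> 'a \<Rightarrow> 'a"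
    and S :: "'s set" and R :: "('s word \<times> 's word) set"
    and gen :: "'i \<Rightarrow> 'a \<Rightarrow> 's" and idx :: "'s \<Rightarrow> 'i" and val :: "'s \<Rightarrow> 'a"
  assumes Gs: "i \<in> I \<Longrightarrow> subgroup (Gs i) K" and A: "i \<in> I \<Longrightarrow> subgroup (A i) K"
    and A_Gs: "i \<in> I \<Longrightarrow> A i \<subseteq> Gs i" and A0: "subgroup A0 K"
    and psi_bij: "i \<in> I \<Longrightarrow> bij_betw (\<psi> i) (A i) A0"
    and psi_hom: "i \<in> I \<Longrightarrow> a \<in> A i \<Longrightarrow> b \<in> A i \<Longrightarrow> \<psi> i (a \<otimes> b) = \<psi> i a \<otimes> \<psi> i b"
    and S_idx: "s \<in> S \<Longrightarrow> idx s \<in> I" and S_val: "s \<in> S \<Longrightarrow> val s \<in> Gs (idx s)"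
    and S_gen: "s \<in> S \<Longrightarrow> gen (idx s) (val s) = s"
    and gen_S: "i \<in> I \<Longrightarrow> g \<in> Gs i \<Longrightarrow> gen i g \<in> S"
    and gen_idx: "i \<in> I \<Longrightarrow> g \<in> Gs i \<Longrightarrow> idx (gen i g) = i"
    and gen_val: "i \<in> I \<Longrightarrow> g \<in> Gs i \<Longrightarrow> val (gen i g) = g"
    and R_cases: "(u, v) \<in> R \<Longrightarrow>
      (\<exists>i\<in>I. \<exists>g\<in>Gs i. \<exists>h\<in>Gs i. u = [(gen i g, True), (gen i h, True)] \<and> v = [(gen i (g \<otimes> h), True)]) \<or>
      (\<exists>i\<in>I. \<exists>j\<in>I. \<exists>a\<in>A i. \<exists>b\<in>A j. \<psi> i a = \<psi> j b \<and> u = [(gen i a, True)] \<and> v = [(gen j b, True)])"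
    and R_mult: "i \<in> I \<Longrightarrow> g \<in> Gs i \<Longrightarrow> h \<in> Gs i \<Longrightarrow>
      word_eq S R [(gen i g, True), (gen i h, True)] [(gen i (g \<otimes> h), True)]"
    and R_glue: "i \<in> I \<Longrightarrow> j \<in> I \<Longrightarrow> a \<in> A i \<Longrightarrow> b \<in> A j \<Longrightarrow> \<psi> i a = \<psi> j b \<Longrightarrow>
      word_eq S R [(gen i a, True)] [(gen j b, True)]"
    and proper: "i \<in> I \<Longrightarrow> A i \<noteq> Gs i"
    and two: "i \<in> I \<Longrightarrow> \<exists>j\<in>I. j \<noteq> i" and I_ne: "I \<noteq> {}"
begin

text \<open>\<open>(i, True)\<close> is \<open>t_i\<close> and \<open>(i, False)\<close> its
  inverse. Since \<open>t_i^-1 a = \<psi>_i(a) t_i^-1\<close>, the subgroup \<open>A i\<close> goes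
  with the inverse letter and \<open>A0\<close> with \<open>t_i\<close>.\<close>

definition Cs :: "'i \<times> bool \<Rightarrow> 'a set" where "Cs e = (if snd e then A0 else A (fst e))"
definition psi :: "'i \<times> bool \<Rightarrow> 'a \<Rightarrow> 'a" where
  "psi e = (if snd e then inv_into (A (fst e)) (\<psi> (fst e)) else \<psi> (fst e))"
definition bar :: "'i \<times> bool \<Rightarrow> 'i \<times> bool" where "bar e = (fst e, \<not> snd e)"
definition E :: "('i \<times> bool) set" where "E = I \<times> UNIV"

lemma Cs_simps [simp]: "Cs (i, False) = A i" "Cs (i, True) = A0"
  by (simp_all add: Cs_def)

lemma bar_simp [simp]: "bar (i, b) = (i, \<not> b)"
  by (simp add: bar_def)

lemma psi_A0: "i \<in> I \<Longrightarrow> a \<in> A i \<Longrightarrow> \<psi> i a \<in> A0"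
  using psi_bij by (auto simp: bij_betw_def)

lemma psi_inv_into:
  "i \<in> I \<Longrightarrow> b \<in> A0 \<Longrightarrow> inv_into (A i) (\<psi> i) b \<in> A i"
  "i \<in> I \<Longrightarrow> b \<in> A0 \<Longrightarrow> \<psi> i (inv_into (A i) (\<psi> i) b) = b"
  "i \<in> I \<Longrightarrow> a \<in> A i \<Longrightarrow> inv_into (A i) (\<psi> i) (\<psi> i a) = a"
  using psi_bij by (auto simp: bij_betw_def inv_into_into f_inv_into_f)

sublocale hnn_system K E bar Cs psi
proof (intro hnn_system.intro hnn_system_axioms.intro is_group)
  fix e c c' assume e: "e \<in> E"
  then obtain i b where ib: "e = (i, b)" "i \<in> I" by (auto simp: E_def)
  show "bar e \<in> E" "bar (bar e) = e" using e by (auto simp: bar_def E_def)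
  show "subgroup (Cs e) K" using A A0 ib by (simp add: Cs_def)
  assume c: "c \<in> Cs e"
  show "psi e c \<in> Cs (bar e)" using c psi_inv_into psi_A0 ib by (auto simp: Cs_def psi_def bar_def)
  show "psi (bar e) (psi e c) = c" using c psi_inv_into ib by (auto simp: Cs_def psi_def bar_def)
  assume c': "c' \<in> Cs e"
  show "psi e (c \<otimes> c') = psi e c \<otimes> psi e c'"
  proof (cases b)
    case True
    then have h1: "\<psi> i (psi e c \<otimes> psi e c') = c \<otimes> c'" and h2: "psi e c \<otimes> psi e c' \<in> A i"
      using c c' psi_inv_into psi_hom subgroup.m_closed[OF A] ib by (auto simp: Cs_def psi_def)
    have "psi e (c \<otimes> c') = inv_into (A i) (\<psi> i) (\<psi> i (psi e c \<otimes> psi e c'))"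
      unfolding h1 using True ib by (simp add: psi_def)
    then show ?thesis unfolding psi_inv_into(3)[OF ib(2) h2] .
  qed (use c c' psi_hom ib in \<open>simp add: Cs_def psi_def\<close>)
qed

lemma Gs_carrier: "i \<in> I \<Longrightarrow> g \<in> Gs i \<Longrightarrow> g \<in> carrier K"
  by (rule subgroup.mem_carrier[OF Gs])

lemma A_carrier: "i \<in> I \<Longrightarrow> g \<in> A i \<Longrightarrow> g \<in> carrier K"
  by (rule subgroup.mem_carrier[OF A])

lemma E_iff [simp]: "(i, b) \<in> E \<longleftrightarrow> i \<in> I" by (auto simp: E_def)

abbreviation "D \<equiv> presented_group S R"

sublocale D: group D by (rule group_presented_group)

definition actG :: "'i \<Rightarrow> 'a \<Rightarrow> 'a \<times> (('i \<times> bool) \<times> 'a) list \<Rightarrow> 'a \<times> (('i \<times> bool) \<times> 'a) list" where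
  "actG i g w = actT (i, False) (actK g (actT (i, True) w))"

lemma actG_W: "i \<in> I \<Longrightarrow> g \<in> carrier K \<Longrightarrow> w \<in> W \<Longrightarrow> actG i g w \<in> W"
  by (simp add: actG_def actT_W actK_W)

lemma actT_cancel:
  assumes "i \<in> I" "w \<in> W"
  shows "actT (i, True) (actT (i, False) w) = w" "actT (i, False) (actT (i, True) w) = w"
  using actT_bar[of "(i, False)" w] actT_bar[of "(i, True)" w] assms by (simp_all add: bar_def)

lemma actG_mult:
  "i \<in> I \<Longrightarrow> g \<in> carrier K \<Longrightarrow> h \<in> carrier K \<Longrightarrow> w \<in> W \<Longrightarrow> actG i (g \<otimes> h) w = actG i g (actG i h w)"
  by (simp add: actG_def actT_cancel actK_mult actT_W actK_W)

lemma actG_one: "i \<in> I \<Longrightarrow> w \<in> W \<Longrightarrow> actG i \<one> w = w"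
  by (simp add: actG_def actK_one actT_cancel actT_W)

text \<open>The stable letters around \<open>a\<close> cancel by the HNN relation. Elements of
  different \<open>A i\<close> with the same image in \<open>A0\<close> therefore act alike, which
  verifies the gluing relations.\<close>

lemma actG_A:
  assumes "i \<in> I" "a \<in> A i" "w \<in> W"
  shows "actG i a w = actK (\<psi> i a) w"
proof -
  have "actT (i, False) (actK a (actT (i, True) w)) = actK (psi (i, False) a) (actT (i, False) (actT (i, True) w))"
    using assms actT_W[of "(i, True)" w] by (intro actT_actK) (auto simp: Cs_def)
  then show ?thesis using assms by (simp add: actG_def psi_def actT_cancel)
qed

definition letter :: "'s \<times> bool \<Rightarrow> 'a \<times> (('i \<times> bool) \<times> 'a) list \<Rightarrow> 'a \<times> (('i \<times> bool) \<times> 'a) list" where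
  "letter = (\<lambda>(s, b). actG (idx s) (if b then val s else inv (val s)))"

lemma val_carrier: "s \<in> S \<Longrightarrow> val s \<in> carrier K"
  using S_val S_idx Gs_carrier by blast

lemma letter_W: "s \<in> S \<Longrightarrow> w \<in> W \<Longrightarrow> letter (s, b) w \<in> W"
  by (simp add: letter_def actG_W S_idx val_carrier)

lemma letter_cancel: "s \<in> S \<Longrightarrow> w \<in> W \<Longrightarrow> letter (s, b) (letter (s, \<not> b) w) = w"
  by (simp add: letter_def actG_mult[symmetric] actG_one S_idx val_carrier)

lemma letter_gen: "i \<in> I \<Longrightarrow> g \<in> Gs i \<Longrightarrow> letter (gen i g, True) w = actG i g w"
  by (simp add: letter_def gen_idx gen_val)

lemma letter_rel:
  assumes "(u, v) \<in> R" "w \<in> W"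
  shows "foldr letter u w = foldr letter v w"
  using R_cases[OF assms(1)]
proof (elim disjE bexE conjE)
  fix i g h assume *: "i \<in> I" "g \<in> Gs i" "h \<in> Gs i"
    "u = [(gen i g, True), (gen i h, True)]" "v = [(gen i (g \<otimes> h), True)]"
  then show ?thesis
    using assms(2) subgroup.m_closed[OF Gs, of i g h] Gs_carrier by (simp add: letter_gen actG_mult)
next
  fix i j a b assume *: "i \<in> I" "j \<in> I" "a \<in> A i" "b \<in> A j" "\<psi> i a = \<psi> j b"
    "u = [(gen i a, True)]" "v = [(gen j b, True)]"
  then have "a \<in> Gs i" "b \<in> Gs j" using A_Gs by auto
  then show ?thesis using * assms(2) by (simp add: letter_gen actG_A)
qed

definition Act where "Act = word_act letter"

lemma Act_class: "u \<in> words S \<Longrightarrow> w \<in> W \<Longrightarrow> Act (word_class S R u) w = foldr letter u w"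
  unfolding Act_def by (rule word_act_class[of S W]) (auto intro: letter_W letter_cancel letter_rel)

lemma foldr_letter_W: "u \<in> words S \<Longrightarrow> w \<in> W \<Longrightarrow> foldr letter u w \<in> W"
  by (induction u) (auto intro: letter_W)

sublocale hnn_action K E bar Cs psi D Act
proof
  fix x w assume "x \<in> carrier D" and w: "w \<in> W"
  then obtain u where u: "u \<in> words S" "x = word_class S R u" by (auto simp: presented_group_carrier)
  show "Act x w \<in> W" using Act_class[OF u(1) w] foldr_letter_W[OF u(1) w] u by simp
  fix y assume "y \<in> carrier D"
  then obtain v where v: "v \<in> words S" "y = word_class S R v" by (auto simp: presented_group_carrier)
  show "Act (x \<otimes>\<^bsub>D\<^esub> y) w = Act x (Act y w)"
    using u v w foldr_letter_W[OF v(1) w] by (simp add: presented_group_mult Act_class)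
qed

definition \<iota> :: "'i \<Rightarrow> 'a \<Rightarrow> 's word set" where "\<iota> i g = word_class S R [(gen i g, True)]"

lemma iota_closed: "i \<in> I \<Longrightarrow> g \<in> Gs i \<Longrightarrow> \<iota> i g \<in> carrier D"
  by (simp add: \<iota>_def presented_group_carrier gen_S)

lemma iota_mult: "i \<in> I \<Longrightarrow> g \<in> Gs i \<Longrightarrow> h \<in> Gs i \<Longrightarrow> \<iota> i (g \<otimes> h) = \<iota> i g \<otimes>\<^bsub>D\<^esub> \<iota> i h"
  using word_class_eqI[OF R_mult] by (simp add: \<iota>_def presented_group_mult gen_S)

lemma iota_one: "i \<in> I \<Longrightarrow> \<iota> i \<one> = \<one>\<^bsub>D\<^esub>"
proof -
  assume i: "i \<in> I"
  have "\<one> \<in> Gs i" using subgroup.one_closed[OF Gs[OF i]] .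
  then show ?thesis using iota_mult[OF i, of \<one> \<one>] iota_closed[OF i, of \<one>] by simp
qed

lemma iota_inv: "i \<in> I \<Longrightarrow> g \<in> Gs i \<Longrightarrow> \<iota> i (inv g) = inv\<^bsub>D\<^esub> (\<iota> i g)"
proof -
  assume i: "i \<in> I" "g \<in> Gs i"
  have "inv g \<in> Gs i" using subgroup.m_inv_closed[OF Gs[OF i(1)] i(2)] .
  then show ?thesis
    using iota_mult[OF i(1), of "inv g" g] i iota_closed iota_one Gs_carrier[OF i]
    by (intro D.inv_equality[symmetric]) auto
qed

lemma iota_glue:
  assumes "i \<in> I" "j \<in> I" "a \<in> A i"
  shows "\<exists>b\<in>A j. \<iota> i a = \<iota> j b"
proof -
  let ?b = "inv_into (A j) (\<psi> j) (\<psi> i a)"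
  have "?b \<in> A j" "\<psi> j ?b = \<psi> i a" using assms psi_inv_into psi_A0 by auto
  then show ?thesis using word_class_eqI[OF R_glue[OF assms, of ?b]] by (auto simp: \<iota>_def)
qed

lemma Act_iota: "i \<in> I \<Longrightarrow> g \<in> Gs i \<Longrightarrow> w \<in> W \<Longrightarrow> Act (\<iota> i g) w = actG i g w"
  by (simp add: \<iota>_def Act_class gen_S letter_gen)

lemma Act_one: "w \<in> W \<Longrightarrow> Act \<one>\<^bsub>D\<^esub> w = w"
  by (simp add: presented_group_one Act_class)

text \<open>The action on the base point displays \<open>\<psi> i a\<close>, from which
  \<open>a\<close> is recovered. Injectivity on \<open>A i\<close> is what
  \<open>RS_element_hom\<close> asks for.\<close>

lemma iota_inj:
  assumes i: "i \<in> I" and a: "a \<in> A i" and one: "\<iota> i a = \<one>\<^bsub>D\<^esub>"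
  shows "a = \<one>"
proof -
  have aG: "a \<in> Gs i" using A_Gs i a by blast
  have "actK (\<psi> i a) (\<one>, []) = (\<one>, [])"
    using Act_iota[OF i aG base_W] Act_one[OF base_W] actG_A[OF i a base_W] one by simp
  then have "\<psi> i a = \<one>" using subgroup.mem_carrier[OF A0 psi_A0[OF i a]] by (simp add: actK_def)
  moreover have one: "\<one> \<in> A i" using subgroup.one_closed[OF A[OF i]] .
  then have "\<psi> i \<one> \<otimes> \<psi> i \<one> = \<psi> i \<one>" using psi_hom[OF i, of \<one> \<one>] by simp
  then have "\<psi> i \<one> = \<one>" using subgroup.mem_carrier[OF A0 psi_A0[OF i one]] by simp
  ultimately show ?thesis using psi_inv_into(3)[OF i] a one by metis
qed

fun alt :: "('i \<times> 'a) list \<Rightarrow> bool" where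
  "alt [] \<longleftrightarrow> True"
| "alt ((i, g) # l) \<longleftrightarrow> i \<in> I \<and> g \<in> Gs i \<and> g \<notin> A i \<and> alt l \<and> (l \<noteq> [] \<longrightarrow> fst (hd l) \<noteq> i)"

definition delt :: "('i \<times> 'a) list \<Rightarrow> 's word set" where
  "delt l = foldr (\<lambda>(i, g) x. \<iota> i g \<otimes>\<^bsub>D\<^esub> x) l \<one>\<^bsub>D\<^esub>"

lemma delt_simps [simp]: "delt [] = \<one>\<^bsub>D\<^esub>" "delt ((i, g) # l) = \<iota> i g \<otimes>\<^bsub>D\<^esub> delt l"
  by (simp_all add: delt_def)

lemma delt_closed: "alt l \<Longrightarrow> delt l \<in> carrier D"
  by (induction l rule: alt.induct) (auto simp: iota_closed)

lemma A_mult_notin: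
  assumes "i \<in> I" "a \<in> A i" "g \<in> Gs i" "g \<notin> A i"
  shows "a \<otimes> g \<notin> A i" "g \<otimes> a \<notin> A i"
proof -
  have c: "a \<in> carrier K" "g \<in> carrier K" using A_carrier Gs_carrier assms by auto
  have inv: "inv a \<in> A i" using subgroup.m_inv_closed[OF A] assms by blast
  show "a \<otimes> g \<notin> A i"
  proof
    assume "a \<otimes> g \<in> A i"
    then have "inv a \<otimes> (a \<otimes> g) \<in> A i" using subgroup.m_closed[OF A] inv assms by blast
    then show False using c assms by simp
  qed
  show "g \<otimes> a \<notin> A i"
  proof
    assume "g \<otimes> a \<in> A i"
    then have "g \<otimes> a \<otimes> inv a \<in> A i" using subgroup.m_closed[OF A] inv assms by blast
    then show False using c assms by simp
  qed
qed

lemma iota_A_mult_delt: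
  assumes i: "i \<in> I" "a \<in> A i" and l: "alt l" "l \<noteq> []"
  shows "\<exists>l'. alt l' \<and> l' \<noteq> [] \<and> \<iota> i a \<otimes>\<^bsub>D\<^esub> delt l = delt l'"
proof -
  obtain j h q where q: "l = (j, h) # q" using l(2) by (cases l) auto
  have j: "j \<in> I" "h \<in> Gs j" "h \<notin> A j" "alt q" using l(1) q by auto
  obtain b where b: "b \<in> A j" "\<iota> i a = \<iota> j b" using iota_glue[OF i(1) j(1) i(2)] by blast
  have bG: "b \<in> Gs j" using A_Gs j b by blast
  have "\<iota> i a \<otimes>\<^bsub>D\<^esub> delt l = delt ((j, b \<otimes> h) # q)"
    using b bG j iota_closed delt_closed by (simp add: q iota_mult D.m_assoc)
  moreover have "alt ((j, b \<otimes> h) # q)"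
    using l(1) q A_mult_notin(1)[OF j(1) b(1) j(2,3)] subgroup.m_closed[OF Gs[OF j(1)] bG j(2)] by simp
  ultimately show ?thesis by blast
qed

definition base :: "'s word set set" where "base = (\<Union>i\<in>I. \<iota> i ` A i)"

text \<open>The gluing relations make the images of all the \<open>A i\<close> coincide.\<close>

lemma base_iff: "i \<in> I \<Longrightarrow> x \<in> base \<longleftrightarrow> x \<in> \<iota> i ` A i"
  using iota_glue by (fastforce simp: base_def)

text \<open>A new syllable merges with the first one if both come from the same factor. Whenever an
  element of \<open>A i\<close> results, gluing moves it into the factor of the next syllable, which
  absorbs it without falling into the amalgamated subgroup.\<close>

lemma base_or_alt_step:
  assumes i: "i \<in> I" and g: "g \<in> Gs i" and x: "x \<in> base \<or> (\<exists>l. alt l \<and> l \<noteq> [] \<and> x = delt l)"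
  shows "\<iota> i g \<otimes>\<^bsub>D\<^esub> x \<in> base \<or> (\<exists>l. alt l \<and> l \<noteq> [] \<and> \<iota> i g \<otimes>\<^bsub>D\<^esub> x = delt l)"
proof -
  have single: "\<iota> i g \<in> base \<or> (\<exists>l. alt l \<and> l \<noteq> [] \<and> \<iota> i g = delt l)" if "g \<in> Gs i" for g
  proof (cases "g \<in> A i")
    case True
    then show ?thesis using i by (auto simp: base_def)
  next
    case False
    then have "alt [(i, g)]" "\<iota> i g = delt [(i, g)]" using i that iota_closed by auto
    then show ?thesis by blast
  qed
  from x show ?thesis
  proof
    assume "x \<in> base"
    then obtain a where a: "a \<in> A i" "x = \<iota> i a" using base_iff[OF i] by blast
    then have "\<iota> i g \<otimes>\<^bsub>D\<^esub> x = \<iota> i (g \<otimes> a)" "g \<otimes> a \<in> Gs i"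
      using iota_mult[OF i g] A_Gs[OF i] subgroup.m_closed[OF Gs[OF i] g] by auto
    then show ?thesis using single by simp
  next
    assume "\<exists>l. alt l \<and> l \<noteq> [] \<and> x = delt l"
    then obtain j h q where q: "alt ((j, h) # q)" "x = delt ((j, h) # q)"
      by (metis list.exhaust prod.exhaust)
    then have j: "j \<in> I" "h \<in> Gs j" "h \<notin> A j" "alt q" by auto
    show ?thesis
    proof (cases "j = i")
      case True
      have gh: "g \<otimes> h \<in> Gs i" using subgroup.m_closed[OF Gs[OF i] g] j True by simp
      have eq: "\<iota> i g \<otimes>\<^bsub>D\<^esub> x = \<iota> i (g \<otimes> h) \<otimes>\<^bsub>D\<^esub> delt q"
        using q j True i g iota_closed delt_closed by (simp add: iota_mult D.m_assoc)
      show ?thesis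
      proof (cases "g \<otimes> h \<in> A i")
        case True
        show ?thesis
        proof (cases "q = []")
          case True
          then show ?thesis using eq single[OF gh] iota_closed[OF i gh] by simp
        next
          case False
          then show ?thesis using eq iota_A_mult_delt[OF i True j(4)] by metis
        qed
      next
        case False
        then have "alt ((i, g \<otimes> h) # q)" using q(1) \<open>j = i\<close> gh by simp
        then show ?thesis using eq by (metis delt_simps(2) list.distinct(1))
      qed
    next
      case False
      show ?thesis
      proof (cases "g \<in> A i")
        case True
        then show ?thesis using iota_A_mult_delt[OF i True q(1)] q(2) by auto
      next
        case gA: False
        then have "alt ((i, g) # (j, h) # q)" using q(1) False i g by simp
        then show ?thesis using q(2) by (metis delt_simps(2) list.distinct(1))
      qed
    qed
  qed
qed

lemma base_or_alt:
  assumes "x \<in> carrier D"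
  shows "x \<in> base \<or> (\<exists>l. alt l \<and> l \<noteq> [] \<and> x = delt l)"
proof -
  obtain u where u: "u \<in> words S" "x = word_class S R u" using assms by (auto simp: presented_group_carrier)
  have "word_class S R u \<in> base \<or> (\<exists>l. alt l \<and> l \<noteq> [] \<and> word_class S R u = delt l)"
    using u(1)
  proof (induction u)
    case Nil
    obtain i where i: "i \<in> I" using I_ne by blast
    have "\<iota> i \<one> \<in> base" using i subgroup.one_closed[OF A[OF i]] by (auto simp: base_def)
    then show ?case using iota_one[OF i] by (simp add: presented_group_one)
  next
    case (Cons a u)
    obtain s b where a: "a = (s, b)" by force
    have s: "s \<in> S" "u \<in> words S" using Cons.prems a by auto
    have si: "idx s \<in> I" "val s \<in> Gs (idx s)" using S_idx S_val s by auto
    have split: "word_class S R (a # u) = word_class S R [a] \<otimes>\<^bsub>D\<^esub> word_class S R u"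
      using presented_group_mult[of "[a]" S u R] s a by simp
    have iv: "inv (val s) \<in> Gs (idx s)" using subgroup.m_inv_closed[OF Gs[OF si(1)] si(2)] .
    have iota_s: "\<iota> (idx s) (val s) = word_class S R [(s, True)]" using S_gen[OF s(1)] by (simp add: \<iota>_def)
    have "word_class S R [a] = \<iota> (idx s) (if b then val s else inv (val s))"
    proof (cases b)
      case False
      have "word_class S R [(s, False)] \<otimes>\<^bsub>D\<^esub> \<iota> (idx s) (val s) = \<one>\<^bsub>D\<^esub>"
        using word_class_eqI[OF word_eq.cancel[of s S R False]] s
        by (simp add: iota_s presented_group_mult presented_group_one)
      moreover have "word_class S R [(s, False)] \<in> carrier D"
        using s by (auto simp: presented_group_carrier)
      ultimately have "inv\<^bsub>D\<^esub> (\<iota> (idx s) (val s)) = word_class S R [(s, False)]"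
        using iota_closed[OF si] by (intro D.inv_equality) auto
      then show ?thesis using False iota_inv[OF si] by (simp add: a)
    qed (simp add: a iota_s)
    then show ?case
      using split base_or_alt_step[OF si(1), of "if b then val s else inv (val s)"] si iv Cons.IH[OF s(2)] by simp
  qed
  then show ?thesis using u by simp
qed

text \<open>A syllable \<open>g\<close> of the factor \<open>i\<close> becomes
  \<open>t_i^-1 g t_i\<close>; the trivial element fills the slot that follows every stable letter
  in this encoding.\<close>

definition expand :: "('i \<times> 'a) list \<Rightarrow> (('i \<times> bool) \<times> 'a) list" where
  "expand l = concat (map (\<lambda>(i, g). [((i, False), g), ((i, True), \<one>)]) l)"

lemma expand_simps [simp]:
  "expand [] = []" "expand ((i, g) # l) = ((i, False), g) # ((i, True), \<one>) # expand l"
  by (simp_all add: expand_def)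

lemma expand_hd: "l \<noteq> [] \<Longrightarrow> expand l \<noteq> [] \<and> fst (hd (expand l)) = (fst (hd l), False)"
  by (cases l) auto

lemma expand_last: "l \<noteq> [] \<Longrightarrow> fst (last (expand l)) = (fst (last l), True)"
proof (induction l rule: alt.induct)
  case (2 i g l)
  then show ?case using expand_hd[of l] by (cases "l = []") auto
qed simp

text \<open>The two possible pinches are \<open>t_i^-1 g t_i\<close>, excluded by \<open>g\<close>
  not in \<open>A i\<close>, and \<open>t_i 1 t_j^-1\<close>, excluded by the change of
  factor.\<close>

lemma reduced_expand: "alt l \<Longrightarrow> reduced (expand l)"
proof (induction l rule: alt.induct)
  case (2 i g l)
  then show ?case using Gs_carrier expand_hd[of l] by (cases "l = []") auto
qed simp

lemma Act_delt: "alt l \<Longrightarrow> w \<in> W \<Longrightarrow> Act (delt l) w = actL (expand l) w"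
proof (induction l rule: alt.induct)
  case (2 i g l)
  have "actL (expand l) w \<in> W" using actL_W[OF reduced_expand] 2 by simp
  then show ?case
    using 2 by (simp add: Act_mult iota_closed delt_closed Act_iota actG_def actK_one)
qed (simp add: Act_one)

lemma redn_delt:
  assumes "alt l" "l \<noteq> []"
  shows "redn (delt l) (fst (hd l), False) (fst (last l), True) (length (expand l))"
  using rednI[of "delt l" \<one> "expand l"] assms delt_closed reduced_expand[OF assms(1)] expand_hd[OF assms(2)]
    expand_last[OF assms(2)] Act_delt actK_one actL_W by auto

lemma alt_last: "alt l \<Longrightarrow> l \<noteq> [] \<Longrightarrow> fst (last l) \<in> I"
  by (induction l rule: alt.induct) auto

text \<open>A conjugator is taken from a second factor \<open>j\<close>, outside \<open>A j\<close>,
  which is where properness and the presence of two factors enter. It and its inverse both expand to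
  words from \<open>t_j^-1\<close> to \<open>t_j\<close>, so nothing cancels against a word that
  starts with \<open>t_i^-1\<close>.\<close>

lemma ext_condition:
  assumes "e \<in> I \<times> {False}"
  shows "\<exists>y f l l' m m'. f \<in> I \<times> {False} \<and> redn y f l m \<and> redn (inv\<^bsub>D\<^esub> y) l' (bar f) m' \<and> e \<noteq> bar l \<and> l' \<noteq> e"
proof -
  obtain i where i: "i \<in> I" "e = (i, False)" using assms by auto
  obtain j where j: "j \<in> I" "j \<noteq> i" using two[OF i(1)] by blast
  obtain g where g: "g \<in> Gs j" "g \<notin> A j" using A_Gs[OF j(1)] proper[OF j(1)] by blast
  have ig: "inv g \<in> Gs j" using subgroup.m_inv_closed[OF Gs[OF j(1)] g(1)] .
  have "inv g \<notin> A j"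
    using subgroup.m_inv_closed[OF A[OF j(1)], of "inv g"] g Gs_carrier[OF j(1)] by auto
  then have "redn (\<iota> j (inv g)) (j, False) (j, True) 2"
    using redn_delt[of "[(j, inv g)]"] j ig iota_closed by (simp add: numeral_2_eq_2)
  moreover have "redn (\<iota> j g) (j, False) (j, True) 2"
    using redn_delt[of "[(j, g)]"] j g iota_closed by (simp add: numeral_2_eq_2)
  ultimately show ?thesis
    using i j iota_inv[OF j(1) g(1)]
    by (intro exI[of _ "\<iota> j g"] exI[of _ "(j, False)"] exI[of _ "(j, True)"] exI[of _ "2::nat"])
       (auto simp: bar_def)
qed

text \<open>An element outside \<open>base\<close> is an alternating product, whose expanded word
  runs from some \<open>t_i^-1\<close> to some \<open>t_j\<close>. Its first letter is in
  \<open>I \<times> {False}\<close>, the set \<open>Q\<close> for which conjugators are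
  available.\<close>

lemma FC_torsion_subset_base:
  assumes x: "x \<in> FC_torsion D"
  shows "x \<in> base"
proof (rule ccontr)
  assume "x \<notin> base"
  then obtain l where l: "alt l" "l \<noteq> []" "x = delt l"
    using base_or_alt subgroup.mem_carrier[OF D.subgroup_FC_torsion x] by blast
  have "fst (hd l) \<in> I" using l by (cases l) auto
  then have "x \<notin> FC_torsion D"
    unfolding l(3) using alt_last[OF l(1,2)]
    by (intro redn_not_FC_torsion[OF redn_delt[OF l(1,2)], of "I \<times> {False}"] ext_condition)
       (auto simp: E_def)
  then show False using x by blast
qed

end

section \<open>Transport along isomorphisms and the cut property\<close>

lemma RS_torsion_iso:
  assumes P: "group P" and D: "group D" and iso: "P \<cong> D"
    and RS: "\<And>x. x \<in> FC_torsion D \<Longrightarrow> RS_element D x" and x: "x \<in> FC_torsion P"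
  shows "RS_element P x"
proof -
  obtain h where h: "h \<in> iso D P" using group.iso_sym[OF P iso] by (auto simp: is_iso_def)
  interpret h: group_hom D P h
    by (intro group_hom.intro group_hom_axioms.intro P D) (use h in \<open>simp add: iso_def\<close>)
  have bij: "bij_betw h (carrier D) (carrier P)" using h by (simp add: iso_def)
  have xc: "x \<in> carrier P" using x by (simp add: FC_torsion_def FC_subgroup_def)
  then obtain y where y: "y \<in> carrier D" "h y = x"  using bij unfolding bij_betw_def by (metis imageE)
  have inj: "a = b" if "h a = h b" "a \<in> carrier D" "b \<in> carrier D" for a b
    using bij that by (auto simp: bij_betw_def inj_on_def)
  have conj: "conj_in P (h a) (h b)" if ab: "conj_in D a b" "a \<in> carrier D" for a b
  proof -
    obtain g where g: "g \<in> carrier D" "b = g \<otimes>\<^bsub>D\<^esub> a \<otimes>\<^bsub>D\<^esub> inv\<^bsub>D\<^esub> g"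
      using ab(1) unfolding conj_in_def by blast
    have "h b = h g \<otimes>\<^bsub>P\<^esub> h a \<otimes>\<^bsub>P\<^esub> inv\<^bsub>P\<^esub> (h g)" using g ab(2) by simp
    then show ?thesis using h.hom_closed[OF g(1)] unfolding conj_in_def by blast
  qed
  have "h ` {z. conj_in D y z} \<subseteq> {z. conj_in P x z}" using conj[OF _ y(1)] y(2) by blast
  then have "finite (h ` {z. conj_in D y z})"
    using x finite_subset by (auto simp: FC_torsion_def FC_subgroup_def)
  moreover have "inj_on h {z. conj_in D y z}"
    using inj h.G.conj_in_closed y(1) by (auto simp: inj_on_def)
  ultimately have fin: "finite {z. conj_in D y z}" by (rule finite_imageD)
  have pow: "h (y [^]\<^bsub>D\<^esub> (n::nat)) = x [^]\<^bsub>P\<^esub> n" for n using h.hom_nat_pow[OF y(1), of n] y(2) by simp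
  have "torsion_elt D y"
  proof -
    obtain n :: nat where n: "n > 0" "x [^]\<^bsub>P\<^esub> n = \<one>\<^bsub>P\<^esub>" using x by (auto simp: FC_torsion_def torsion_elt_def)
    then have "h (y [^]\<^bsub>D\<^esub> n) = h \<one>\<^bsub>D\<^esub>" using pow by simp
    then have "y [^]\<^bsub>D\<^esub> n = \<one>\<^bsub>D\<^esub>" by (rule inj) (use y in auto)
    then show ?thesis using n by (auto simp: torsion_elt_def)
  qed
  then have "y \<in> FC_torsion D" using fin y by (simp add: FC_torsion_def FC_subgroup_def)
  then have FC: "RS_element D z" if "z \<in> FC_torsion D" for z using RS that by blast
  \<comment> \<open>With \<open>\<Phi>\<^sup>+\<close> of \<open>D\<close> packaged as an
    RS-subgroup, \<open>RS_element_hom\<close> applied to the isomorphism transports the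
    property.\<close>
  have "RS_subgroup (FC_torsion D) D"
    using h.G.subgroup_FC_torsion FC by (simp add: RS_subgroup_def)
  then have "RS_element P (h y)"
    using \<open>y \<in> FC_torsion D\<close> x y(2) subgroup.mem_carrier[OF h.G.subgroup_FC_torsion] inj[of _ "\<one>\<^bsub>D\<^esub>"]
    by (intro RS_element_hom[OF D P h.homh, of "FC_torsion D"]) (auto simp: FC_torsion_def)
  then show ?thesis using y(2) by simp
qed

lemma cut_group_isoI:
  assumes "group P" "group D" "P \<cong> D" "\<And>x. x \<in> FC_torsion D \<Longrightarrow> RS_element D x"
  shows "cut_group P"
  using group.RS_cut_group[OF assms(1)] RS_torsion_iso[OF assms] by blast

theorem cut_group_HNN:
  assumes P: "group P" and G: "group G" "subgroup A G" "subgroup B G"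
    and \<phi>: "\<phi> \<in> iso (G\<lparr>carrier := A\<rparr>) (G\<lparr>carrier := B\<rparr>)" and iso: "P \<cong> HNN_extension G A \<phi>"
    and RS: "RS_subgroup A G \<or> RS_subgroup B G"
  shows "cut_group P"
proof -
  interpret hnn_extension_data G A B \<phi>
    by (intro hnn_extension_data.intro hnn_extension_data_axioms.intro G \<phi>)
  show ?thesis
    by (rule cut_group_isoI[OF P D.is_group iso[unfolded HNN_extension_eq] FC_torsion_RS[OF RS]])
qed

theorem cut_group_amalgam:
  fixes G :: "('a, 'ma) monoid_scheme" and G' :: "('b, 'mb) monoid_scheme"
  assumes P: "group P" and G: "group G" "group G'" and A: "subgroup A G" "subgroup A' G'"
    and f: "f \<in> iso (G\<lparr>carrier := A\<rparr>) (G'\<lparr>carrier := A'\<rparr>)" and iso: "P \<cong> amalgam G G' A f"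
    and RS: "RS_subgroup A G \<or> RS_subgroup A' G'" and proper: "A \<noteq> carrier G" "A' \<noteq> carrier G'"
  shows "cut_group P"
proof -
  interpret G: group G by (rule G)
  interpret G': group G' by (rule G)
  \<comment> \<open>\<open>amalgam_data\<close> places both factors inside one group; the direct
    product hosts them as coordinate subgroups, with index \<open>True\<close> for \<open>G\<close>.
    The relations multiply only within one coordinate.\<close>
  let ?K = "G \<times>\<times> G'"
  have K: "group ?K" using DirProd_group[OF G] .
  let ?Gs = "\<lambda>b. if b then carrier G \<times> {\<one>\<^bsub>G'\<^esub>} else {\<one>\<^bsub>G\<^esub>} \<times> carrier G'"
  let ?A = "\<lambda>b. if b then A \<times> {\<one>\<^bsub>G'\<^esub>} else {\<one>\<^bsub>G\<^esub>} \<times> A'"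
  \<comment> \<open>The common subgroup is the copy of \<open>A\<close> in the first coordinate, so
    the second factor is matched to it by the inverse of \<open>f\<close>.\<close>
  let ?\<psi> = "\<lambda>b k. if b then k else (inv_into A f (snd k), \<one>\<^bsub>G'\<^esub>)"
  let ?S = "carrier G <+> carrier G'"
  let ?R = "mult_table Inl G \<union> mult_table Inr G' \<union> {([(Inl a, True)], [(Inr (f a), True)]) |a. a \<in> A}"
  let ?gen = "\<lambda>b k. if b then Inl (fst k) else Inr (snd k) :: 'a + 'b"
  let ?idx = "\<lambda>s :: 'a + 'b. case s of Inl _ \<Rightarrow> True | Inr _ \<Rightarrow> False"
  let ?val = "\<lambda>s :: 'a + 'b. case s of Inl a \<Rightarrow> (a, \<one>\<^bsub>G'\<^esub>) | Inr b \<Rightarrow> (\<one>\<^bsub>G\<^esub>, b)"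
  have sub1: "subgroup {\<one>\<^bsub>G\<^esub>} G" "subgroup {\<one>\<^bsub>G'\<^esub>} G'" using G.triv_subgroup G'.triv_subgroup by auto
  have fbij: "bij_betw f A A'" using f by (simp add: iso_def)
  have fmult: "f (a \<otimes>\<^bsub>G\<^esub> b) = f a \<otimes>\<^bsub>G'\<^esub> f b" if "a \<in> A" "b \<in> A" for a b
    using f that by (simp add: iso_def hom_def)
  have fA: "f a \<in> A'" if "a \<in> A" for a using fbij that by (auto simp: bij_betw_def)
  have finv: "inv_into A f b \<in> A" "f (inv_into A f b) = b" if "b \<in> A'" for b
    using fbij that by (auto simp: bij_betw_def inv_into_into f_inv_into_f)
  have finv2: "inv_into A f (f a) = a" if "a \<in> A" for a using fbij that by (auto simp: bij_betw_def)
  have Ac: "a \<in> carrier G" if "a \<in> A" for a using subgroup.mem_carrier[OF A(1) that] .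
  have A'c: "a \<in> carrier G'" if "a \<in> A'" for a using subgroup.mem_carrier[OF A(2) that] .
  have finv_mult: "inv_into A f (a \<otimes>\<^bsub>G'\<^esub> b) = inv_into A f a \<otimes>\<^bsub>G\<^esub> inv_into A f b"
    if "a \<in> A'" "b \<in> A'" for a b
  proof -
    have "a \<otimes>\<^bsub>G'\<^esub> b = f (inv_into A f a \<otimes>\<^bsub>G\<^esub> inv_into A f b)" using that finv fmult by simp
    then show ?thesis using finv2 subgroup.m_closed[OF A(1)] finv that by simp
  qed
  have glue: "word_eq ?S ?R [(Inl a, True)] [(Inr (f a), True)]" if "a \<in> A" for a
    using that Ac A'c[OF fA[OF that]] by (intro word_eq.rel) auto
  interpret amalgam_data ?K UNIV ?Gs ?A "A \<times> {\<one>\<^bsub>G'\<^esub>}" ?\<psi> ?S ?R ?gen ?idx ?val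
  proof (intro amalgam_data.intro amalgam_data_axioms.intro K)
    fix i j :: bool
    show "subgroup (?Gs i) ?K"
      using DirProd_subgroups[OF G(1) G.subgroup_self G(2) sub1(2)]
        DirProd_subgroups[OF G(1) sub1(1) G(2) G'.subgroup_self] by simp
    show "subgroup (?A i) ?K" "subgroup (A \<times> {\<one>\<^bsub>G'\<^esub>}) ?K"
      using DirProd_subgroups[OF G(1) A(1) G(2) sub1(2)] DirProd_subgroups[OF G(1) sub1(1) G(2) A(2)] by auto
    show "?A i \<subseteq> ?Gs i" using Ac A'c by auto
    show "bij_betw (?\<psi> i) (?A i) (A \<times> {\<one>\<^bsub>G'\<^esub>})"
    proof (cases i)
      case False
      have "bij_betw (\<lambda>k. (inv_into A f (snd k), \<one>\<^bsub>G'\<^esub>)) ({\<one>\<^bsub>G\<^esub>} \<times> A') (A \<times> {\<one>\<^bsub>G'\<^esub>})"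
        using finv finv2 fA by (intro bij_betwI[of _ _ _ "\<lambda>k. (\<one>\<^bsub>G\<^esub>, f (fst k))"]) auto
      then show ?thesis using False by simp
    next
      case True
      then show ?thesis by (simp add: bij_betw_def)
    qed
    show "?\<psi> i (a \<otimes>\<^bsub>?K\<^esub> b) = ?\<psi> i a \<otimes>\<^bsub>?K\<^esub> ?\<psi> i b" if "a \<in> ?A i" "b \<in> ?A i" for a b
      using that finv_mult by (auto split: if_splits)
    show "?val s \<in> ?Gs (?idx s)" "?gen (?idx s) (?val s) = s" if "s \<in> ?S" for s
      using that by (auto split: sum.splits)
    show "?gen i g \<in> ?S" "?idx (?gen i g) = i" "?val (?gen i g) = g" if "g \<in> ?Gs i" for g
      using that by (auto split: if_splits)
    show "(\<exists>i\<in>UNIV. \<exists>g\<in>?Gs i. \<exists>h\<in>?Gs i. u = [(?gen i g, True), (?gen i h, True)] \<and> v = [(?gen i (g \<otimes>\<^bsub>?K\<^esub> h), True)]) \<or>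
      (\<exists>i\<in>UNIV. \<exists>j\<in>UNIV. \<exists>a\<in>?A i. \<exists>b\<in>?A j. ?\<psi> i a = ?\<psi> j b \<and> u = [(?gen i a, True)] \<and> v = [(?gen j b, True)])"
      if uv: "(u, v) \<in> ?R" for u v
    proof -
      consider (l) x y where "x \<in> carrier G" "y \<in> carrier G" "u = [(Inl x, True), (Inl y, True)]" "v = [(Inl (x \<otimes>\<^bsub>G\<^esub> y), True)]"
        | (r) x y where "x \<in> carrier G'" "y \<in> carrier G'" "u = [(Inr x, True), (Inr y, True)]" "v = [(Inr (x \<otimes>\<^bsub>G'\<^esub> y), True)]"
        | (a) a where "a \<in> A" "u = [(Inl a, True)]" "v = [(Inr (f a), True)]"
        using uv by (auto simp: mult_table_def)
      then show ?thesis
      proof cases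
        case l
        then show ?thesis
          by (intro disjI1 bexI[of _ True] bexI[of _ "(x, \<one>\<^bsub>G'\<^esub>)"] bexI[of _ "(y, \<one>\<^bsub>G'\<^esub>)"]) auto
      next
        case r
        then show ?thesis
          by (intro disjI1 bexI[of _ False] bexI[of _ "(\<one>\<^bsub>G\<^esub>, x)"] bexI[of _ "(\<one>\<^bsub>G\<^esub>, y)"]) auto
      next
        case a
        then show ?thesis using fA finv2
          by (intro disjI2 bexI[of _ True] bexI[of _ False] bexI[of _ "(a, \<one>\<^bsub>G'\<^esub>)"] bexI[of _ "(\<one>\<^bsub>G\<^esub>, f a)"]) auto
      qed
    qed
    show "word_eq ?S ?R [(?gen i g, True), (?gen i h, True)] [(?gen i (g \<otimes>\<^bsub>?K\<^esub> h), True)]"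
      if "g \<in> ?Gs i" "h \<in> ?Gs i" for g h
      using that by (intro word_eq.rel) (auto simp: mult_table_def split: if_splits)
    show "word_eq ?S ?R [(?gen i a, True)] [(?gen j b, True)]"
      if "a \<in> ?A i" "b \<in> ?A j" "?\<psi> i a = ?\<psi> j b" for a b
    proof (cases i; cases j)
      assume ij: "i" "j"
      then show ?thesis using that Ac by (auto intro!: word_eq.refl)
    next
      assume ij: "i" "\<not> j"
      then have "fst a \<in> A" "snd b = f (fst a)" using that finv by auto
      then show ?thesis using ij glue by simp
    next
      assume ij: "\<not> i" "j"
      then have "fst b \<in> A" "snd a = f (fst b)" using that finv by auto
      then show ?thesis using ij word_eq.sym[OF glue] by simp
    next
      assume ij: "\<not> i" "\<not> j"
      then have "snd a = snd b" "snd a \<in> A'" using that finv by (auto, metis)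
      then show ?thesis using ij A'c by (auto intro!: word_eq.refl)
    qed
    show "?A i \<noteq> ?Gs i" using proper by auto
    show "\<exists>j\<in>UNIV. j \<noteq> i" by (intro bexI[of _ "\<not> i"]) auto
  qed auto
  have am: "amalgam G G' A f = D" by (simp add: amalgam_def)
  have hom1: "(\<lambda>g. \<iota> True (g, \<one>\<^bsub>G'\<^esub>)) \<in> hom G D"
  proof (rule homI)
    fix g h assume "g \<in> carrier G" "h \<in> carrier G"
    then show "\<iota> True (g \<otimes>\<^bsub>G\<^esub> h, \<one>\<^bsub>G'\<^esub>) = \<iota> True (g, \<one>\<^bsub>G'\<^esub>) \<otimes>\<^bsub>D\<^esub> \<iota> True (h, \<one>\<^bsub>G'\<^esub>)"
      using iota_mult[of True "(g, \<one>\<^bsub>G'\<^esub>)" "(h, \<one>\<^bsub>G'\<^esub>)"] by simp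
  qed (use iota_closed[of True] in auto)
  have hom2: "(\<lambda>g. \<iota> False (\<one>\<^bsub>G\<^esub>, g)) \<in> hom G' D"
  proof (rule homI)
    fix g h assume "g \<in> carrier G'" "h \<in> carrier G'"
    then show "\<iota> False (\<one>\<^bsub>G\<^esub>, g \<otimes>\<^bsub>G'\<^esub> h) = \<iota> False (\<one>\<^bsub>G\<^esub>, g) \<otimes>\<^bsub>D\<^esub> \<iota> False (\<one>\<^bsub>G\<^esub>, h)"
      using iota_mult[of False "(\<one>\<^bsub>G\<^esub>, g)" "(\<one>\<^bsub>G\<^esub>, h)"] by simp
  qed (use iota_closed[of False] in auto)
  have "RS_element D x" if x: "x \<in> FC_torsion D" for x
  proof -
    have tor: "torsion_elt D x" using x by (simp add: FC_torsion_def)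
    from RS show ?thesis
    proof
      assume RSA: "RS_subgroup A G"
      obtain a where a: "a \<in> A" "x = \<iota> True (a, \<one>\<^bsub>G'\<^esub>)"
        using FC_torsion_subset_base[OF x] base_iff[of True x] by auto
      have inj: "c = \<one>\<^bsub>G\<^esub>" if "c \<in> A" "\<iota> True (c, \<one>\<^bsub>G'\<^esub>) = \<one>\<^bsub>D\<^esub>" for c
        using iota_inj[of True "(c, \<one>\<^bsub>G'\<^esub>)"] that by simp
      show ?thesis
        using RS_element_hom[OF G(1) D.is_group hom1 RSA a(1) inj] tor a(2) by simp
    next
      assume RSA: "RS_subgroup A' G'"
      obtain a where a: "a \<in> A'" "x = \<iota> False (\<one>\<^bsub>G\<^esub>, a)"
        using FC_torsion_subset_base[OF x] base_iff[of False x] by auto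
      have inj: "c = \<one>\<^bsub>G'\<^esub>" if "c \<in> A'" "\<iota> False (\<one>\<^bsub>G\<^esub>, c) = \<one>\<^bsub>D\<^esub>" for c
        using iota_inj[of False "(\<one>\<^bsub>G\<^esub>, c)"] that by simp
      show ?thesis
        using RS_element_hom[OF G(2) D.is_group hom2 RSA a(1) inj] tor a(2) by simp
    qed
  qed
  then show ?thesis by (rule cut_group_isoI[OF P D.is_group iso[unfolded am]])
qed

lemma RS_element_one: "group G \<Longrightarrow> RS_element G \<one>\<^bsub>G\<^esub>"
proof -
  assume "group G"
  then interpret group G .
  have "conj_in G \<one>\<^bsub>G\<^esub> \<one>\<^bsub>G\<^esub>" using conj_inI[of "\<one>\<^bsub>G\<^esub>" "\<one>\<^bsub>G\<^esub>"] by simp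
  moreover have "torsion_elt G \<one>\<^bsub>G\<^esub>" by (auto simp: torsion_elt_def intro: exI[of _ "1::nat"])
  ultimately show ?thesis by (simp add: RS_element_def)
qed

theorem cut_group_free_product:
  fixes H :: "'i \<Rightarrow> ('h, 'm) monoid_scheme"
  assumes P: "group P" and H: "\<And>i. i \<in> I \<Longrightarrow> group (H i)"
    and ne: "\<And>i. i \<in> I \<Longrightarrow> carrier (H i) \<noteq> {\<one>\<^bsub>H i\<^esub>}"
    and two: "\<exists>i\<in>I. \<exists>j\<in>I. i \<noteq> j" and iso: "P \<cong> free_product I H"
  shows "cut_group P"
proof -
  \<comment> \<open>The full direct product hosts the factors as coordinate subgroups, whatever the
    size of \<open>I\<close>; all amalgamated subgroups are trivial.\<close>
  let ?K = "product_group I H"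
  have K: "group ?K" using H by (rule product_group)
  let ?emb = "\<lambda>i h. \<lambda>j\<in>I. if j = i then h else \<one>\<^bsub>H j\<^esub>"
  let ?Gs = "\<lambda>i. ?emb i ` carrier (H i)"
  let ?S = "SIGMA i:I. carrier (H i)"
  let ?R = "\<Union>i\<in>I. mult_table (Pair i) (H i)"
  let ?gen = "\<lambda>i k. (i, k i)" and ?val = "\<lambda>s. ?emb (fst s) (snd s)"
  have one: "\<one>\<^bsub>H i\<^esub> \<in> carrier (H i)" if "i \<in> I" for i using group.is_monoid[OF H[OF that]] monoid.one_closed by blast
  have emb_mult: "?emb i g \<otimes>\<^bsub>?K\<^esub> ?emb i h = ?emb i (g \<otimes>\<^bsub>H i\<^esub> h)" if "i \<in> I" "g \<in> carrier (H i)" "h \<in> carrier (H i)" for i g h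
    using that one group.is_monoid[OF H] by (auto simp: fun_eq_iff restrict_def intro: monoid.r_one)
  have emb_hom: "?emb i \<in> hom (H i) ?K" if "i \<in> I" for i
    using that one emb_mult[OF that] by (intro homI) auto
  have emb_at: "?emb i h i = h" if "i \<in> I" for i h using that by simp
  have Gs_sub: "subgroup (?Gs i) ?K" if i: "i \<in> I" for i
  proof -
    interpret h: group_hom "H i" ?K "?emb i"
      by (intro group_hom.intro group_hom_axioms.intro H K emb_hom i)
    show ?thesis by (rule h.img_is_subgroup)
  qed
  have triv: "subgroup {\<one>\<^bsub>?K\<^esub>} ?K" by (rule group.triv_subgroup[OF K])
  have emb_one: "?emb i \<one>\<^bsub>H i\<^esub> = \<one>\<^bsub>?K\<^esub>" if "i \<in> I" for i
    by (auto simp: fun_eq_iff restrict_def)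
  have one_i: "\<one>\<^bsub>?K\<^esub> i = \<one>\<^bsub>H i\<^esub>" if "i \<in> I" for i using that by simp
  have rel: "word_eq ?S ?R [((i, g), True), ((i, h), True)] [((i, g \<otimes>\<^bsub>H i\<^esub> h), True)]"
    if "i \<in> I" "g \<in> carrier (H i)" "h \<in> carrier (H i)" for i g h
    using that monoid.m_closed[OF group.is_monoid[OF H[OF that(1)]], of g h]
    by (intro word_eq.rel) (auto simp: mult_table_def)
  \<comment> \<open>A generator belonging to an identity element is idempotent in a group, hence
    trivial. This supplies the gluing of the identities of different factors, which the presentation
    does not list.\<close>
  have rel_one: "word_eq ?S ?R [((i, \<one>\<^bsub>H i\<^esub>), True)] []" if i: "i \<in> I" for i
  proof -
    interpret D: group "presented_group ?S ?R" by (rule group_presented_group)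
    let ?x = "word_class ?S ?R [((i, \<one>\<^bsub>H i\<^esub>), True)]"
    have "?x \<otimes>\<^bsub>presented_group ?S ?R\<^esub> ?x = ?x"
      using word_class_eqI[OF rel[OF i one[OF i] one[OF i]]] i one group.is_monoid[OF H[OF i]]
      by (simp add: presented_group_mult monoid.r_one)
    moreover have "?x \<in> carrier (presented_group ?S ?R)"
      using i one by (auto simp: presented_group_carrier)
    ultimately have "?x = word_class ?S ?R []"
      using D.l_cancel_one[of ?x ?x] by (simp add: presented_group_one)
    then show ?thesis using word_class_eq_iff[of "[((i, \<one>\<^bsub>H i\<^esub>), True)]" ?S ?R "[]"] i one by simp
  qed
  interpret amalgam_data ?K I ?Gs "\<lambda>i. {\<one>\<^bsub>?K\<^esub>}" "{\<one>\<^bsub>?K\<^esub>}" "\<lambda>i k. k" ?S ?R ?gen fst ?val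
  proof (intro amalgam_data.intro amalgam_data_axioms.intro K triv Gs_sub)
    fix i assume i: "i \<in> I"
    show "{\<one>\<^bsub>?K\<^esub>} \<subseteq> ?Gs i" using imageI[OF one[OF i], of "?emb i"] unfolding emb_one[OF i] by blast
    show "bij_betw (\<lambda>k. k) {\<one>\<^bsub>?K\<^esub>} {\<one>\<^bsub>?K\<^esub>}" by (simp add: bij_betw_def)
    show "(i, g i) \<in> ?S" "fst (i, g i) = i" "?emb (fst (i, g i)) (snd (i, g i)) = g" if "g \<in> ?Gs i" for g
      using that i by auto
    show "word_eq ?S ?R [((i, g i), True), ((i, h i), True)] [((i, (g \<otimes>\<^bsub>?K\<^esub> h) i), True)]"
      if "g \<in> ?Gs i" "h \<in> ?Gs i" for g h
      using that rel i by auto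
    show "\<exists>j\<in>I. j \<noteq> i" using two by metis
    show "{\<one>\<^bsub>?K\<^esub>} \<noteq> ?Gs i"
    proof
      assume eq: "{\<one>\<^bsub>?K\<^esub>} = ?Gs i"
      have "h = \<one>\<^bsub>H i\<^esub>" if "h \<in> carrier (H i)" for h
      proof -
        have "?emb i h = \<one>\<^bsub>?K\<^esub>" using eq that by blast
        then have "?emb i h i = \<one>\<^bsub>?K\<^esub> i" by simp
        then show ?thesis using i by simp
      qed
      then show False using ne[OF i] one[OF i] by blast
    qed
    fix j a b assume "j \<in> I" "a \<in> {\<one>\<^bsub>?K\<^esub>}" "b \<in> {\<one>\<^bsub>?K\<^esub>}"
    then show "word_eq ?S ?R [((i, a i), True)] [((j, b j), True)]"
      using i word_eq.trans[OF rel_one[OF i] word_eq.sym[OF rel_one[of j]]] one_i by simp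
  next
    fix s assume s: "s \<in> ?S"
    then show "fst s \<in> I" "?val s \<in> ?Gs (fst s)" "(fst s, ?val s (fst s)) = s" by auto
  next
    fix u v assume "(u, v) \<in> ?R"
    then obtain i g h where *: "i \<in> I" "g \<in> carrier (H i)" "h \<in> carrier (H i)"
      "u = [((i, g), True), ((i, h), True)]" "v = [((i, g \<otimes>\<^bsub>H i\<^esub> h), True)]"
      by (auto simp: mult_table_def)
    then show "(\<exists>i\<in>I. \<exists>g\<in>?Gs i. \<exists>h\<in>?Gs i. u = [(?gen i g, True), (?gen i h, True)] \<and> v = [(?gen i (g \<otimes>\<^bsub>?K\<^esub> h), True)]) \<or>
      (\<exists>i\<in>I. \<exists>j\<in>I. \<exists>a\<in>{\<one>\<^bsub>?K\<^esub>}. \<exists>b\<in>{\<one>\<^bsub>?K\<^esub>}. a = b \<and> u = [(?gen i a, True)] \<and> v = [(?gen j b, True)])"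
      by (intro disjI1 bexI[of _ i] bexI[of _ "?emb i g"] bexI[of _ "?emb i h"]) auto
  qed (use two in auto)
  have fp: "free_product I H = D" by (simp add: free_product_def)
  have "RS_element D x" if x: "x \<in> FC_torsion D" for x
  proof -
    obtain i where "i \<in> I" "x = \<iota> i \<one>\<^bsub>?K\<^esub>" using FC_torsion_subset_base[OF x] unfolding base_def by blast
    then have "x = \<one>\<^bsub>D\<^esub>" using iota_one by simp
    then show ?thesis using RS_element_one[OF D.is_group] by simp
  qed
  then show ?thesis by (rule cut_group_isoI[OF P D.is_group iso[unfolded fp]])
qed

text \<open>Groups are taken up to isomorphism, as the constructions produce concrete groups of word
  classes. Free products form a clause of their own because the index set may be infinite.\<close>

theorem theorem5:
  fixes P :: "('p, 'mp) monoid_scheme"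
    and N :: "'p set"
    and G :: "('a, 'ma) monoid_scheme"
    and G' :: "('b, 'mb) monoid_scheme"
    and A B :: "'a set"
    and A' :: "'b set"
    and f :: "'a \<Rightarrow> 'b"
    and \<phi> :: "'a \<Rightarrow> 'a"
    and I :: "'i set"
    and H :: "'i \<Rightarrow> ('h, 'mh) monoid_scheme"
  assumes "group P"
  shows
    "(N \<lhd> P \<longrightarrow>
       (cut_group (P Mod N) \<and> N \<inter> FC_torsion P = {\<one>\<^bsub>P\<^esub>} \<longrightarrow> cut_group P) \<and>
       (cut_group (P Mod N) \<and> FC_torsion (P\<lparr>carrier := N\<rparr>) = {\<one>\<^bsub>P\<^esub>} \<longrightarrow> cut_group P) \<and>
       (FC_torsion (P Mod N) = {\<one>\<^bsub>P Mod N\<^esub>} \<and> RS_subgroup (FC_torsion (P\<lparr>carrier := N\<rparr>)) P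
          \<longrightarrow> cut_group P) \<and>
       (FC_torsion (P Mod N) = {\<one>\<^bsub>P Mod N\<^esub>} \<and> cut_group (P\<lparr>carrier := N\<rparr>)
          \<longrightarrow> cut_group P)) \<and>
     (group G \<and> group G' \<and> subgroup A G \<and> subgroup A' G' \<and>
        f \<in> iso (G\<lparr>carrier := A\<rparr>) (G'\<lparr>carrier := A'\<rparr>) \<and> P \<cong> amalgam G G' A f \<and>
        (RS_subgroup A G \<or> RS_subgroup A' G') \<and> A \<noteq> carrier G \<and> A' \<noteq> carrier G'
        \<longrightarrow> cut_group P) \<and>
     ((\<forall>i\<in>I. group (H i) \<and> carrier (H i) \<noteq> {\<one>\<^bsub>H i\<^esub>}) \<and>
        (\<exists>i\<in>I. \<exists>j\<in>I. i \<noteq> j) \<and> P \<cong> free_product I H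
        \<longrightarrow> cut_group P) \<and>
     (group G \<and> subgroup A G \<and> subgroup B G \<and>
        \<phi> \<in> iso (G\<lparr>carrier := A\<rparr>) (G\<lparr>carrier := B\<rparr>) \<and> P \<cong> HNN_extension G A \<phi> \<and>
        (RS_subgroup A G \<or> RS_subgroup B G)
        \<longrightarrow> cut_group P)"
proof -
  interpret P: group P by (rule assms)
  \<comment> \<open>Finite classes in \<open>P\<close> stay finite in \<open>N\<close>, so the case
    of trivial \<open>\<Phi>\<^sup>+\<close> of \<open>N\<close> falls under the case of trivial
    intersection.\<close>
  have one: "N \<inter> FC_torsion P = {\<one>\<^bsub>P\<^esub>}"
    if N: "N \<lhd> P" and tor: "FC_torsion (P\<lparr>carrier := N\<rparr>) = {\<one>\<^bsub>P\<^esub>}"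
  proof -
    have sub: "subgroup N P" using N by (rule normal_imp_subgroup)
    have "\<one>\<^bsub>P\<^esub> \<in> N \<inter> FC_torsion P"
      using subgroup.one_closed[OF sub] subgroup.one_closed[OF P.subgroup_FC_torsion] by blast
    then show ?thesis using P.FC_torsion_subgroup_subset[OF sub] tor by blast
  qed
  \<comment> \<open>Triviality of \<open>\<Phi>\<^sup>+\<close> of the quotient pushes
    \<open>\<Phi>\<^sup>+\<close> of \<open>P\<close> into \<open>N\<close>, and from there into
    \<open>\<Phi>\<^sup>+\<close> of \<open>N\<close>, where the RS hypothesis applies.\<close>
  have RS: "cut_group P" if N: "N \<lhd> P" and Q: "FC_torsion (P Mod N) = {\<one>\<^bsub>P Mod N\<^esub>}"
    and R: "RS_subgroup (FC_torsion (P\<lparr>carrier := N\<rparr>)) P"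
  proof (rule P.RS_cut_group)
    fix x assume x: "x \<in> FC_torsion P"
    then have "x \<in> FC_torsion (P\<lparr>carrier := N\<rparr>)"
      using P.FC_torsion_subset_normal[OF N Q] P.FC_torsion_subgroup_subset[OF normal_imp_subgroup[OF N]] by blast
    then show "RS_element P x" using R x by (simp add: RS_subgroup_def FC_torsion_def)
  qed
  have i: "N \<lhd> P \<longrightarrow>
       (cut_group (P Mod N) \<and> N \<inter> FC_torsion P = {\<one>\<^bsub>P\<^esub>} \<longrightarrow> cut_group P) \<and>
       (cut_group (P Mod N) \<and> FC_torsion (P\<lparr>carrier := N\<rparr>) = {\<one>\<^bsub>P\<^esub>} \<longrightarrow> cut_group P) \<and>
       (FC_torsion (P Mod N) = {\<one>\<^bsub>P Mod N\<^esub>} \<and> RS_subgroup (FC_torsion (P\<lparr>carrier := N\<rparr>)) P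
          \<longrightarrow> cut_group P) \<and>
       (FC_torsion (P Mod N) = {\<one>\<^bsub>P Mod N\<^esub>} \<and> cut_group (P\<lparr>carrier := N\<rparr>)
          \<longrightarrow> cut_group P)"
  proof (intro impI conjI; elim conjE)
    assume N: "N \<lhd> P"
    show "cut_group P" if "cut_group (P Mod N)" "N \<inter> FC_torsion P = {\<one>\<^bsub>P\<^esub>}"
      by (rule P.cut_group_from_quotient[OF N that])
    show "cut_group P" if "cut_group (P Mod N)" "FC_torsion (P\<lparr>carrier := N\<rparr>) = {\<one>\<^bsub>P\<^esub>}"
      by (rule P.cut_group_from_quotient[OF N that(1) one[OF N that(2)]])
    show "cut_group P"
      if "FC_torsion (P Mod N) = {\<one>\<^bsub>P Mod N\<^esub>}" "RS_subgroup (FC_torsion (P\<lparr>carrier := N\<rparr>)) P"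
      by (rule RS[OF N that])
    show "cut_group P" if "FC_torsion (P Mod N) = {\<one>\<^bsub>P Mod N\<^esub>}" "cut_group (P\<lparr>carrier := N\<rparr>)"
      by (rule P.cut_group_from_normal_cut[OF N that])
  qed
  show ?thesis
  proof (intro conjI i impI; elim conjE)
    assume "group G" "group G'" "subgroup A G" "subgroup A' G'"
      "f \<in> iso (G\<lparr>carrier := A\<rparr>) (G'\<lparr>carrier := A'\<rparr>)" "P \<cong> amalgam G G' A f"
      "RS_subgroup A G \<or> RS_subgroup A' G'" "A \<noteq> carrier G" "A' \<noteq> carrier G'"
    then show "cut_group P" by (rule cut_group_amalgam[OF assms])
  next
    assume "\<forall>i\<in>I. group (H i) \<and> carrier (H i) \<noteq> {\<one>\<^bsub>H i\<^esub>}" "\<exists>i\<in>I. \<exists>j\<in>I. i \<noteq> j"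
      "P \<cong> free_product I H"
    then show "cut_group P" by (intro cut_group_free_product[OF assms]) auto
  next
    assume "group G" "subgroup A G" "subgroup B G"
      "\<phi> \<in> iso (G\<lparr>carrier := A\<rparr>) (G\<lparr>carrier := B\<rparr>)" "P \<cong> HNN_extension G A \<phi>"
      "RS_subgroup A G \<or> RS_subgroup B G"
    then show "cut_group P" by (rule cut_group_HNN[OF assms])
  qed
qed

end
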